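(* Let $D$ be a connected locally-finite digraph with exactly two ends. Then $D$ is connected-homogeneous if and only if it is isomorphic to $J(r)$ for some $r\in\mathbb{N}$.
   Context: A digraph is a set with an irreflexive antisymmetric arc relation $\to$; connectivity and ends refer to the underlying undirected graph (ends of a connected locally-finite graph are equivalence classes of rays, two rays being equivalent if some third ray meets each infinitely often). Locally-finite: every vertex has finitely many in- and out-neighbours. Connected-homogeneous: every isomorphism between finite connected induced subdigraphs extends to an automorphism. For $r\in\mathbb{N}$, $J(r)$ is the digraph with vertex set $\mathbb{Z}\times\{1,\dots,r\}$ and arcs $(i,x)\to(i+1,y)$ for all $i\in\mathbb{Z}$ and $x,y\in\{1,\dots,r\}$. *)

theory Defs
  imports Main
begin

text \<open>A digraph is given by a vertex set V and an arc relation E (set of pairs).\<close>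

definition digraph :: "'a set \<Rightarrow> ('a \<times> 'a) set \<Rightarrow> bool" where
  "digraph V E \<longleftrightarrow> E \<subseteq> V \<times> V \<and> (\<forall>x. (x, x) \<notin> E) \<and> (\<forall>x y. (x, y) \<in> E \<longrightarrow> (y, x) \<notin> E)"

text \<open>Adjacency of the underlying undirected graph, restricted to a vertex set S.\<close>
definition uadj :: "'a set \<Rightarrow> ('a \<times> 'a) set \<Rightarrow> ('a \<times> 'a) set" where
  "uadj S E = {(x, y). x \<in> S \<and> y \<in> S \<and> ((x, y) \<in> E \<or> (y, x) \<in> E)}"

text \<open>The (induced sub)digraph on S is connected (underlying undirected graph).\<close>
definition connected_on :: "'a set \<Rightarrow> ('a \<times> 'a) set \<Rightarrow> bool" where
  "connected_on S E \<longleftrightarrow> S \<noteq> {} \<and> (\<forall>x\<in>S. \<forall>y\<in>S. (x, y) \<in> (uadj S E)\<^sup>*)"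

definition locally_finite :: "'a set \<Rightarrow> ('a \<times> 'a) set \<Rightarrow> bool" where
  "locally_finite V E \<longleftrightarrow> (\<forall>v\<in>V. finite {u. (u, v) \<in> E} \<and> finite {u. (v, u) \<in> E})"

text \<open>A ray: one-way infinite path in the underlying undirected graph.\<close>
definition ray :: "'a set \<Rightarrow> ('a \<times> 'a) set \<Rightarrow> (nat \<Rightarrow> 'a) \<Rightarrow> bool" where
  "ray V E R \<longleftrightarrow> inj R \<and> (\<forall>i. (R i, R (Suc i)) \<in> uadj V E)"

text \<open>Two rays are equivalent if some third ray meets each of them infinitely often.\<close>
definition ray_equiv :: "'a set \<Rightarrow> ('a \<times> 'a) set \<Rightarrow> (nat \<Rightarrow> 'a) \<Rightarrow> (nat \<Rightarrow> 'a) \<Rightarrow> bool" where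
  "ray_equiv V E R1 R2 \<longleftrightarrow> (\<exists>R3. ray V E R3 \<and> infinite {i. R3 i \<in> range R1} \<and> infinite {i. R3 i \<in> range R2})"

definition ends :: "'a set \<Rightarrow> ('a \<times> 'a) set \<Rightarrow> (nat \<Rightarrow> 'a) set set" where
  "ends V E = {R. ray V E R} // {(R1, R2). ray V E R1 \<and> ray V E R2 \<and> ray_equiv V E R1 R2}"

text \<open>f is an isomorphism from the digraph (V,E) to the digraph (W,F).\<close>
definition dg_iso :: "('a \<Rightarrow> 'b) \<Rightarrow> 'a set \<Rightarrow> ('a \<times> 'a) set \<Rightarrow> 'b set \<Rightarrow> ('b \<times> 'b) set \<Rightarrow> bool" where
  "dg_iso f V E W F \<longleftrightarrow> bij_betw f V W \<and> (\<forall>x\<in>V. \<forall>y\<in>V. (x, y) \<in> E \<longleftrightarrow> (f x, f y) \<in> F)"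

definition isomorphic :: "'a set \<Rightarrow> ('a \<times> 'a) set \<Rightarrow> 'b set \<Rightarrow> ('b \<times> 'b) set \<Rightarrow> bool" where
  "isomorphic V E W F \<longleftrightarrow> (\<exists>f. dg_iso f V E W F)"

text \<open>Induced subdigraph on S.\<close>
definition induced :: "'a set \<Rightarrow> ('a \<times> 'a) set \<Rightarrow> ('a \<times> 'a) set" where
  "induced S E = E \<inter> (S \<times> S)"

text \<open>Every isomorphism between finite connected induced subdigraphs extends to an automorphism.\<close>
definition conn_homogeneous :: "'a set \<Rightarrow> ('a \<times> 'a) set \<Rightarrow> bool" where
  "conn_homogeneous V E \<longleftrightarrow>
    (\<forall>S T f. S \<subseteq> V \<and> T \<subseteq> V \<and> finite S \<and> finite T \<and>
       connected_on S (induced S E) \<and> connected_on T (induced T E) \<and>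
       dg_iso f S (induced S E) T (induced T E) \<longrightarrow>
       (\<exists>g. dg_iso g V E V E \<and> (\<forall>x\<in>S. g x = f x)))"

text \<open>J(r): vertices Z x {1..r}, arcs (i,x) -> (i+1,y).\<close>
definition J_verts :: "nat \<Rightarrow> (int \<times> nat) set" where
  "J_verts r = UNIV \<times> {1..r}"

definition J_arcs :: "nat \<Rightarrow> ((int \<times> nat) \<times> (int \<times> nat)) set" where
  "J_arcs r = {((i, x), (j, y)). x \<in> {1..r} \<and> y \<in> {1..r} \<and> j = i + 1}"

end

theory Submission
  imports Defs "HOL.Binomial"
begin

text \<open>
  For the forward direction, let \<open>A\<close> be a side of a finite edge cut separating the two ends.
  Every infinite set with infinite complement and finite coboundary is commensurable
  with \<open>A\<close> or with its complement, so summing the signed size of \<open>B - A\<close> minus \<open>A - B\<close> over all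
  cuts \<open>B\<close> commensurable with \<open>A\<close> and located near \<open>v\<close> gives an integer height \<open>h v\<close> with finite
  fibres on which every automorphism acts as \<open>k \<mapsto> \<plusminus>k + c\<close>. By arc-transitivity the height changes
  by the same amount \<open>\<plusminus>c \<noteq> 0\<close> along every arc, so there are no triangles; exchanging two
  out-neighbours of \<open>v\<close> while fixing an in-neighbour shows that all arcs go up. Hence the digraph is
  graded with finite levels.

  In a graded digraph of degree \<open>d \<ge> 2\<close>, let \<open>j\<close> be least such that two distinct out-neighbours of
  some vertex have a common \<open>j\<close>-step descendant; \<open>j\<close> exists because the levels have bounded size.
  If \<open>j = 1\<close>, two vertices have a common out-neighbour iff they have a common in-neighbour, and
  permuting the out-neighbours of \<open>x\<close> while fixing an in-neighbour of \<open>x\<close> forces such vertices to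
  have the same out-neighbours, so consecutive levels are completely joined. If \<open>j \<ge> 2\<close>, any two
  induced paths of the shape \<open>\<rightarrow> \<dots> \<rightarrow> \<leftarrow> \<dots> \<leftarrow>\<close> with legs of length \<open>j\<close> are equivalent, so their ends
  always have a common in-neighbour, which contradicts a count.
\<close>

section \<open>Components, coboundaries and rays\<close>

text \<open>One fixed cut near \<open>v\<close> need not be invariant under the stabiliser of
  \<open>v\<close>, so the height sums over all nearby cuts of one commensurability class. Having
  two ends leaves only the class of \<open>A\<close> and that of its complement, and the sign in the
  action on heights records whether an automorphism swaps them. Finite fibres over an infinite
  vertex set force infinitely many heights, which is what refutes every constant or two-valued
  height.

  Homogeneity speaks only of induced subdigraphs, so each application must first exclude unwanted
  arcs. Before the grading this rests on the absence of triangles, afterwards on comparing levels,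
  and near a confluence on the minimality of \<open>j\<close>.

  The case \<open>j >= 2\<close> splits at 3. For \<open>j >= 3\<close> an in-neighbour can point to
  at most one of the counted ancestors because two-step confluence is still excluded. For
  \<open>j = 2\<close> this fails: both sides of the analogous count equal d(d-1). There is no
  contradiction yet, but the equality yields enough local structure to confine a whole neighbourhood
  of \<open>u\<close> to a set that is too small.\<close>

lemma uadj_sym: "(x, y) \<in> uadj S E \<Longrightarrow> (y, x) \<in> uadj S E"
  by (auto simp: uadj_def)

lemma uadj_rtrancl_sym: "(x, y) \<in> (uadj S E)\<^sup>* \<Longrightarrow> (y, x) \<in> (uadj S E)\<^sup>*"
  by (metis uadj_sym sym_rtrancl sym_def symI)

lemma uadj_mono: "S \<subseteq> T \<Longrightarrow> uadj S E \<subseteq> uadj T E"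
  by (auto simp: uadj_def)

lemma uadj_rtrancl_mono: "S \<subseteq> T \<Longrightarrow> (x, y) \<in> (uadj S E)\<^sup>* \<Longrightarrow> (x, y) \<in> (uadj T E)\<^sup>*"
  using rtrancl_mono[OF uadj_mono] by blast

lemma uadj_rtrancl_in: "(x, y) \<in> (uadj S E)\<^sup>* \<Longrightarrow> x \<in> S \<Longrightarrow> y \<in> S"
  by (induction rule: rtrancl_induct) (auto simp: uadj_def)

lemma connected_onI:
  assumes "c \<in> S" "\<And>x. x \<in> S \<Longrightarrow> (x, c) \<in> (uadj S E)\<^sup>*"
  shows "connected_on S E"
  unfolding connected_on_def using assms uadj_rtrancl_sym by (metis empty_iff rtrancl_trans)

section \<open>Connected components and finite coboundaries\<close>

definition component :: "'a set \<Rightarrow> ('a \<times> 'a) set \<Rightarrow> 'a \<Rightarrow> 'a set" where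
  "component S E x = {y. (x, y) \<in> (uadj S E)\<^sup>*}"

lemma component_self [simp]: "x \<in> component S E x"
  by (simp add: component_def)

lemma component_subset: "x \<in> S \<Longrightarrow> component S E x \<subseteq> S"
  using uadj_rtrancl_in by (fastforce simp: component_def)

lemma component_step: "y \<in> component S E x \<Longrightarrow> (y, z) \<in> uadj S E \<Longrightarrow> z \<in> component S E x"
  by (auto simp: component_def)

lemma component_connected: "connected_on (component S E x) E"
proof (rule connected_onI)
  show "x \<in> component S E x" by simp
  fix y assume "y \<in> component S E x"
  then have "(x, y) \<in> (uadj S E)\<^sup>*" by (simp add: component_def)
  then have "(x, y) \<in> (uadj (component S E x) E)\<^sup>*"
  proof (induction rule: rtrancl_induct)
    case (step y z)
    from step have "y \<in> component S E x" "z \<in> component S E x"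
      by (auto simp: component_def)
    with step have "(y, z) \<in> uadj (component S E x) E" by (auto simp: uadj_def)
    with step.IH show ?case by auto
  qed simp
  then show "(y, x) \<in> (uadj (component S E x) E)\<^sup>*" by (rule uadj_rtrancl_sym)
qed

text \<open>Induction along a walk; the standard way here to spread a property from one vertex over
  a connected set.\<close>

lemma connected_invariant:
  assumes "connected_on S E" "a \<in> S" "P a" "\<And>x y. (x, y) \<in> uadj S E \<Longrightarrow> P x \<Longrightarrow> P y" "b \<in> S"
  shows "P b"
proof -
  have "(a, b) \<in> (uadj S E)\<^sup>*" using assms by (auto simp: connected_on_def)
  then show ?thesis by (induction rule: rtrancl_induct) (use assms in auto)
qed

text \<open>Each coboundary edge is represented once, by the ordered pair leaving \<open>B\<close>;
  passing to the complement swaps the pairs.\<close>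

definition fin_cob :: "'a set \<Rightarrow> ('a \<times> 'a) set \<Rightarrow> 'a set \<Rightarrow> bool" where
  "fin_cob V E B \<longleftrightarrow> B \<subseteq> V \<and> finite {(x, y) \<in> uadj V E. x \<in> B \<and> y \<notin> B}"

lemma fin_cob_compl: assumes "fin_cob V E B" shows "fin_cob V E (V - B)"
proof -
  have "{(x, y) \<in> uadj V E. x \<in> V - B \<and> y \<notin> V - B} \<subseteq> prod.swap ` {(x, y) \<in> uadj V E. x \<in> B \<and> y \<notin> B}"
    by (force simp: uadj_def)
  moreover have "finite (prod.swap ` {(x, y) \<in> uadj V E. x \<in> B \<and> y \<notin> B})"
    using assms by (simp add: fin_cob_def)
  ultimately have "finite {(x, y) \<in> uadj V E. x \<in> V - B \<and> y \<notin> V - B}" by (rule finite_subset)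
  then show ?thesis by (simp add: fin_cob_def)
qed

lemma fin_cob_Int: assumes "fin_cob V E B" "fin_cob V E C" shows "fin_cob V E (B \<inter> C)"
proof -
  have "{(x, y) \<in> uadj V E. x \<in> B \<inter> C \<and> y \<notin> B \<inter> C}
    \<subseteq> {(x, y) \<in> uadj V E. x \<in> B \<and> y \<notin> B} \<union> {(x, y) \<in> uadj V E. x \<in> C \<and> y \<notin> C}"
    by auto
  moreover have "finite ({(x, y) \<in> uadj V E. x \<in> B \<and> y \<notin> B} \<union> {(x, y) \<in> uadj V E. x \<in> C \<and> y \<notin> C})"
    using assms by (simp add: fin_cob_def)
  ultimately have "finite {(x, y) \<in> uadj V E. x \<in> B \<inter> C \<and> y \<notin> B \<inter> C}" by (rule finite_subset)
  then show ?thesis using assms by (auto simp: fin_cob_def)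
qed

section \<open>Rays and limits of finite paths\<close>

lemma ray_in_V: "ray V E R \<Longrightarrow> R i \<in> V"
  by (auto simp: ray_def uadj_def)

lemma ray_finite_vimage: "ray V E R \<Longrightarrow> finite F \<Longrightarrow> finite {i. R i \<in> F}"
  using finite_vimageI[of F R] by (auto simp: ray_def vimage_def)

lemma ray_eventually_avoids:
  assumes "ray V E R" "finite F" obtains m where "\<And>i. i \<ge> m \<Longrightarrow> R i \<notin> F"
proof -
  obtain m where "\<forall>i\<in>{i. R i \<in> F}. i < m"
    using ray_finite_vimage[OF assms] finite_nat_set_iff_bounded by blast
  then show ?thesis using that[of m] by (metis mem_Collect_eq not_le)
qed

lemma ray_tail_connected:
  assumes "ray V E R" "\<And>i. i \<ge> m \<Longrightarrow> R i \<in> S" "i \<ge> m"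
  shows "(R m, R i) \<in> (uadj S E)\<^sup>*"
  using assms(3)
proof (induction rule: dec_induct)
  case (step n)
  have "(R n, R (Suc n)) \<in> uadj S E" using assms(1) assms(2)[of n] assms(2)[of "Suc n"] step
    by (auto simp: ray_def uadj_def)
  then show ?case using step by auto
qed simp

text \<open>An injective ray leaves the finite set of end vertices of the coboundary for good, and
  from then on no step changes side.\<close>

lemma ray_eventually_constant_side:
  assumes "ray V E R" "fin_cob V E B"
  shows "\<not> (infinite {i. R i \<in> B} \<and> infinite {i. R i \<notin> B})"
proof -
  let ?C = "{(x, y) \<in> uadj V E. x \<in> B \<and> y \<notin> B}"
  have fin: "finite (fst ` ?C \<union> snd ` ?C)" using assms(2) by (auto simp: fin_cob_def)
  obtain m where m: "\<And>i. i \<ge> m \<Longrightarrow> R i \<notin> fst ` ?C \<union> snd ` ?C"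
    using ray_eventually_avoids[OF assms(1) fin] by blast
  have st: "R (Suc i) \<in> B \<longleftrightarrow> R i \<in> B" if "i \<ge> m" for i
  proof -
    have e: "(R i, R (Suc i)) \<in> uadj V E" using assms(1) by (auto simp: ray_def)
    note e = e uadj_sym[OF e]
    show ?thesis
    proof (rule ccontr)
      assume "\<not> ?thesis"
      then have "(R i, R (Suc i)) \<in> ?C \<or> (R (Suc i), R i) \<in> ?C" using e by auto
      then have "R i \<in> fst ` ?C \<union> snd ` ?C" by force
      then show False using m that by blast
    qed
  qed
  have all: "R i \<in> B \<longleftrightarrow> R m \<in> B" if "i \<ge> m" for i
    using that by (induction rule: dec_induct) (auto simp: st)
  show ?thesis
  proof (cases "R m \<in> B")
    case True then have "{i. R i \<notin> B} \<subseteq> {..<m}" using all by (metis (no_types, lifting) lessThan_iff linorder_not_le mem_Collect_eq subsetI)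
    then show ?thesis using finite_subset by blast
  next
    case False then have "{i. R i \<in> B} \<subseteq> {..<m}" using all by (metis (no_types, lifting) lessThan_iff linorder_not_le mem_Collect_eq subsetI)
    then show ?thesis using finite_subset by blast
  qed
qed

text \<open>Extensions only append, so the lists converge to a ray. The index of \<open>Q\<close>
  lets the target vary from one extension to the next, as needed for alternating between two
  rays.\<close>

lemma ray_limit:
  assumes base: "Inv xs0"
    and path: "\<And>xs. Inv xs \<Longrightarrow> xs \<noteq> [] \<and> distinct xs \<and> successively (\<lambda>x y. (x, y) \<in> uadj V E) xs"
    and step: "\<And>n xs. Inv xs \<Longrightarrow> \<exists>ys. ys \<noteq> [] \<and> Inv (xs @ ys) \<and> Q (n::nat) (last (xs @ ys))
                  \<and> set (xs @ ys) \<subseteq> set xs \<union> W"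
    and W: "set xs0 \<subseteq> W"
  shows "\<exists>R. ray V E R \<and> (\<forall>n. \<exists>k\<ge>n. Q n (R k)) \<and> range R \<subseteq> W"
proof -
  have "\<exists>L. \<forall>n. (Inv (L n) \<and> set (L n) \<subseteq> W) \<and>
          (\<exists>ys. ys \<noteq> [] \<and> L (Suc n) = L n @ ys \<and> Q n (last (L (Suc n))))"
  proof (rule dependent_nat_choice)
    show "\<exists>x. Inv x \<and> set x \<subseteq> W" using base W by blast
    fix x and n :: nat assume "Inv x \<and> set x \<subseteq> W"
    then show "\<exists>y. (Inv y \<and> set y \<subseteq> W) \<and> (\<exists>ys. ys \<noteq> [] \<and> y = x @ ys \<and> Q n (last y))"
      using step[of x n] by (metis le_sup_iff subset_trans sup.absorb_iff2)
  qed
  then obtain L where L: "\<And>n. Inv (L n)" "\<And>n. set (L n) \<subseteq> W"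
    and Ls: "\<And>n. \<exists>ys. ys \<noteq> [] \<and> L (Suc n) = L n @ ys \<and> Q n (last (L (Suc n)))" by blast
  have ext: "\<exists>ys. L n = L m @ ys" if "m \<le> n" for m n
    using that
  proof (induction rule: dec_induct)
    case (step n) then show ?case using Ls[of n] by auto
  qed simp
  have len: "length (L n) > n" for n
  proof (induction n)
    case 0 show ?case using path[OF L(1)[of 0]] by auto
  next
    case (Suc n) obtain ys where "ys \<noteq> []" "L (Suc n) = L n @ ys" using Ls by blast
    then show ?case using Suc by (cases ys) auto
  qed
  \<comment> \<open>The \<open>i\<close>-th list has more than \<open>i\<close> entries, so this
    entry exists, and all later lists agree with it.\<close>
  define R where "R i = L i ! i" for i
  have R: "L n ! i = R i" if "i < length (L n)" for n i
  proof (cases "n \<le> i")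
    case True then show ?thesis using ext[OF True] that by (auto simp: R_def nth_append)
  next
    case False then have "i \<le> n" by simp
    then show ?thesis using ext[of i n] len[of i] by (auto simp: R_def nth_append)
  qed
  have "inj R"
  proof (rule injI)
    fix i j assume e: "R i = R j"
    let ?n = "max i j"
    have l: "i < length (L ?n)" "j < length (L ?n)" using len[of ?n] by auto
    then have "L ?n ! i = L ?n ! j" using e R by simp
    then show "i = j" using path[OF L(1)[of ?n]] l nth_eq_iff_index_eq by blast
  qed
  moreover have "(R i, R (Suc i)) \<in> uadj V E" for i
  proof -
    have "Suc i < length (L (Suc i))" using len by blast
    moreover have "successively (\<lambda>x y. (x, y) \<in> uadj V E) (L (Suc i))" using path[OF L(1)] by blast
    ultimately show ?thesis using R[of i "Suc i"] R[of "Suc i" "Suc i"]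
      by (auto simp: successively_conv_nth)
  qed
  ultimately have "ray V E R" by (auto simp: ray_def)
  moreover have "\<exists>k\<ge>n. Q n (R k)" for n
  proof -
    have ne: "L (Suc n) \<noteq> []" using path[OF L(1)] by blast
    have "R (length (L (Suc n)) - 1) = last (L (Suc n))"
      using R[of "length (L (Suc n)) - 1" "Suc n"] ne by (simp add: last_conv_nth)
    moreover have "length (L (Suc n)) - 1 \<ge> n" using len[of "Suc n"] by auto
    ultimately show ?thesis using Ls[of n] by metis
  qed
  moreover have "range R \<subseteq> W" using L(2) nth_mem[OF len] by (auto simp: R_def subset_iff)
  ultimately show ?thesis by blast
qed

text \<open>The walk is stopped at its first visit to \<open>Z\<close> and freed of loops: a vertex
  that occurs again later becomes the new start of the path.\<close>

lemma path_to_set: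
  assumes "(p, q) \<in> r\<^sup>*" "q \<in> Z" "p \<notin> Z"
  shows "\<exists>ys. ys \<noteq> [] \<and> distinct (p # ys) \<and> successively (\<lambda>x y. (x, y) \<in> r) (p # ys)
           \<and> last ys \<in> Z \<and> set (butlast ys) \<inter> Z = {}"
  using assms(1,3)
proof (induction rule: converse_rtrancl_induct)
  case base then show ?case using assms(2) by simp
next
  case (step p p1)
  show ?case
  proof (cases "p1 \<in> Z")
    case True then show ?thesis using step by (intro exI[of _ "[p1]"]) auto
  next
    case False
    then obtain ys where ys: "ys \<noteq> []" "distinct (p1 # ys)"
      "successively (\<lambda>x y. (x, y) \<in> r) (p1 # ys)" "last ys \<in> Z" "set (butlast ys) \<inter> Z = {}"
      using step.IH by blast
    show ?thesis
    proof (cases "p \<in> set (p1 # ys)")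
      case F: False
      then show ?thesis using ys step False by (intro exI[of _ "p1 # ys"]) auto
    next
      case True
      then obtain as bs where ab: "p1 # ys = as @ p # bs" by (meson split_list)
      have bs: "bs \<noteq> []"
      proof
        assume "bs = []"
        then have "last (p1 # ys) = p" using ab by (metis last_snoc)
        then show False using ys step.prems by simp
      qed
      have "last bs = last ys" using ab bs ys(1) by (metis last.simps last_append last_ConsR list.distinct(1))
      moreover have "butlast (p1 # ys) = as @ p # butlast bs" using ab bs by (simp add: butlast_append)
      then have "set (butlast bs) \<subseteq> set (p1 # butlast ys)" using ys(1) by (metis (no_types, lifting) Un_iff butlast.simps(2) list.set_intros(2) set_append subsetI)
      moreover have "distinct (p # bs)" using ab ys(2) by (metis distinct_append)
      moreover have "successively (\<lambda>x y. (x, y) \<in> r) (p # bs)"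
        using ab ys(3) by (metis successively_append_iff)
      ultimately show ?thesis using ys bs False by (intro exI[of _ bs]) auto
    qed
  qed
qed

section \<open>Rays and ends of a connected locally finite graph\<close>

locale lf_graph =
  fixes V :: "'a set" and E :: "('a \<times> 'a) set"
  assumes conn: "connected_on V E" and lf: "locally_finite V E"
begin

lemma finite_nbrs: "finite {y. (x, y) \<in> uadj V E}"
proof (cases "x \<in> V")
  case True
  have "{y. (x, y) \<in> uadj V E} \<subseteq> {u. (u, x) \<in> E} \<union> {u. (x, u) \<in> E}" by (auto simp: uadj_def)
  then show ?thesis using lf True by (auto simp: locally_finite_def intro: finite_subset)
qed (simp add: uadj_def)

lemma walk_in_V: "x \<in> V \<Longrightarrow> y \<in> V \<Longrightarrow> (x, y) \<in> (uadj V E)\<^sup>*"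
  using conn by (auto simp: connected_on_def)

text \<open>The path is led only to its first contact with a tail of \<open>R\<close>, so the ray
  beyond the contact point stays off the earlier vertices and the extension can be repeated.\<close>

lemma ray_extend_towards:
  assumes R: "ray V E R" and ne: "xs \<noteq> []" and d: "distinct xs"
    and s: "successively (\<lambda>x y. (x, y) \<in> uadj V E) xs"
    and av: "\<And>i. i \<ge> m \<Longrightarrow> R i \<notin> set (butlast xs)"
    and reach: "(last xs, R m) \<in> (uadj (V - set (butlast xs)) E)\<^sup>*"
    and V: "set xs \<subseteq> V"
  shows "\<exists>ys m'. ys \<noteq> [] \<and> distinct (xs @ ys) \<and> successively (\<lambda>x y. (x, y) \<in> uadj V E) (xs @ ys)
     \<and> set (xs @ ys) \<subseteq> V \<and> last (xs @ ys) = R m' \<and> (\<forall>i\<ge>m'. R i \<notin> set (butlast (xs @ ys)))"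
proof -
  let ?F = "set (butlast xs)"
  obtain m1 where m1: "\<And>i. i \<ge> m1 \<Longrightarrow> R i \<notin> set xs"
    using ray_eventually_avoids[OF R, of "set xs"] by auto
  \<comment> \<open>Beyond \<open>m2\<close> the ray also avoids \<open>last xs\<close>, so the
    connecting path starts outside the tail it aims at.\<close>
  define m2 where "m2 = max m m1"
  have "(R m, R m2) \<in> (uadj (V - ?F) E)\<^sup>*"
    by (rule ray_tail_connected[OF R]) (use av ray_in_V[OF R] in \<open>auto simp: m2_def\<close>)
  with reach have "(last xs, R m2) \<in> (uadj (V - ?F) E)\<^sup>*" by auto
  moreover have "last xs \<notin> R ` {m2..}" using m1 last_in_set[OF ne] by (force simp: m2_def)
  ultimately obtain ys where ys: "ys \<noteq> []" "distinct (last xs # ys)"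
    "successively (\<lambda>x y. (x, y) \<in> uadj (V - ?F) E) (last xs # ys)"
    "last ys \<in> R ` {m2..}" "set (butlast ys) \<inter> R ` {m2..} = {}"
    using path_to_set[of "last xs" "R m2" "uadj (V - ?F) E" "R ` {m2..}"] by blast
  have ysV: "set ys \<subseteq> V - ?F"
  proof
    fix y assume "y \<in> set ys"
    then obtain i where i: "i < length ys" "y = ys ! i" by (metis in_set_conv_nth)
    then have "((last xs # ys) ! i, y) \<in> uadj (V - ?F) E"
      using ys(3) by (auto simp: successively_conv_nth)
    then show "y \<in> V - ?F" by (simp add: uadj_def)
  qed
  obtain m' where m': "m' \<ge> m2" "last ys = R m'" using ys(4) by auto
  have xs: "set xs = insert (last xs) ?F"
    using ne by (cases xs rule: rev_cases) auto
  have "distinct (xs @ ys)" using d ys(2) ysV xs by auto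
  moreover have s2: "successively (\<lambda>x y. (x, y) \<in> uadj V E) (last xs # ys)"
    by (rule successively_mono[OF ys(3)]) (use uadj_mono[of "V - ?F" V E] in auto)
  then have "successively (\<lambda>x y. (x, y) \<in> uadj V E) (xs @ ys)"
    using s ys(1) by (cases ys) (auto simp: successively_append_iff)
  moreover have "last (xs @ ys) = R m'" using ys(1) m' by simp
  moreover have "R i \<notin> set (butlast (xs @ ys))" if "i \<ge> m'" for i
  proof -
    have "R i \<notin> set xs" using m1 that m' by (auto simp: m2_def)
    moreover have "R i \<notin> set (butlast ys)" using ys(5) that m' by auto
    ultimately show ?thesis using ys(1) by (simp add: butlast_append)
  qed
  moreover have "set (xs @ ys) \<subseteq> V" using V ysV by auto
  ultimately show ?thesis using ys(1) by blast
qed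

text \<open>The third ray is the limit of finite paths that alternately hit the two rays; the invariant is that the
  endpoint can still reach tails of both rays avoiding the rest of the path.\<close>

lemma rays_separated:
  assumes R1: "ray V E R1" and R2: "ray V E R2" and neq: "\<not> ray_equiv V E R1 R2"
  shows "\<exists>F m. finite F \<and> (\<forall>i\<ge>m. R1 i \<notin> F \<and> R2 i \<notin> F) \<and> (R1 m, R2 m) \<notin> (uadj (V - F) E)\<^sup>*"
proof (rule ccontr)
  assume "\<not> ?thesis"
  then have nsep: "\<And>F m. finite F \<Longrightarrow> (\<forall>i\<ge>m. R1 i \<notin> F \<and> R2 i \<notin> F) \<Longrightarrow> (R1 m, R2 m) \<in> (uadj (V - F) E)\<^sup>*"
    by blast
  define Inv where "Inv xs \<longleftrightarrow> xs \<noteq> [] \<and> distinct xs \<and> successively (\<lambda>x y. (x, y) \<in> uadj V E) xs \<and>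
    set xs \<subseteq> V \<and> (\<exists>m. (\<forall>i\<ge>m. R1 i \<notin> set (butlast xs) \<and> R2 i \<notin> set (butlast xs)) \<and>
      (last xs, R1 m) \<in> (uadj (V - set (butlast xs)) E)\<^sup>* \<and> (last xs, R2 m) \<in> (uadj (V - set (butlast xs)) E)\<^sup>*)" for xs
  \<comment> \<open>A path that has just reached one of the rays satisfies the invariant: a tail of
    that ray is reached along the ray itself, and a tail of the other one because no finite set
    separates the two.\<close>
  have InvI: "Inv xs" if xs: "xs \<noteq> []" "distinct xs" "successively (\<lambda>x y. (x, y) \<in> uadj V E) xs" "set xs \<subseteq> V"
    and R: "R = R1 \<or> R = R2" and l: "last xs = R m" "\<forall>i\<ge>m. R i \<notin> set (butlast xs)" for xs R m
  proof -
    let ?F = "set (butlast xs)"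
    obtain n1 where n1: "\<And>i. i \<ge> n1 \<Longrightarrow> R1 i \<notin> ?F" using ray_eventually_avoids[OF R1, of ?F] by auto
    obtain n2 where n2: "\<And>i. i \<ge> n2 \<Longrightarrow> R2 i \<notin> ?F" using ray_eventually_avoids[OF R2, of ?F] by auto
    define n where "n = max m (max n1 n2)"
    have av: "\<forall>i\<ge>n. R1 i \<notin> ?F \<and> R2 i \<notin> ?F" using n1 n2 by (auto simp: n_def)
    have rR: "ray V E R" using R R1 R2 by blast
    have "(R m, R n) \<in> (uadj (V - ?F) E)\<^sup>*"
      by (rule ray_tail_connected[OF rR]) (use l ray_in_V[OF rR] in \<open>auto simp: n_def\<close>)
    moreover have c: "(R1 n, R2 n) \<in> (uadj (V - ?F) E)\<^sup>*" using nsep[OF _ av] by simp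
    moreover have "(R2 n, R1 n) \<in> (uadj (V - ?F) E)\<^sup>*" using c by (rule uadj_rtrancl_sym)
    ultimately have "(last xs, R1 n) \<in> (uadj (V - ?F) E)\<^sup>*" "(last xs, R2 n) \<in> (uadj (V - ?F) E)\<^sup>*"
      using R l by (auto intro: rtrancl_trans)
    then show ?thesis using xs av unfolding Inv_def by blast
  qed
  define Q where "Q n v \<longleftrightarrow> (if even n then v \<in> range R1 else v \<in> range R2)" for n :: nat and v
  have "\<exists>R. ray V E R \<and> (\<forall>n. \<exists>k\<ge>n. Q n (R k)) \<and> range R \<subseteq> V"
  proof (rule ray_limit[where Inv = Inv and ?xs0.0 = "[R1 0]"])
    show "Inv [R1 0]" by (rule InvI[of _ R1 0]) (use ray_in_V[OF R1] in auto)
    show "set [R1 0] \<subseteq> V" using ray_in_V[OF R1] by auto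
    fix xs assume I: "Inv xs"
    then show "xs \<noteq> [] \<and> distinct xs \<and> successively (\<lambda>x y. (x, y) \<in> uadj V E) xs"
      by (simp add: Inv_def)
    fix n :: nat
    define R where "R = (if even n then R1 else R2)"
    have R: "ray V E R" "R = R1 \<or> R = R2" using R1 R2 by (auto simp: R_def)
    obtain m where "\<And>i. i \<ge> m \<Longrightarrow> R i \<notin> set (butlast xs)" "(last xs, R m) \<in> (uadj (V - set (butlast xs)) E)\<^sup>*"
      using I R(2) unfolding Inv_def by blast
    then obtain ys m' where ys: "ys \<noteq> []" "distinct (xs @ ys)" "successively (\<lambda>x y. (x, y) \<in> uadj V E) (xs @ ys)"
       "set (xs @ ys) \<subseteq> V" "last (xs @ ys) = R m'" "\<forall>i\<ge>m'. R i \<notin> set (butlast (xs @ ys))"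
      using ray_extend_towards[OF R(1), of xs m] I unfolding Inv_def by blast
    have "Inv (xs @ ys)" by (rule InvI[OF _ ys(2-4) R(2) ys(5,6)]) (use ys(1) in simp)
    moreover have "Q n (last (xs @ ys))" unfolding Q_def ys(5) by (simp add: R_def)
    ultimately show "\<exists>ys. ys \<noteq> [] \<and> Inv (xs @ ys) \<and> Q n (last (xs @ ys)) \<and> set (xs @ ys) \<subseteq> set xs \<union> V"
      using ys(1,4) by blast
  qed
  then obtain R where R: "ray V E R" "\<And>n. \<exists>k\<ge>n. Q n (R k)" by blast
  have unb: "infinite I" if "\<And>m. \<exists>k\<ge>m. k \<in> I" for I :: "nat set"
    using that unfolding finite_nat_set_iff_bounded by (meson not_le)
  have "infinite {i. R i \<in> range R1}"
  proof (rule unb)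
    fix m
    obtain k where "k \<ge> 2*m" "Q (2*m) (R k)" using R(2) by blast
    then show "\<exists>k\<ge>m. k \<in> {i. R i \<in> range R1}" by (intro exI[of _ k]) (auto simp: Q_def)
  qed
  moreover have "infinite {i. R i \<in> range R2}"
  proof (rule unb)
    fix m
    obtain k where "k \<ge> 2*m+1" "Q (2*m+1) (R k)" using R(2) by blast
    then show "\<exists>k\<ge>m. k \<in> {i. R i \<in> range R2}" by (intro exI[of _ k]) (auto simp: Q_def)
  qed
  ultimately show False using neq R(1) by (auto simp: ray_equiv_def)
qed

text \<open>Koenig's lemma: the last vertex always lies in an infinite component of \<open>W\<close>
  without the earlier vertices. Deleting it as well leaves finitely many pieces, each containing one
  of its neighbours, and one piece is infinite.\<close>

lemma infinite_connected_has_ray: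
  assumes W: "W \<subseteq> V" "connected_on W E" "infinite W"
  shows "\<exists>R. ray V E R \<and> range R \<subseteq> W"
proof -
  define Inv where "Inv xs \<longleftrightarrow> xs \<noteq> [] \<and> distinct xs \<and> successively (\<lambda>x y. (x, y) \<in> uadj V E) xs \<and>
    set xs \<subseteq> W \<and> infinite (component (W - set (butlast xs)) E (last xs))" for xs
  obtain a where a: "a \<in> W" using W(2) by (auto simp: connected_on_def)
  have "\<exists>R. ray V E R \<and> (\<forall>n::nat. \<exists>k\<ge>n. True) \<and> range R \<subseteq> W"
  proof (rule ray_limit[where Inv = Inv and ?xs0.0 = "[a]"])
    have "component W E a = W"
      using W(2) a component_subset[OF a] by (auto simp: component_def connected_on_def)
    then show "Inv [a]" using a W by (simp add: Inv_def)
    show "set [a] \<subseteq> W" using a by simp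
    fix xs assume I: "Inv xs"
    then show "xs \<noteq> [] \<and> distinct xs \<and> successively (\<lambda>x y. (x, y) \<in> uadj V E) xs"
      by (simp add: Inv_def)
    fix n :: nat
    let ?F = "set (butlast xs)" and ?p = "last xs"
    let ?N = "{q. (?p, q) \<in> uadj (W - ?F) E \<and> q \<noteq> ?p}"
    have xs: "set xs = insert ?p ?F"
      using I unfolding Inv_def by (cases xs rule: rev_cases) auto
    have "component (W - ?F) E ?p \<subseteq> insert ?p (\<Union>q\<in>?N. component (W - set xs) E q)"
    proof
      fix y assume "y \<in> component (W - ?F) E ?p"
      then have "(?p, y) \<in> (uadj (W - ?F) E)\<^sup>*" by (simp add: component_def)
      then show "y \<in> insert ?p (\<Union>q\<in>?N. component (W - set xs) E q)"
      proof (induction rule: rtrancl_induct)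
        case (step y z)
        show ?case
        proof (cases "z = ?p \<or> y = ?p")
          case True
          have "z \<noteq> ?p \<Longrightarrow> z \<in> component (W - set xs) E z" by simp
          then show ?thesis using True step.hyps by blast
        next
          case False
          then obtain q where q: "q \<in> ?N" "y \<in> component (W - set xs) E q" using step.IH by blast
          have "(y, z) \<in> uadj (W - set xs) E" using step.hyps False xs by (auto simp: uadj_def)
          then have "z \<in> component (W - set xs) E q" by (rule component_step[OF q(2)])
          then show ?thesis using q(1) by blast
        qed
      qed simp
    qed
    moreover have "finite ?N" by (rule finite_subset[OF _ finite_nbrs[of ?p]]) (use W(1) in \<open>auto simp: uadj_def\<close>)
    ultimately obtain q where q: "q \<in> ?N" "infinite (component (W - set xs) E q)"
      using I unfolding Inv_def by (meson finite_UN_I finite_insert finite_subset)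
    have qW: "q \<in> W" "q \<notin> set xs" "(?p, q) \<in> uadj V E" using q(1) xs W(1) by (auto simp: uadj_def)
    have "Inv (xs @ [q])" using I q(2) qW by (auto simp: Inv_def successively_append_iff)
    then show "\<exists>ys. ys \<noteq> [] \<and> Inv (xs @ ys) \<and> True \<and> set (xs @ ys) \<subseteq> set xs \<union> W"
      using qW by (intro exI[of _ "[q]"]) auto
  qed
  then show ?thesis by blast
qed

text \<open>Unless \<open>B = V\<close>, every component of \<open>B\<close> contains an end of a
  coboundary edge, so there are finitely many components and one of them is infinite.\<close>

lemma infinite_fin_cob_has_ray:
  assumes B: "fin_cob V E B" "infinite B"
  shows "\<exists>R. ray V E R \<and> range R \<subseteq> B"
proof (cases "B = V")
  case True then show ?thesis using infinite_connected_has_ray[of V] conn B by auto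
next
  case False
  have BV: "B \<subseteq> V" using B by (simp add: fin_cob_def)
  with False obtain z where z: "z \<in> V" "z \<notin> B" by blast
  let ?C = "{(x, y) \<in> uadj V E. x \<in> B \<and> y \<notin> B}"
  have "B \<subseteq> (\<Union>x\<in>fst ` ?C. component B E x)"
  proof
    fix b assume b: "b \<in> B"
    have "(b, z) \<in> (uadj V E)\<^sup>*" using walk_in_V b BV z by auto
    then have "b \<in> B \<longrightarrow> (\<exists>x\<in>fst ` ?C. b \<in> component B E x)"
    proof (induction rule: converse_rtrancl_induct)
      case base then show ?case using z by simp
    next
      case (step b c)
      show ?case
      proof (intro impI)
        assume bB: "b \<in> B"
        show "\<exists>x\<in>fst ` ?C. b \<in> component B E x"
        proof (cases "c \<in> B")
          case True
          then obtain x where x: "x \<in> fst ` ?C" "c \<in> component B E x" using step.IH by blast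
          have "(c, b) \<in> uadj B E" using step.hyps bB True by (auto simp: uadj_def)
          then have "b \<in> component B E x" by (rule component_step[OF x(2)])
          then show ?thesis using x(1) by blast
        next
          case False
          then have "(b, c) \<in> ?C" using step.hyps bB by simp
          then show ?thesis by (metis (no_types, lifting) component_self fst_conv image_eqI)
        qed
      qed
    qed
    then show "b \<in> (\<Union>x\<in>fst ` ?C. component B E x)" using b by blast
  qed
  moreover have "finite (fst ` ?C)" using B by (simp add: fin_cob_def)
  ultimately obtain x where x: "x \<in> fst ` ?C" "infinite (component B E x)"
    using B(2) by (meson finite_UN_I finite_subset)
  then have "component B E x \<subseteq> B" by (intro component_subset) auto
  then show ?thesis using infinite_connected_has_ray[OF _ component_connected x(2)] BV by blast
qed

lemma ray_equiv_refl: "ray V E R \<Longrightarrow> ray_equiv V E R R"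
  unfolding ray_equiv_def by (intro exI[of _ R]) auto

text \<open>A third ray meeting both infinitely often would visit both sides of a finite coboundary
  infinitely often.\<close>

lemma rays_in_disjoint_inequivalent:
  assumes "fin_cob V E B" "range R1 \<subseteq> B" "range R2 \<inter> B = {}"
  shows "\<not> ray_equiv V E R1 R2"
proof
  assume "ray_equiv V E R1 R2"
  then obtain R where R: "ray V E R" "infinite {i. R i \<in> range R1}" "infinite {i. R i \<in> range R2}"
    by (auto simp: ray_equiv_def)
  have "infinite {i. R i \<in> B}" using R(2) by (rule infinite_super[rotated]) (use assms in auto)
  moreover have "infinite {i. R i \<notin> B}" using R(3) by (rule infinite_super[rotated]) (use assms in auto)
  ultimately show False using ray_eventually_constant_side[OF R(1) assms(1)] by blast
qed

definition end_of :: "(nat \<Rightarrow> 'a) \<Rightarrow> (nat \<Rightarrow> 'a) set" where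
  "end_of R = {R'. ray V E R' \<and> ray_equiv V E R R'}"

lemma ends_eq: "ends V E = end_of ` {R. ray V E R}"
proof -
  have "{(R1, R2). ray V E R1 \<and> ray V E R2 \<and> ray_equiv V E R1 R2} `` {R} = end_of R" if "ray V E R" for R
    using that by (simp add: end_of_def Image_def)
  then show ?thesis unfolding ends_def quotient_def UNION_singleton_eq_range by (intro image_cong) auto
qed

lemma no_three_ends:
  assumes two: "card (ends V E) = 2"
    and B: "fin_cob V E B1" "fin_cob V E B2" "fin_cob V E B3"
    and inf: "infinite B1" "infinite B2" "infinite B3"
    and disj: "B1 \<inter> B2 = {}" "B1 \<inter> B3 = {}" "B2 \<inter> B3 = {}"
  shows False
proof -
  obtain R1 where R1: "ray V E R1" "range R1 \<subseteq> B1" using infinite_fin_cob_has_ray[OF B(1) inf(1)] by blast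
  obtain R2 where R2: "ray V E R2" "range R2 \<subseteq> B2" using infinite_fin_cob_has_ray[OF B(2) inf(2)] by blast
  obtain R3 where R3: "ray V E R3" "range R3 \<subseteq> B3" using infinite_fin_cob_has_ray[OF B(3) inf(3)] by blast
  have d: "range R2 \<inter> B1 = {}" "range R3 \<inter> B1 = {}" "range R3 \<inter> B2 = {}" using R2 R3 disj by blast+
  note ne = rays_in_disjoint_inequivalent[OF B(1) R1(2) d(1)] rays_in_disjoint_inequivalent[OF B(1) R1(2) d(2)]
    rays_in_disjoint_inequivalent[OF B(2) R2(2) d(3)]
  \<comment> \<open>Each ray lies in its own class by reflexivity, which tells the three classes
    apart.\<close>
  have "R2 \<in> end_of R2 - end_of R1" "R3 \<in> end_of R3 - end_of R1" "R3 \<in> end_of R3 - end_of R2"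
    using ne R2(1) R3(1) ray_equiv_refl by (simp_all add: end_of_def)
  then have "end_of R1 \<noteq> end_of R2" "end_of R1 \<noteq> end_of R3" "end_of R2 \<noteq> end_of R3" by auto
  then have "card {end_of R1, end_of R2, end_of R3} = 3" by simp
  \<comment> \<open>Infinite sets have \<open>card\<close> 0, so \<open>card\<close> 2 already
    carries finiteness.\<close>
  moreover have "finite (ends V E)" using two by (metis card.infinite zero_neq_numeral)
  then have "card {end_of R1, end_of R2, end_of R3} \<le> card (ends V E)"
    by (rule card_mono) (use R1 R2 R3 in \<open>simp add: ends_eq\<close>)
  ultimately show False using two by simp
qed

text \<open>Taking a component twice makes both sides connected: \<open>C1\<close> is a component
  off the separator \<open>F\<close>, and \<open>C2\<close> is a component off \<open>C1\<close>.
  All other components off \<open>C1\<close> remain attached to \<open>C1\<close>. Connectedness of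
  both sides is what later locates cuts that lie far from the coboundary of
  \<open>A\<close>.\<close>

lemma two_ended_cut:
  assumes two: "card (ends V E) = 2"
  shows "\<exists>A\<subseteq>V. infinite A \<and> infinite (V - A) \<and> connected_on A E \<and> connected_on (V - A) E \<and> fin_cob V E A"
proof -
  have "\<exists>R1 R2. ray V E R1 \<and> ray V E R2 \<and> \<not> ray_equiv V E R1 R2"
  proof (rule ccontr)
    assume "\<not> ?thesis"
    then have "end_of R = {R. ray V E R}" if "ray V E R" for R using that by (auto simp: end_of_def)
    then have "ends V E \<subseteq> {{R. ray V E R}}" by (auto simp: ends_eq)
    then have "card (ends V E) \<le> card {{R. ray V E R}}" by (intro card_mono) auto
    then show False using two by simp
  qed
  then obtain R1 R2 F m where R1: "ray V E R1" and R2: "ray V E R2" and F: "finite F"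
    and av: "\<And>i. i \<ge> m \<Longrightarrow> R1 i \<notin> F \<and> R2 i \<notin> F" and sep: "(R1 m, R2 m) \<notin> (uadj (V - F) E)\<^sup>*"
    using rays_separated by (metis (no_types, lifting))
  define C1 where "C1 = component (V - F) E (R1 m)"
  have C1: "C1 \<subseteq> V - F" unfolding C1_def using component_subset av ray_in_V[OF R1] by (metis DiffI order_refl)
  have tail1: "R1 i \<in> C1" if "i \<ge> m" for i
    using ray_tail_connected[OF R1, of m "V - F" i] that av ray_in_V[OF R1] by (auto simp: C1_def component_def)
  have tail2: "R2 i \<notin> C1" if "i \<ge> m" for i
  proof
    assume "R2 i \<in> C1"
    moreover have "(R2 m, R2 i) \<in> (uadj (V - F) E)\<^sup>*"
      using ray_tail_connected[OF R2, of m "V - F" i] that av ray_in_V[OF R2] by auto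
    ultimately show False using sep uadj_rtrancl_sym by (metis C1_def component_def mem_Collect_eq rtrancl_trans)
  qed
  define C2 where "C2 = component (V - C1) E (R2 m)"
  have C2: "C2 \<subseteq> V - C1" unfolding C2_def using component_subset tail2 ray_in_V[OF R2] by (metis DiffI order_refl)
  have tail2': "R2 i \<in> C2" if "i \<ge> m" for i
    using ray_tail_connected[OF R2, of m "V - C1" i] that tail2 ray_in_V[OF R2] by (auto simp: C2_def component_def)
  have inf: "infinite W" if "ray V E R" "\<And>i. i \<ge> m \<Longrightarrow> R i \<in> W" for R W
  proof
    assume "finite W"
    then have "finite {i. R i \<in> W}" by (rule ray_finite_vimage[OF that(1)])
    moreover have "{m..} \<subseteq> {i. R i \<in> W}" using that(2) by auto
    ultimately show False using infinite_Ici finite_subset by blast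
  qed
  \<comment> \<open>Every coboundary edge of \<open>C2\<close> runs from \<open>F\<close> to
    \<open>C1\<close>, so local finiteness bounds their number.\<close>
  have bd: "y \<in> C1 \<and> x \<in> F" if "(x, y) \<in> uadj V E" "x \<in> C2" "y \<notin> C2" for x y
  proof -
    have y: "y \<in> C1" using that C2 component_step[of x "V - C1" E "R2 m" y] by (auto simp: C2_def uadj_def)
    have "x \<in> F"
    proof (rule ccontr)
      assume "x \<notin> F"
      then have "(y, x) \<in> uadj (V - F) E" using that(1) y C1 by (auto simp: uadj_def)
      then have "x \<in> C1" using y component_step unfolding C1_def by fast
      then show False using that C2 by blast
    qed
    with y show ?thesis by blast
  qed
  have "{(x, y) \<in> uadj V E. x \<in> C2 \<and> y \<notin> C2} \<subseteq> (SIGMA x:F. {y. (x, y) \<in> uadj V E})" using bd by auto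
  then have "fin_cob V E C2" using C2 F finite_nbrs
    by (auto simp: fin_cob_def intro: finite_subset[OF _ finite_SigmaI])
  moreover have "infinite C2" using inf[OF R2] tail2' by blast
  moreover have "infinite (V - C2)" using inf[OF R1, of "V - C2"] tail1 C2 ray_in_V[OF R1] by blast
  moreover have "connected_on C2 E" unfolding C2_def by (rule component_connected)
  moreover have "connected_on (V - C2) E"
  proof (rule connected_onI)
    show c: "R1 m \<in> V - C2" using tail1 C2 ray_in_V[OF R1] by blast
    fix x assume x: "x \<in> V - C2"
    have "(x, R1 m) \<in> (uadj V E)\<^sup>*" using walk_in_V x ray_in_V[OF R1] by blast
    then have "x \<notin> C2 \<longrightarrow> (x, R1 m) \<in> (uadj (V - C2) E)\<^sup>*"
    proof (induction rule: converse_rtrancl_induct)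
      case (step x y)
      show ?case
      proof
        assume xC: "x \<notin> C2"
        show "(x, R1 m) \<in> (uadj (V - C2) E)\<^sup>*"
        proof (cases "y \<in> C2")
          case True
          then have "x \<in> C1" using bd[OF uadj_sym[OF step.hyps(1)]] xC by blast
          then have "(R1 m, x) \<in> (uadj C1 E)\<^sup>*"
            using component_connected[of "V - F" E "R1 m"] component_self[of "R1 m" "V - F" E]
            unfolding C1_def connected_on_def by blast
          then have "(R1 m, x) \<in> (uadj (V - C2) E)\<^sup>*" by (rule uadj_rtrancl_mono[rotated]) (use C1 C2 in auto)
          then show ?thesis by (rule uadj_rtrancl_sym)
        next
          case False
          then have "(x, y) \<in> uadj (V - C2) E" using xC step.hyps by (auto simp: uadj_def)
          then show ?thesis using step.IH False by auto
        qed
      qed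
    qed simp
    then show "(x, R1 m) \<in> (uadj (V - C2) E)\<^sup>*" using x by blast
  qed
  ultimately show ?thesis using C2 by blast
qed

end

section \<open>A height function compatible with all automorphisms\<close>

lemma relpow_sym:
  assumes "\<And>x y. (x, y) \<in> r \<Longrightarrow> (y, x) \<in> r" "(x, y) \<in> r ^^ n"
  shows "(y, x) \<in> r ^^ n"
  using assms(2)
proof (induction n arbitrary: x y)
  case (Suc n)
  then obtain z where "(x, z) \<in> r ^^ n" "(z, y) \<in> r" by auto
  then show ?case using Suc.IH assms(1) relpow_Suc_I2 by metis
qed simp

section \<open>Signed difference of commensurable sets\<close>

definition excess :: "'a set \<Rightarrow> 'a set \<Rightarrow> int" where
  "excess X Y = int (card (X - Y)) - int (card (Y - X))"

lemma excess_eq: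
  assumes "finite U" "X - Y \<subseteq> U" "Y - X \<subseteq> U"
  shows "excess X Y = int (card (X \<inter> U)) - int (card (Y \<inter> U))"
proof -
  have X: "card (X \<inter> U) = card (X - Y) + card (X \<inter> Y \<inter> U)"
    using assms by (subst card_Un_disjoint[symmetric]) (auto intro!: arg_cong[of _ _ card] dest: finite_subset)
  have Y: "card (Y \<inter> U) = card (Y - X) + card (X \<inter> Y \<inter> U)"
    using assms by (subst card_Un_disjoint[symmetric]) (auto intro!: arg_cong[of _ _ card] dest: finite_subset)
  show ?thesis using X Y by (simp add: excess_def)
qed

definition commens :: "'a set \<Rightarrow> 'a set \<Rightarrow> bool" where
  "commens X Y \<longleftrightarrow> finite (X - Y) \<and> finite (Y - X)"

lemma commens_refl [simp]: "commens X X" by (simp add: commens_def)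

lemma commens_sym: "commens X Y \<Longrightarrow> commens Y X" by (simp add: commens_def)

lemma commens_trans: assumes "commens X Y" "commens Y Z" shows "commens X Z"
proof -
  have "X - Z \<subseteq> (X - Y) \<union> (Y - Z)" "Z - X \<subseteq> (Z - Y) \<union> (Y - X)" by auto
  then show ?thesis using assms unfolding commens_def by (meson finite_Un finite_subset)
qed

text \<open>Inside one finite window holding all the differences, each excess is a difference of two
  cardinalities, and the sum telescopes.\<close>

lemma excess_add:
  assumes "commens X Y" "commens Y Z"
  shows "excess X Z = excess X Y + excess Y Z"
proof -
  define U where "U = (X - Y) \<union> (Y - X) \<union> (Y - Z) \<union> (Z - Y)"
  have f: "finite U" using assms by (simp add: U_def commens_def)
  have "excess X Z = int (card (X \<inter> U)) - int (card (Z \<inter> U))"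
    by (rule excess_eq[OF f]) (auto simp: U_def)
  moreover have "excess X Y = int (card (X \<inter> U)) - int (card (Y \<inter> U))"
    by (rule excess_eq[OF f]) (auto simp: U_def)
  moreover have "excess Y Z = int (card (Y \<inter> U)) - int (card (Z \<inter> U))"
    by (rule excess_eq[OF f]) (auto simp: U_def)
  ultimately show ?thesis by simp
qed

lemma Diff_Diff_swap: "X \<subseteq> V \<Longrightarrow> Y \<subseteq> V \<Longrightarrow> (V - X) - (V - Y) = Y - X" by auto

lemma excess_compl: "X \<subseteq> V \<Longrightarrow> Y \<subseteq> V \<Longrightarrow> excess (V - X) (V - Y) = - excess X Y"
  by (simp add: excess_def Diff_Diff_swap)

lemma commens_compl: "X \<subseteq> V \<Longrightarrow> Y \<subseteq> V \<Longrightarrow> commens (V - X) (V - Y) \<longleftrightarrow> commens X Y"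
  by (auto simp add: commens_def Diff_Diff_swap)

lemma excess_image:
  assumes "inj_on g V" "X \<subseteq> V" "Y \<subseteq> V"
  shows "excess (g ` X) (g ` Y) = excess X Y"
proof -
  have "card (g ` X - g ` Y) = card (X - Y)" if "X \<subseteq> V" "Y \<subseteq> V" for X Y
    using that assms(1) by (metis Diff_subset card_image inj_on_image_set_diff inj_on_subset order_trans)
  then show ?thesis using assms by (simp add: excess_def)
qed

lemma commens_image:
  assumes "inj_on g V" "X \<subseteq> V" "Y \<subseteq> V" "commens X Y"
  shows "commens (g ` X) (g ` Y)"
proof -
  have "g ` X - g ` Y \<subseteq> g ` (X - Y)" "g ` Y - g ` X \<subseteq> g ` (Y - X)" by auto
  then show ?thesis using assms(4) unfolding commens_def by (meson finite_imageI finite_subset)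
qed

context lf_graph
begin

section \<open>Finite cuts near a vertex\<close>

definition ball :: "nat \<Rightarrow> 'a \<Rightarrow> 'a set" where
  "ball n v = {x. \<exists>k\<le>n. (v, x) \<in> uadj V E ^^ k}"

lemma finite_relpow_nbrs: "finite {x. (v, x) \<in> uadj V E ^^ k}"
proof (induction k)
  case (Suc k)
  have "{x. (v, x) \<in> uadj V E ^^ Suc k} \<subseteq> (\<Union>y\<in>{x. (v, x) \<in> uadj V E ^^ k}. {x. (y, x) \<in> uadj V E})"
    by auto
  then show ?case using Suc finite_nbrs by (meson finite_UN_I finite_subset)
qed simp

lemma finite_ball: "finite (ball n v)"
proof -
  have "ball n v = (\<Union>k\<in>{..n}. {x. (v, x) \<in> uadj V E ^^ k})" by (auto simp: ball_def)
  then show ?thesis using finite_relpow_nbrs by simp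
qed

lemma ball_sym: "x \<in> ball n v \<Longrightarrow> v \<in> ball n x"
  unfolding ball_def using relpow_sym[of "uadj V E" v x] uadj_sym by fast

lemma ball_mono: "m \<le> n \<Longrightarrow> ball m v \<subseteq> ball n v"
  by (auto simp: ball_def intro: le_trans)

lemma finite_subset_ball:
  assumes "finite K" "K \<subseteq> V" "v \<in> V"
  shows "\<exists>n. K \<subseteq> ball n v"
  using assms(1,2)
proof (induction rule: finite_induct)
  case (insert x K)
  then obtain n where n: "K \<subseteq> ball n v" by blast
  have "(v, x) \<in> (uadj V E)\<^sup>*" using walk_in_V assms insert by blast
  then obtain k where "(v, x) \<in> uadj V E ^^ k" using rtrancl_imp_relpow by blast
  then have "x \<in> ball k v" by (auto simp: ball_def)
  then have "insert x K \<subseteq> ball (max k n) v" using n ball_mono[of k "max k n" v] ball_mono[of n "max k n" v] by auto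
  then show ?case by blast
qed simp

lemma finite_ball_meets:
  assumes "finite K"
  shows "finite {v. ball n v \<inter> K \<noteq> {}}"
proof -
  have "{v. ball n v \<inter> K \<noteq> {}} \<subseteq> (\<Union>x\<in>K. ball n x)" using ball_sym by blast
  then show ?thesis using assms finite_ball by (meson finite_UN_I finite_subset)
qed

text \<open>Confining coboundaries to the finite set \<open>ball n v \<times> ball n v\<close> makes
  the family finite. Commensurability with \<open>A\<close> selects one of \<open>B\<close> and its
  complement and gives \<open>excess B A\<close> its meaning.\<close>

definition cuts :: "'a set \<Rightarrow> nat \<Rightarrow> 'a \<Rightarrow> 'a set set" where
  "cuts A n v = {B. B \<subseteq> V \<and> commens B A \<and>
     (\<forall>x y. (x, y) \<in> uadj V E \<and> x \<in> B \<and> y \<notin> B \<longrightarrow> x \<in> ball n v \<and> y \<in> ball n v)}"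

lemma cuts_compl:
  assumes "A \<subseteq> V" "B \<in> cuts A n v"
  shows "V - B \<in> cuts (V - A) n v"
  using assms uadj_sym unfolding cuts_def by (auto simp: commens_compl uadj_def)

text \<open>Agreement of the two memberships at one vertex passes across every edge; if they agree
  nowhere, the sets are complementary.\<close>

lemma cobounds_determine:
  assumes "B \<subseteq> V" "B' \<subseteq> V"
    and eq: "\<And>x y. (x, y) \<in> uadj V E \<Longrightarrow> (x \<in> B \<and> y \<notin> B) \<longleftrightarrow> (x \<in> B' \<and> y \<notin> B')"
  shows "B = B' \<or> B' = V - B"
proof (cases "\<exists>a\<in>V. a \<in> B \<longleftrightarrow> a \<in> B'")
  case True
  then obtain a where a: "a \<in> V" "a \<in> B \<longleftrightarrow> a \<in> B'" by blast
  have "b \<in> B \<longleftrightarrow> b \<in> B'" if "b \<in> V" for b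
  proof (rule connected_invariant[OF conn a(1) _ _ that])
    show "a \<in> B \<longleftrightarrow> a \<in> B'" by (rule a)
    fix x y assume "(x, y) \<in> uadj V E" "x \<in> B \<longleftrightarrow> x \<in> B'"
    then show "y \<in> B \<longleftrightarrow> y \<in> B'" using eq[of x y] eq[OF uadj_sym, of x y] by blast
  qed
  then show ?thesis using assms(1,2) by blast
qed (use assms(1,2) in blast)

lemma finite_cuts:
  assumes "infinite V" "A \<subseteq> V"
  shows "finite (cuts A n v)"
proof (rule finite_imageD)
  let ?c = "\<lambda>B. {(x, y) \<in> uadj V E. x \<in> B \<and> y \<notin> B}"
  have "?c ` cuts A n v \<subseteq> Pow (ball n v \<times> ball n v)" by (auto simp: cuts_def)
  then show "finite (?c ` cuts A n v)" using finite_ball by (meson finite_Pow_iff finite_SigmaI finite_subset)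
  show "inj_on ?c (cuts A n v)"
  proof (rule inj_onI)
    fix B B' assume B: "B \<in> cuts A n v" "B' \<in> cuts A n v" and e: "?c B = ?c B'"
    then have s: "B \<subseteq> V" "B' \<subseteq> V" and c: "commens B B'"
      unfolding cuts_def using commens_trans[OF _ commens_sym, of B A B'] by auto
    have "(x \<in> B \<and> y \<notin> B) \<longleftrightarrow> (x \<in> B' \<and> y \<notin> B')" if "(x, y) \<in> uadj V E" for x y
    proof -
      have "(x, y) \<in> ?c B \<longleftrightarrow> (x, y) \<in> ?c B'" using e by simp
      then show ?thesis using that by simp
    qed
    then have "B = B' \<or> B' = V - B" by (rule cobounds_determine[OF s])
    moreover have "B' \<noteq> V - B"
    proof
      assume "B' = V - B"
      then have "V \<subseteq> (B - B') \<union> (B' - B)" using s by auto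
      then show False using c assms(1) unfolding commens_def by (meson finite_Un finite_subset)
    qed
    ultimately show "B = B'" by blast
  qed
qed

text \<open>Adds one adjacent vertex at a time. The prescribed size later becomes a lower bound for
  the size of \<open>A - B\<close>.\<close>

lemma large_finite_connected:
  assumes "connected_on A E" "infinite A" "a \<in> A"
  shows "\<exists>K. finite K \<and> K \<subseteq> A \<and> a \<in> K \<and> card K = Suc M \<and> connected_on K E"
proof (induction M)
  case 0
  show ?case by (rule exI[of _ "{a}"]) (use assms in \<open>auto simp: connected_on_def\<close>)
next
  case (Suc M)
  then obtain K where K: "finite K" "K \<subseteq> A" "a \<in> K" "card K = Suc M" "connected_on K E" by blast
  have "\<exists>x y. (x, y) \<in> uadj A E \<and> x \<in> K \<and> y \<notin> K"
  proof (rule ccontr)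
    assume n: "\<not> ?thesis"
    have "A \<subseteq> K"
    proof
      fix b assume "b \<in> A"
      show "b \<in> K" by (rule connected_invariant[where P = "\<lambda>x. x \<in> K", OF assms(1,3) K(3) _ \<open>b \<in> A\<close>]) (use n in blast)
    qed
    then show False using K(1) assms(2) finite_subset by blast
  qed
  then obtain x y where xy: "(x, y) \<in> uadj A E" "x \<in> K" "y \<notin> K" by blast
  have "connected_on (insert y K) E"
  proof (rule connected_onI)
    show "x \<in> insert y K" using xy by simp
    fix z assume z: "z \<in> insert y K"
    show "(z, x) \<in> (uadj (insert y K) E)\<^sup>*"
    proof (cases "z = y")
      case True
      have "(y, x) \<in> uadj (insert y K) E" using xy by (auto simp: uadj_def)
      then show ?thesis using True by auto
    next
      case False
      then have "(z, x) \<in> (uadj K E)\<^sup>*" using z K(5) xy(2) by (auto simp: connected_on_def)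
      then show ?thesis by (rule uadj_rtrancl_mono[rotated]) auto
    qed
  qed
  moreover have "y \<in> A" using xy by (auto simp: uadj_def)
  ultimately show ?case using K xy by (intro exI[of _ "insert y K"]) auto
qed

text \<open>If the ball around \<open>v\<close> lies deep inside \<open>A\<close>, a cut near \<open>v\<close> is contained in \<open>A\<close> and misses any
  prescribed finite connected set touching the boundary of \<open>A\<close>.\<close>

lemma cuts_far:
  assumes A: "A \<subseteq> V" "infinite A" "infinite (V - A)" "connected_on A E" "connected_on (V - A) E" "fin_cob V E A"
  shows "finite {v \<in> A. \<exists>B\<in>cuts A n v. excess B A > - int M}"
proof -
  let ?C = "{(x, y) \<in> uadj V E. x \<in> A \<and> y \<notin> A}"
  let ?K0 = "fst ` ?C \<union> snd ` ?C"
  have fK0: "finite ?K0" using A(6) by (simp add: fin_cob_def)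
  obtain a0 b0 where a0: "a0 \<in> A" and b0: "b0 \<in> V - A" using A(4,5) by (auto simp: connected_on_def)
  have "\<exists>a b. (a, b) \<in> ?C"
  proof (rule ccontr)
    assume n: "\<not> ?thesis"
    have "b0 \<in> A" by (rule connected_invariant[where P = "\<lambda>x. x \<in> A", OF conn _ a0]) (use n a0 b0 A(1) in auto)
    then show False using b0 by simp
  qed
  then obtain a b where ab: "(a, b) \<in> uadj V E" "a \<in> A" "b \<notin> A" by blast
  obtain K where K: "finite K" "K \<subseteq> A" "a \<in> K" "card K = Suc M" "connected_on K E"
    using large_finite_connected[OF A(4,2) ab(2)] by blast
  have "{v \<in> A. \<exists>B\<in>cuts A n v. excess B A > - int M} \<subseteq> {v. ball n v \<inter> (K \<union> ?K0) \<noteq> {}}"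
  proof (rule subsetI, rule CollectI, rule notI)
    fix v assume v: "v \<in> {v \<in> A. \<exists>B\<in>cuts A n v. excess B A > - int M}"
      and far: "ball n v \<inter> (K \<union> ?K0) = {}"
    then obtain B where B: "B \<in> cuts A n v" "excess B A > - int M" and vA: "v \<in> A" by blast
    have ballA: "x \<in> A" if "(v, x) \<in> uadj V E ^^ k" "k \<le> n" for x k
      using that
    proof (induction k arbitrary: x)
      case 0 then show ?case using vA by simp
    next
      case (Suc k)
      then obtain y where y: "(v, y) \<in> uadj V E ^^ k" "(y, x) \<in> uadj V E" by auto
      then have yA: "y \<in> A" using Suc by auto
      show ?case
      proof (rule ccontr)
        assume "x \<notin> A"
        then have "(y, x) \<in> ?C" using y yA by simp
        then have "y \<in> ?K0" by force
        moreover have "y \<in> ball n v" using y Suc.prems by (auto simp: ball_def intro!: exI[of _ k])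
        ultimately show False using far by blast
      qed
    qed
    then have ballA: "ball n v \<subseteq> A" by (auto simp: ball_def)
    have cobB: "x \<in> ball n v \<and> y \<in> ball n v" if "(x, y) \<in> uadj V E" "(x \<in> B) \<noteq> (y \<in> B)" for x y
      using that B(1) uadj_sym[OF that(1)] unfolding cuts_def by blast
    \<comment> \<open>\<open>V - A\<close> is connected and contains no coboundary edge of
      \<open>B\<close>, so it lies inside \<open>B\<close> or misses it. The former contradicts
      commensurability with \<open>A\<close>.\<close>
    have disj: "B \<inter> (V - A) = {}"
    proof (rule ccontr)
      assume "B \<inter> (V - A) \<noteq> {}"
      then obtain c where c: "c \<in> B" "c \<in> V - A" by blast
      have "V - A \<subseteq> B"
      proof
        fix e assume e: "e \<in> V - A"
        show "e \<in> B"
        proof (rule connected_invariant[where P = "\<lambda>x. x \<in> B", OF A(5) c(2,1) _ e])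
          fix x y assume xy: "(x, y) \<in> uadj (V - A) E" "x \<in> B"
          then have "(x, y) \<in> uadj V E" "x \<notin> A" by (auto simp: uadj_def)
          then show "y \<in> B" using cobB[of x y] xy(2) ballA by blast
        qed
      qed
      then have "V - A \<subseteq> B - A" by auto
      then show False using B(1) A(3) finite_subset by (auto simp: cuts_def commens_def)
    qed
    then have BA: "B \<subseteq> A" using B(1) by (auto simp: cuts_def)
    have "b \<notin> B" using BA ab by blast
    \<comment> \<open>The neighbour \<open>b\<close> of \<open>a\<close> lies outside
      \<open>A\<close>, hence outside \<open>B\<close>, and the edge between them is too far from
      \<open>v\<close> to belong to the coboundary of \<open>B\<close>.\<close>
    have aB: "a \<notin> B" using cobB[OF ab(1)] \<open>b \<notin> B\<close> far K(3) by blast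
    have "K \<subseteq> A - B"
    proof
      fix e assume e: "e \<in> K"
      have "e \<notin> B"
      proof (rule connected_invariant[where P = "\<lambda>x. x \<notin> B", OF K(5,3) aB _ e])
        fix x y assume xy: "(x, y) \<in> uadj K E" "x \<notin> B"
        then have "(x, y) \<in> uadj V E" "x \<in> K" using K(2) A(1) by (auto simp: uadj_def)
        then show "y \<notin> B" using cobB[of x y] xy(2) far by blast
      qed
      then show "e \<in> A - B" using e K(2) by blast
    qed
    then have "card K \<le> card (A - B)" using B(1) by (intro card_mono) (auto simp: cuts_def commens_def)
    moreover have "card (B - A) = 0" using BA by (metis Diff_eq_empty_iff card.empty)
    ultimately have "excess B A \<le> - int (Suc M)" using K(4) unfolding excess_def by linarith
    then show False using B(2) by simp
  qed
  moreover have "finite {v. ball n v \<inter> (K \<union> ?K0) \<noteq> {}}" by (rule finite_ball_meets) (use fK0 K in simp)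
  ultimately show ?thesis by (rule finite_subset)
qed

end

section \<open>Heights on two-ended vertex-transitive graphs\<close>

locale vt_graph = lf_graph +
  assumes two: "card (ends V E) = 2"
    and vt: "\<And>u v. u \<in> V \<Longrightarrow> v \<in> V \<Longrightarrow> \<exists>g. dg_iso g V E V E \<and> g u = v"
begin

abbreviation aut :: "('a \<Rightarrow> 'a) \<Rightarrow> bool" where "aut g \<equiv> dg_iso g V E V E"

lemma aut_inj: "aut g \<Longrightarrow> inj_on g V" by (simp add: dg_iso_def bij_betw_def)
lemma aut_image: "aut g \<Longrightarrow> g ` V = V" by (simp add: dg_iso_def bij_betw_def)
lemma aut_in: "aut g \<Longrightarrow> x \<in> V \<Longrightarrow> g x \<in> V" using aut_image by blast
lemma aut_uadj: "aut g \<Longrightarrow> (x, y) \<in> uadj V E \<Longrightarrow> (g x, g y) \<in> uadj V E"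
  using aut_in unfolding uadj_def dg_iso_def by blast
lemma aut_uadj_iff: "aut g \<Longrightarrow> x \<in> V \<Longrightarrow> y \<in> V \<Longrightarrow> (g x, g y) \<in> uadj V E \<longleftrightarrow> (x, y) \<in> uadj V E"
  using aut_in unfolding uadj_def dg_iso_def by blast

lemma aut_ball: assumes "aut g" "x \<in> ball n v" shows "g x \<in> ball n (g v)"
proof -
  have "(g v, g x) \<in> uadj V E ^^ k" if "(v, x) \<in> uadj V E ^^ k" for k
    using that by (induction k arbitrary: x) (use aut_uadj[OF assms(1)] in auto)
  then show ?thesis using assms(2) by (auto simp: ball_def)
qed

lemma aut_cob:
  assumes g: "aut g" and B: "B \<subseteq> V" and xy: "(x, y) \<in> uadj V E" "x \<in> g ` B" "y \<notin> g ` B"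
  shows "\<exists>x' y'. x = g x' \<and> y = g y' \<and> (x', y') \<in> uadj V E \<and> x' \<in> B \<and> y' \<notin> B"
proof -
  obtain x' where x': "x = g x'" "x' \<in> B" using xy by blast
  obtain y' where y': "y = g y'" "y' \<in> V" using xy(1) aut_image[OF g] by (auto simp: uadj_def)
  have "(x', y') \<in> uadj V E" using aut_uadj_iff[OF g, of x' y'] x' y' B xy(1) by auto
  then show ?thesis using x' y' xy by blast
qed

lemma aut_fin_cob: assumes g: "aut g" and B: "fin_cob V E B" shows "fin_cob V E (g ` B)"
proof -
  have BV: "B \<subseteq> V" using B by (simp add: fin_cob_def)
  have "{(x, y) \<in> uadj V E. x \<in> g ` B \<and> y \<notin> g ` B} \<subseteq> map_prod g g ` {(x, y) \<in> uadj V E. x \<in> B \<and> y \<notin> B}"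
    using aut_cob[OF g BV] by fastforce
  moreover have "finite (map_prod g g ` {(x, y) \<in> uadj V E. x \<in> B \<and> y \<notin> B})" using B by (simp add: fin_cob_def)
  ultimately have "finite {(x, y) \<in> uadj V E. x \<in> g ` B \<and> y \<notin> g ` B}" by (rule finite_subset)
  then show ?thesis using aut_in[OF g] BV by (auto simp: fin_cob_def)
qed

text \<open>At most two of the four corners are infinite, since there are only two ends. As all four
  sides are infinite, the two finite corners cannot share a side, so they are diagonally
  opposite.\<close>

lemma cut_dichotomy:
  assumes A: "infinite A" "infinite (V - A)" "fin_cob V E A"
    and B: "infinite B" "infinite (V - B)" "fin_cob V E B"
  shows "commens B A \<or> commens (V - B) A"
proof -
  have AV: "A \<subseteq> V" "B \<subseteq> V" using A B by (auto simp: fin_cob_def)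
  note c = A(3) B(3) fin_cob_compl[OF A(3)] fin_cob_compl[OF B(3)]
  let ?Q1 = "A \<inter> B" and ?Q2 = "A \<inter> (V - B)" and ?Q3 = "(V - A) \<inter> B" and ?Q4 = "(V - A) \<inter> (V - B)"
  note f = fin_cob_Int[OF c(1,2)] fin_cob_Int[OF c(1,4)] fin_cob_Int[OF c(3,2)] fin_cob_Int[OF c(3,4)]
  have three: "finite X \<or> finite Y \<or> finite Z" if "fin_cob V E X" "fin_cob V E Y" "fin_cob V E Z"
    "X \<inter> Y = {}" "X \<inter> Z = {}" "Y \<inter> Z = {}" for X Y Z
    using no_three_ends[OF two that(1-3)] that(4-6) by blast
  have t: "finite ?Q1 \<or> finite ?Q2 \<or> finite ?Q3" "finite ?Q1 \<or> finite ?Q2 \<or> finite ?Q4"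
     "finite ?Q1 \<or> finite ?Q3 \<or> finite ?Q4" "finite ?Q2 \<or> finite ?Q3 \<or> finite ?Q4"
  proof -
    show "finite ?Q1 \<or> finite ?Q2 \<or> finite ?Q3" by (rule three[OF f(1,2,3)]) auto
    show "finite ?Q1 \<or> finite ?Q2 \<or> finite ?Q4" by (rule three[OF f(1,2,4)]) auto
    show "finite ?Q1 \<or> finite ?Q3 \<or> finite ?Q4" by (rule three[OF f(1,3,4)]) auto
    show "finite ?Q2 \<or> finite ?Q3 \<or> finite ?Q4" by (rule three[OF f(2,3,4)]) auto
  qed
  have "\<not> (finite ?Q1 \<and> finite ?Q2)" "\<not> (finite ?Q3 \<and> finite ?Q4)" "\<not> (finite ?Q1 \<and> finite ?Q3)" "\<not> (finite ?Q2 \<and> finite ?Q4)"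
  proof -
    have e: "A = ?Q1 \<union> ?Q2" "V - A = ?Q3 \<union> ?Q4" "B = ?Q1 \<union> ?Q3" "V - B = ?Q2 \<union> ?Q4" using AV by auto
    show "\<not> (finite ?Q1 \<and> finite ?Q2)" using A(1) e(1) by (metis finite_UnI)
    show "\<not> (finite ?Q3 \<and> finite ?Q4)" using A(2) e(2) by (metis finite_UnI)
    show "\<not> (finite ?Q1 \<and> finite ?Q3)" using B(1) e(3) by (metis finite_UnI)
    show "\<not> (finite ?Q2 \<and> finite ?Q4)" using B(2) e(4) by (metis finite_UnI)
  qed
  then have "(finite ?Q2 \<and> finite ?Q3) \<or> (finite ?Q1 \<and> finite ?Q4)" using t by blast
  moreover have "B - A = ?Q3" "A - B = ?Q2" "V - B - A = ?Q4" "A - (V - B) = ?Q1" using AV by auto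
  ultimately show ?thesis by (auto simp: commens_def)
qed

text \<open>Deep inside \<open>A\<close> all cuts near a vertex miss much of \<open>A\<close>, so
  every summand is very negative; complementation makes the summands very positive deep inside
  \<open>V - A\<close>. Hence a given height occurs only in a finite region.\<close>

lemma height_exists:
  "\<exists>h :: 'a \<Rightarrow> int. (\<forall>g. aut g \<longrightarrow> (\<exists>e c. (e = 1 \<or> e = -1) \<and> (\<forall>v\<in>V. h (g v) = e * h v + c)))
     \<and> (\<forall>k. finite {v \<in> V. h v = k})"
proof -
  obtain A where A: "A \<subseteq> V" "infinite A" "infinite (V - A)" "connected_on A E" "connected_on (V - A) E" "fin_cob V E A"
    using two_ended_cut[OF two] by blast
  have Vinf: "infinite V" using A(1,2) finite_subset by blast
  obtain v0 where v0: "v0 \<in> V" using conn by (auto simp: connected_on_def)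
  let ?C = "{(x, y) \<in> uadj V E. x \<in> A \<and> y \<notin> A}"
  have "finite (fst ` ?C \<union> snd ` ?C)" using A(6) by (simp add: fin_cob_def)
  moreover have "fst ` ?C \<union> snd ` ?C \<subseteq> V" by (auto simp: uadj_def)
  ultimately obtain n where n: "fst ` ?C \<union> snd ` ?C \<subseteq> ball n v0" using finite_subset_ball v0 by meson
  \<comment> \<open>The radius is chosen for this: it makes the number \<open>N\<close> of cuts per
    vertex positive.\<close>
  have "A \<in> cuts A n v0" using n A(1) unfolding cuts_def by force
  then have ne0: "cuts A n v0 \<noteq> {}" by blast
  have fin: "finite (cuts A n v)" for v by (rule finite_cuts[OF Vinf A(1)])
  \<comment> \<open>\<open>t\<close> will be the action of \<open>g\<close> on sets, followed by
    complementation when \<open>g\<close> swaps the two ends, and \<open>e\<close> is the resulting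
    sign.\<close>
  define transports where "transports g t e \<longleftrightarrow> (e = 1 \<or> e = -1) \<and> commens (t A) A
     \<and> (\<forall>v. t ` cuts A n v \<subseteq> cuts A n (g v)) \<and> inj_on t (Pow V)
     \<and> (\<forall>X\<in>Pow V. \<forall>Y\<in>Pow V. excess (t X) (t Y) = e * excess X Y \<and> (commens X Y \<longrightarrow> commens (t X) (t Y)))"
    for g :: "'a \<Rightarrow> 'a" and t :: "'a set \<Rightarrow> 'a set" and e :: int
  have ex: "\<exists>t e. transports g t e" if g: "aut g" for g
  proof -
    have gA: "g ` A \<subseteq> V" using A(1) aut_in[OF g] by blast
    have gi: "inj_on g V" by (rule aut_inj[OF g])
    have injP: "inj_on ((`) g) (Pow V)" using gi by (rule inj_on_image_Pow)
    have gsub: "g ` X \<subseteq> V" if "X \<subseteq> V" for X using that aut_in[OF g] by blast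
    have "infinite (g ` A)" using A gi by (metis finite_image_iff inj_on_subset)
    moreover have "V - g ` A = g ` (V - A)" using gi aut_image[OF g] A(1) by (metis inj_on_image_set_diff order_refl Diff_subset)
    then have "infinite (V - g ` A)" using A gi by (metis Diff_subset finite_image_iff inj_on_subset)
    ultimately have "commens (g ` A) A \<or> commens (V - g ` A) A"
      using cut_dichotomy[OF A(2,3,6)] aut_fin_cob[OF g A(6)] by blast
    moreover have gB: "x \<in> ball n (g v) \<and> y \<in> ball n (g v)"
      if B: "B \<in> cuts A n v" "(x, y) \<in> uadj V E" "x \<in> g ` B" "y \<notin> g ` B" for B v x y
    proof -
      have "B \<subseteq> V" using B(1) by (simp add: cuts_def)
      then obtain x' y' where "x = g x'" "y = g y'" "(x', y') \<in> uadj V E" "x' \<in> B" "y' \<notin> B"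
        using aut_cob[OF g _ B(2-4)] by blast
      then show ?thesis using B(1) aut_ball[OF g] unfolding cuts_def by blast
    qed
    moreover have cB: "B \<subseteq> V" "commens (g ` B) (g ` A)" if "B \<in> cuts A n v" for B v
      using that commens_image[OF gi _ A(1)] by (auto simp: cuts_def)
    ultimately consider "commens (g ` A) A" | "commens (V - g ` A) A" by blast
    then show ?thesis
    proof cases
      case 1
      have "(`) g ` cuts A n v \<subseteq> cuts A n (g v)" for v
      proof (clarify)
        fix B assume B: "B \<in> cuts A n v"
        show "g ` B \<in> cuts A n (g v)"
          using gB[OF B] gsub cB[OF B] commens_trans[OF cB(2)[OF B] 1] unfolding cuts_def by blast
      qed
      then show ?thesis using 1 injP
        by (intro exI[of _ "(`) g"] exI[of _ 1]) (simp add: transports_def excess_image[OF gi] commens_image[OF gi])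
    next
      case 2
      let ?t = "\<lambda>X. V - g ` X"
      have "?t ` cuts A n v \<subseteq> cuts A n (g v)" for v
      proof (clarify)
        fix B assume B: "B \<in> cuts A n v"
        have "commens (V - g ` B) (V - g ` A)" using cB[OF B] gsub gA by (simp add: commens_compl)
        then have "commens (V - g ` B) A" using 2 commens_trans by blast
        moreover have "x \<in> ball n (g v) \<and> y \<in> ball n (g v)"
          if "(x, y) \<in> uadj V E" "x \<in> V - g ` B" "y \<notin> V - g ` B" for x y
          using gB[OF B uadj_sym[OF that(1)]] that by (auto simp: uadj_def)
        ultimately show "V - g ` B \<in> cuts A n (g v)" by (auto simp: cuts_def)
      qed
      moreover have "inj_on ?t (Pow V)"
      proof (rule inj_onI)
        fix X Y assume "X \<in> Pow V" "Y \<in> Pow V" "V - g ` X = V - g ` Y"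
        then have "g ` X = g ` Y" using gsub by (metis PowD double_diff order_refl)
        then show "X = Y" using injP \<open>X \<in> Pow V\<close> \<open>Y \<in> Pow V\<close> by (meson inj_onD)
      qed
      ultimately show ?thesis using 2
        by (intro exI[of _ ?t] exI[of _ "-1"])
          (simp add: transports_def excess_compl commens_compl gsub excess_image[OF gi] commens_image[OF gi])
    qed
  qed
  have cutsP: "cuts A n v \<subseteq> Pow V" for v by (auto simp: cuts_def)
  have card_le: "card (cuts A n u) \<le> card (cuts A n v)" if "u \<in> V" "v \<in> V" for u v
  proof -
    obtain g where g: "aut g" "g u = v" using vt \<open>u \<in> V\<close> \<open>v \<in> V\<close> by blast
    obtain t e where "transports g t e" using ex[OF g(1)] by blast
    then have t: "t ` cuts A n u \<subseteq> cuts A n v" "inj_on t (Pow V)"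
      unfolding transports_def g(2)[symmetric] by simp_all
    show ?thesis by (rule card_inj_on_le[OF inj_on_subset[OF t(2) cutsP] t(1) fin])
  qed
  define N where "N = card (cuts A n v0)"
  have N: "card (cuts A n v) = N" if "v \<in> V" for v unfolding N_def using card_le that v0 by (meson le_antisym)
  have Npos: "N \<ge> 1" using ne0 fin[of v0] by (simp add: N_def Suc_le_eq card_gt_0_iff)
  define h where "h v = (\<Sum>B\<in>cuts A n v. excess B A)" for v
  have "\<exists>e c. (e = 1 \<or> e = -1) \<and> (\<forall>v\<in>V. h (g v) = e * h v + c)" if g: "aut g" for g
  proof -
    obtain t e where "transports g t e" using ex[OF g] by blast
    then have e: "e = 1 \<or> e = -1" and tA: "commens (t A) A" and tc: "\<And>v. t ` cuts A n v \<subseteq> cuts A n (g v)"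
      and ti: "inj_on t (Pow V)"
      and tx: "\<And>X Y. X \<subseteq> V \<Longrightarrow> Y \<subseteq> V \<Longrightarrow> excess (t X) (t Y) = e * excess X Y \<and> (commens X Y \<longrightarrow> commens (t X) (t Y))"
      by (simp_all add: transports_def)
    \<comment> \<open>By additivity through \<open>t A\<close>, every transported cut picks up the
      same error \<open>excess (t A) A\<close>. The total shift is independent of \<open>v\<close>
      because every vertex has the same number \<open>N\<close> of cuts.\<close>
    have "h (g v) = e * h v + int N * excess (t A) A" if v: "v \<in> V" for v
    proof -
      have ti': "inj_on t (cuts A n v)" by (rule inj_on_subset[OF ti cutsP])
      have "card (t ` cuts A n v) = card (cuts A n (g v))"
        using N v aut_in[OF g] card_image[OF ti'] by simp
      then have "t ` cuts A n v = cuts A n (g v)" using tc fin by (meson card_subset_eq)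
      then have "h (g v) = (\<Sum>B\<in>t ` cuts A n v. excess B A)" by (simp add: h_def)
      also have "\<dots> = (\<Sum>B\<in>cuts A n v. excess (t B) A)" using ti' by (simp add: sum.reindex)
      also have "\<dots> = (\<Sum>B\<in>cuts A n v. e * excess B A + excess (t A) A)"
      proof (rule sum.cong[OF refl])
        fix B assume "B \<in> cuts A n v"
        then have "B \<subseteq> V" "commens B A" by (auto simp: cuts_def)
        then show "excess (t B) A = e * excess B A + excess (t A) A"
          using excess_add[of "t B" "t A" A] tA tx A(1) by auto
      qed
      also have "\<dots> = e * h v + int N * excess (t A) A"
        using N[OF v] by (simp add: sum.distrib h_def sum_distrib_left)
      finally show ?thesis .
    qed
    then show ?thesis using e by blast
  qed
  moreover have "finite {v \<in> V. h v = k}" for k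
  proof -
    \<comment> \<open>If all \<open>N >= 1\<close> summands are at most \<open>-M\<close>, or all
      are at least \<open>M\<close>, then the height exceeds the absolute value of \<open>k\<close>
      in absolute value.\<close>
    define M where "M = nat (\<bar>k\<bar> + 1)"
    have Mk: "int M = \<bar>k\<bar> + 1" by (simp add: M_def)
    have MN: "int M \<le> int N * int M" using Npos by (metis mult.commute mult_le_mono2 nat_mult_1_right of_nat_le_iff of_nat_mult)
    have A': "V - A \<subseteq> V" "infinite (V - A)" "infinite (V - (V - A))" "connected_on (V - A) E"
       "connected_on (V - (V - A)) E" "fin_cob V E (V - A)"
      using A fin_cob_compl[OF A(6)] by (simp_all add: double_diff)
    let ?S = "{v \<in> A. \<exists>B\<in>cuts A n v. excess B A > - int M}"
    let ?T = "{v \<in> V - A. \<exists>B\<in>cuts (V - A) n v. excess B (V - A) > - int M}"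
    have "{v \<in> V. h v = k} \<subseteq> ?S \<union> ?T"
    proof (rule ccontr)
      assume "\<not> ?thesis"
      then obtain v where v: "v \<in> V" "h v = k" "v \<notin> ?S" "v \<notin> ?T" by blast
      show False
      proof (cases "v \<in> A")
        case True
        then have "excess B A \<le> - int M" if "B \<in> cuts A n v" for B using that v(3) by force
        then have "h v \<le> (\<Sum>B\<in>cuts A n v. - int M)" unfolding h_def by (rule sum_mono)
        then have "h v \<le> - (int N * int M)" using N[OF v(1)] by simp
        then show False using v(2) MN Mk by linarith
      next
        case False
        have "excess B A \<ge> int M" if B: "B \<in> cuts A n v" for B
        proof -
          have "V - B \<in> cuts (V - A) n v" by (rule cuts_compl[OF A(1) B])
          then have "excess (V - B) (V - A) \<le> - int M" using v False by force
          moreover have "B \<subseteq> V" using B by (simp add: cuts_def)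
          ultimately show ?thesis using excess_compl[OF _ A(1)] by simp
        qed
        then have "h v \<ge> (\<Sum>B\<in>cuts A n v. int M)" unfolding h_def by (rule sum_mono)
        then have "h v \<ge> int N * int M" using N[OF v(1)] by simp
        then show False using v(2) MN Mk by linarith
      qed
    qed
    then show ?thesis using cuts_far[OF A, of n M] cuts_far[OF A', of n M] by (meson finite_Un finite_subset)
  qed
  ultimately show ?thesis by (intro exI[of _ h]) blast
qed

lemma infinite_V: "infinite V"
  using two_ended_cut[OF two] finite_subset by blast

end

section \<open>Grading\<close>

lemma uadj_induced: "uadj S (induced S E) = uadj S E"
  by (auto simp: uadj_def induced_def)

lemma connected_on_induced: "connected_on S (induced S E) \<longleftrightarrow> connected_on S E"
  by (simp add: connected_on_def uadj_induced)

lemma connected_on_image: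
  assumes "connected_on S E" "\<And>x y. x \<in> S \<Longrightarrow> y \<in> S \<Longrightarrow> (x, y) \<in> E \<Longrightarrow> (f x, f y) \<in> E"
  shows "connected_on (f ` S) E"
proof -
  have w: "(f x, f y) \<in> (uadj (f ` S) E)\<^sup>*" if "(x, y) \<in> (uadj S E)\<^sup>*" for x y
    using that
  proof (induction rule: rtrancl_induct)
    case (step y z)
    then have "(f y, f z) \<in> uadj (f ` S) E" using assms(2) by (auto simp: uadj_def)
    with step show ?case by auto
  qed simp
  show ?thesis using assms(1) w unfolding connected_on_def by blast
qed

section \<open>Automorphisms obtained from homogeneity\<close>

locale homog_digraph = lf_graph +
  assumes dg: "digraph V E" and hom: "conn_homogeneous V E"
begin

abbreviation aut :: "('a \<Rightarrow> 'a) \<Rightarrow> bool" where "aut g \<equiv> dg_iso g V E V E"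
definition out :: "'a \<Rightarrow> 'a set" where "out v = {y. (v, y) \<in> E}"
definition inn :: "'a \<Rightarrow> 'a set" where "inn v = {x. (x, v) \<in> E}"

lemma in_out [simp]: "y \<in> out v \<longleftrightarrow> (v, y) \<in> E" by (simp add: out_def)
lemma in_inn [simp]: "x \<in> inn v \<longleftrightarrow> (x, v) \<in> E" by (simp add: inn_def)

lemma arcV: "(x, y) \<in> E \<Longrightarrow> x \<in> V \<and> y \<in> V" using dg by (auto simp: digraph_def)
lemma irrefl: "(x, x) \<notin> E" using dg by (auto simp: digraph_def)
lemma antisym: "(x, y) \<in> E \<Longrightarrow> (y, x) \<notin> E" using dg by (auto simp: digraph_def)

lemma finite_out [simp]: "v \<in> V \<Longrightarrow> finite (out v)" using lf by (simp add: locally_finite_def out_def)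
lemma finite_inn [simp]: "v \<in> V \<Longrightarrow> finite (inn v)" using lf by (simp add: locally_finite_def inn_def)

text \<open>The working form of homogeneity: the target is the image of \<open>S\<close>, which
  inherits its connectedness from \<open>S\<close>.\<close>

lemma extend:
  assumes "S \<subseteq> V" "finite S" "connected_on S E" "inj_on f S" "f ` S \<subseteq> V"
    and "\<And>x y. x \<in> S \<Longrightarrow> y \<in> S \<Longrightarrow> (x, y) \<in> E \<longleftrightarrow> (f x, f y) \<in> E"
  shows "\<exists>g. aut g \<and> (\<forall>x\<in>S. g x = f x)"
proof -
  have "connected_on (f ` S) E" using connected_on_image[OF assms(3)] assms(6) by blast
  moreover have "dg_iso f S (induced S E) (f ` S) (induced (f ` S) E)"
    using assms by (auto simp: dg_iso_def bij_betw_def induced_def)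
  ultimately show ?thesis using hom assms(1-5) unfolding conn_homogeneous_def connected_on_induced
    by (meson finite_imageI)
qed

lemma vertex_transitive: assumes "u \<in> V" "v \<in> V" shows "\<exists>g. aut g \<and> g u = v"
  using extend[of "{u}" "\<lambda>_. v"] assms irrefl by (auto simp: connected_on_def)

lemma autE: "aut g \<Longrightarrow> x \<in> V \<Longrightarrow> y \<in> V \<Longrightarrow> (g x, g y) \<in> E \<longleftrightarrow> (x, y) \<in> E"
  by (auto simp: dg_iso_def)

lemma aut_arc: "aut g \<Longrightarrow> (x, y) \<in> E \<Longrightarrow> (g x, g y) \<in> E" using autE arcV by blast

lemma aut_bij: "aut g \<Longrightarrow> bij_betw g V V" by (simp add: dg_iso_def)

lemma aut_in: "aut g \<Longrightarrow> x \<in> V \<Longrightarrow> g x \<in> V" using aut_bij by (metis bij_betwE)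

lemma aut_preimage: "aut g \<Longrightarrow> y \<in> V \<Longrightarrow> \<exists>x\<in>V. g x = y" using aut_bij by (metis bij_betw_def imageE)

lemma aut_inj: "aut g \<Longrightarrow> inj_on g V" by (simp add: dg_iso_def bij_betw_def)

lemma aut_out: assumes "aut g" "v \<in> V" shows "out (g v) = g ` out v"
proof (intro equalityI subsetI)
  fix y assume "y \<in> out (g v)"
  then have y: "(g v, y) \<in> E" by simp
  then obtain x where "x \<in> V" "g x = y" using aut_preimage[OF assms(1)] arcV by blast
  then show "y \<in> g ` out v" using y autE[OF assms(1,2)] by auto
qed (use assms aut_arc in auto)

lemma aut_inn: assumes "aut g" "v \<in> V" shows "inn (g v) = g ` inn v"
proof (intro equalityI subsetI)
  fix y assume "y \<in> inn (g v)"
  then have y: "(y, g v) \<in> E" by simp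
  then obtain x where "x \<in> V" "g x = y" using aut_preimage[OF assms(1)] arcV by blast
  then show "y \<in> g ` inn v" using y autE[OF assms(1) _ assms(2)] by auto
qed (use assms aut_arc in auto)

lemma star_connected:
  assumes "c \<in> S" "\<And>x. x \<in> S \<Longrightarrow> x = c \<or> (x, c) \<in> E \<or> (c, x) \<in> E"
  shows "connected_on S E"
proof (rule connected_onI[OF assms(1)])
  fix x assume x: "x \<in> S"
  show "(x, c) \<in> (uadj S E)\<^sup>*"
  proof (cases "x = c")
    case False
    then have "(x, c) \<in> uadj S E" using assms x by (auto simp: uadj_def)
    then show ?thesis by auto
  qed simp
qed

lemma arc_transitive:
  assumes "(u, v) \<in> E" "(u', v') \<in> E"
  shows "\<exists>g. aut g \<and> g u = u' \<and> g v = v'"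
proof -
  have "u \<noteq> v" "u' \<noteq> v'" using assms irrefl by auto
  then have "\<exists>g. aut g \<and> (\<forall>x\<in>{u, v}. g x = (if x = u then u' else v'))"
    using assms antisym irrefl arcV
    by (intro extend star_connected[of u]) (auto simp: inj_on_def)
  then show ?thesis using \<open>u \<noteq> v\<close> by auto
qed

lemma graded:
  assumes two: "card (ends V E) = 2"
  shows "\<exists>lev :: 'a \<Rightarrow> int. (\<forall>x y. (x, y) \<in> E \<longrightarrow> lev y = lev x + 1) \<and> (\<forall>k. finite {v \<in> V. lev v = k})
     \<and> (\<exists>x y. (x, y) \<in> E)"
proof -
  interpret G: vt_graph V E using vertex_transitive two by unfold_locales auto
  obtain h :: "'a \<Rightarrow> int" where h: "\<And>g. aut g \<Longrightarrow> \<exists>e c. (e = 1 \<or> e = -1) \<and> (\<forall>v\<in>V. h (g v) = e * h v + c)"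
    and hfin: "\<And>k. finite {v \<in> V. h v = k}" using G.height_exists by blast
  \<comment> \<open>Two finite fibres cannot cover an infinite vertex set; with \<open>k = l\<close>
    this refutes constant heights too.\<close>
  have twoval: False if "\<And>v. v \<in> V \<Longrightarrow> h v = k \<or> h v = l" for k l
  proof -
    have "V \<subseteq> {v \<in> V. h v = k} \<union> {v \<in> V. h v = l}" using that by blast
    then show False using hfin G.infinite_V by (meson finite_Un finite_subset)
  qed
  have "E \<noteq> {}"
  proof
    assume "E = {}"
    obtain v0 where v0: "v0 \<in> V" using conn by (auto simp: connected_on_def)
    have "h v = h v0" if "v \<in> V" for v
      by (rule connected_invariant[where P = "\<lambda>v. h v = h v0", OF conn v0 refl _ that]) (use \<open>E = {}\<close> in \<open>auto simp: uadj_def\<close>)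
    then show False using twoval by blast
  qed
  then obtain a b where ab: "(a, b) \<in> E" by auto
  have exout: "\<exists>y. (v, y) \<in> E" and exin: "\<exists>y. (y, v) \<in> E" if v: "v \<in> V" for v
  proof -
    obtain g where "aut g" "g a = v" using vertex_transitive arcV[OF ab] v by blast
    then show "\<exists>y. (v, y) \<in> E" using aut_arc ab by blast
    obtain g where "aut g" "g b = v" using vertex_transitive arcV[OF ab] v by blast
    then show "\<exists>y. (y, v) \<in> E" using aut_arc ab by blast
  qed
  define c where "c = \<bar>h b - h a\<bar>"
  have step: "\<bar>h y - h x\<bar> = c" if xy: "(x, y) \<in> E" for x y
  proof -
    obtain g where g: "aut g" "g a = x" "g b = y" using arc_transitive[OF ab xy] by blast
    obtain e k where e: "e = 1 \<or> e = -1" "\<forall>v\<in>V. h (g v) = e * h v + k" using h[OF g(1)] by blast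
    then have "h y - h x = e * (h b - h a)" using g arcV[OF ab] by (auto simp: algebra_simps)
    then show ?thesis using e(1) by (auto simp: c_def)
  qed
  have c0: "c > 0"
  proof (rule ccontr)
    assume "\<not> c > 0"
    then have "h y = h x" if "(x, y) \<in> E" for x y using step[OF that] by simp
    then have "h v = h a" if "v \<in> V" for v
      by (intro connected_invariant[where P = "\<lambda>v. h v = h a", OF conn _ refl _ that])
        (use arcV[OF ab] in \<open>auto simp: uadj_def\<close>)
    then show False using twoval by blast
  qed
  have ustep: "\<bar>h y - h x\<bar> = c" if "(x, y) \<in> E \<or> (y, x) \<in> E" for x y using that step[of x y] step[of y x] by auto
  \<comment> \<open>Two neighbours of \<open>v\<close> differ in height by \<open>0\<close> or by
    \<open>2 * c\<close> in absolute value, whereas an arc needs exactly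
    \<open>c > 0\<close>.\<close>
  have tri: "(x, y) \<notin> E" if "(v, x) \<in> E \<or> (x, v) \<in> E" "(v, y) \<in> E \<or> (y, v) \<in> E" for v x y
    using ustep[OF that(1)] ustep[OF that(2)] step[of x y] c0 by linarith
  \<comment> \<open>Absence of triangles makes swapping \<open>x\<close> and \<open>y\<close> an
    isomorphism. Fixing the further neighbour \<open>z\<close> together with \<open>v\<close> gives
    two fixed vertices of different height, which forces \<open>e = 1\<close> and
    \<open>k = 0\<close>; this rules out a reflection of the heights.\<close>
  have side: "h x = h y"
    if s: "(v, x) \<in> E \<longleftrightarrow> (v, y) \<in> E" "(x, v) \<in> E \<longleftrightarrow> (y, v) \<in> E" "(v, x) \<in> E \<or> (x, v) \<in> E"
      "(v, z) \<in> E \<or> (z, v) \<in> E" "z \<noteq> x" "z \<noteq> y" for v x y z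
  proof (cases "x = y")
    case False
    have nv: "x \<noteq> v" "y \<noteq> v" "z \<noteq> v" using s irrefl by blast+
    have V: "v \<in> V" "x \<in> V" "y \<in> V" "z \<in> V" using s arcV by blast+
    let ?f = "\<lambda>t. if t = x then y else if t = y then x else t"
    have adj: "\<forall>p\<in>{x,y,z}. (v, p) \<in> E \<or> (p, v) \<in> E" using s by blast
    then have non: "\<forall>p\<in>{x,y,z}. \<forall>q\<in>{x,y,z}. (p, q) \<notin> E" using tri by blast
    have "\<exists>g. aut g \<and> (\<forall>t\<in>{v,x,y,z}. g t = ?f t)"
    proof (rule extend)
      show "connected_on {v,x,y,z} E" using adj by (intro star_connected[of v]) auto
      show "inj_on ?f {v,x,y,z}" by (auto simp: inj_on_def)
      fix p q assume "p \<in> {v,x,y,z}" "q \<in> {v,x,y,z}"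
      then show "(p, q) \<in> E \<longleftrightarrow> (?f p, ?f q) \<in> E" using non s nv irrefl False by auto
    qed (use V in auto)
    then obtain g where g: "aut g" "\<forall>t\<in>{v,x,y,z}. g t = ?f t" by blast
    then have gg: "g v = v" "g z = z" "g x = y" using s nv False by auto
    obtain e k where e: "e = 1 \<or> e = -1" "\<forall>t\<in>V. h (g t) = e * h t + k" using h[OF g(1)] by blast
    have hv: "h v = e * h v + k" "h z = e * h z + k" "h y = e * h x + k" using e(2) gg V by metis+
    have "h z \<noteq> h v" using ustep[of v z] s(4) c0 by auto
    then have "e \<noteq> -1" using hv(1,2) by auto
    then have "e = 1" using e(1) by blast
    then show ?thesis using hv by simp
  qed simp
  have sout: "h x = h y" if xy: "(v, x) \<in> E" "(v, y) \<in> E" for v x y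
  proof -
    obtain z where z: "(z, v) \<in> E" using exin arcV xy by blast
    show ?thesis by (rule side[of v x y z]) (use xy z antisym in auto)
  qed
  have sin: "h x = h y" if xy: "(x, v) \<in> E" "(y, v) \<in> E" for v x y
  proof -
    obtain z where z: "(v, z) \<in> E" using exout arcV xy by blast
    show ?thesis by (rule side[of v x y z]) (use xy z antisym in auto)
  qed
  \<comment> \<open>Otherwise all neighbours of \<open>v\<close> have the same height. Transitivity
    transfers this to every vertex, and connectedness then leaves only the heights
    \<open>h v\<close> and \<open>h x\<close>.\<close>
  have opp: "h x - h v = h v - h z" if xz: "(v, x) \<in> E" "(z, v) \<in> E" for v x z
  proof (rule ccontr)
    assume "h x - h v \<noteq> h v - h z"
    then have eq: "h x = h z" using step[OF xz(1)] step[OF xz(2)] by linarith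
    have allv: "h y = h x" if "(v, y) \<in> E \<or> (y, v) \<in> E" for y
      using that sout[OF xz(1), of y] sin[OF xz(2), of y] eq by auto
    have vV: "v \<in> V" using xz arcV by blast
    have nb: "h y = h y'" if "(u, y) \<in> E \<or> (y, u) \<in> E" "(u, y') \<in> E \<or> (y', u) \<in> E" for u y y'
    proof -
      have uV: "u \<in> V" using that arcV by blast
      obtain g where g: "aut g" "g v = u" using vertex_transitive[OF vV uV] by blast
      obtain e k where e: "\<forall>t\<in>V. h (g t) = e * h t + k" using h[OF g(1)] by blast
      have "h w = e * h x + k" if w: "(u, w) \<in> E \<or> (w, u) \<in> E" for w
      proof -
        have "w \<in> V" using w arcV by blast
        then obtain t where t: "t \<in> V" "g t = w" using aut_preimage[OF g(1)] by blast
        then have "(v, t) \<in> E \<or> (t, v) \<in> E" using w autE[OF g(1)] vV g(2) by blast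
        then show ?thesis using allv e t by auto
      qed
      then show ?thesis using that by metis
    qed
    have "(h u = h v \<and> (\<forall>y. (u, y) \<in> E \<or> (y, u) \<in> E \<longrightarrow> h y = h x)) \<or>
          (h u = h x \<and> (\<forall>y. (u, y) \<in> E \<or> (y, u) \<in> E \<longrightarrow> h y = h v))" (is "?P u") if "u \<in> V" for u
    proof (rule connected_invariant[where P = ?P, OF conn vV _ _ that])
      show "?P v" using allv by blast
      fix p q assume "(p, q) \<in> uadj V E" and P: "?P p"
      then have pq: "(p, q) \<in> E \<or> (q, p) \<in> E" by (auto simp: uadj_def)
      have "\<forall>y. (q, y) \<in> E \<or> (y, q) \<in> E \<longrightarrow> h y = h p" using nb[of q _ p] pq by blast
      then show "?P q" using P pq by auto
    qed
    then show False using twoval by blast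
  qed
  define e0 where "e0 = h b - h a"
  have e0: "e0 \<noteq> 0" using step[OF ab] c0 by (auto simp: e0_def)
  have up: "h y - h v = e0" if vy: "(v, y) \<in> E" for v y
  proof -
    have "\<forall>y. (v, y) \<in> E \<longrightarrow> h y - h v = e0"
    proof (rule connected_invariant[where P = "\<lambda>v. \<forall>y. (v, y) \<in> E \<longrightarrow> h y - h v = e0", OF conn, of a])
      show "\<forall>y. (a, y) \<in> E \<longrightarrow> h y - h a = e0" using sout[OF ab] by (auto simp: e0_def)
      fix p q assume "(p, q) \<in> uadj V E" and P: "\<forall>y. (p, y) \<in> E \<longrightarrow> h y - h p = e0"
      then consider "(p, q) \<in> E" | "(q, p) \<in> E" by (auto simp: uadj_def)
      then show "\<forall>y. (q, y) \<in> E \<longrightarrow> h y - h q = e0"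
      proof cases
        case 1 then show ?thesis using P opp[OF _ 1] by auto
      next
        case 2
        then obtain y where y: "(p, y) \<in> E" using exout arcV by blast
        then have "h p - h q = e0" using P opp[OF y 2] by auto
        then show ?thesis using sout[OF 2] by auto
      qed
    qed (use arcV[OF ab] arcV[OF vy] in auto)
    then show ?thesis using vy by blast
  qed
  \<comment> \<open>\<open>h\<close> need not be a multiple of \<open>e0\<close>, but adding
    \<open>e0\<close> raises the quotient by exactly 1. Dividing by the signed \<open>e0\<close>
    makes arcs go up even if \<open>h\<close> decreases along them.\<close>
  define lev where "lev v = h v div e0" for v
  have "lev y = lev x + 1" if "(x, y) \<in> E" for x y
  proof -
    have "h y = h x + e0" using up[OF that] by simp
    then show ?thesis using div_add_self2[OF e0] by (simp add: lev_def)
  qed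
  moreover have "finite {v \<in> V. lev v = k}" for k
  proof -
    have "{v \<in> V. lev v = k} \<subseteq> (\<Union>r\<in>{e0 * k - \<bar>e0\<bar>..e0 * k + \<bar>e0\<bar>}. {v \<in> V. h v = r})"
    proof
      fix v assume v: "v \<in> {v \<in> V. lev v = k}"
      have "h v = e0 * k + h v mod e0" using v mult_div_mod_eq[of e0 "h v"] by (simp add: lev_def)
      moreover have "\<bar>h v mod e0\<bar> < \<bar>e0\<bar>" using e0 by (rule abs_mod_less)
      ultimately have "h v \<in> {e0 * k - \<bar>e0\<bar>..e0 * k + \<bar>e0\<bar>}" by auto
      then show "v \<in> (\<Union>r\<in>{e0 * k - \<bar>e0\<bar>..e0 * k + \<bar>e0\<bar>}. {v \<in> V. h v = r})" using v by blast
    qed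
    moreover have "finite (\<Union>r\<in>{e0 * k - \<bar>e0\<bar>..e0 * k + \<bar>e0\<bar>}. {v \<in> V. h v = r})" using hfin by blast
    ultimately show ?thesis by (rule finite_subset)
  qed
  ultimately show ?thesis using ab by blast
qed

end

section \<open>Complete bipartite levels from twins\<close>

text \<open>By Pascal's rule. It shows that \<open>n - 1\<close> candidates are too few to realise
  all \<open>k\<close>-subsets of an \<open>n\<close>-set.\<close>

lemma le_choose: "0 < k \<Longrightarrow> k < n \<Longrightarrow> n \<le> n choose k"
proof (induction n arbitrary: k)
  case (Suc n)
  then obtain i where k: "k = Suc i" by (cases k) auto
  show ?case
  proof (cases "k = n")
    case True then show ?thesis by simp
  next
    case False
    then have "n \<le> n choose k" using Suc by auto
    moreover have "n choose i \<ge> 1" using Suc.prems k by (simp add: Suc_le_eq)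
    ultimately show ?thesis using k by simp
  qed
qed simp

lemma ex_permutation_onto:
  assumes "finite U" "T \<subseteq> U" "T' \<subseteq> U" "card T' = card T"
  shows "\<exists>p. bij_betw p U U \<and> p ` T = T'"
proof -
  have f: "finite T" "finite T'" "finite (U - T)" "finite (U - T')" using assms finite_subset by auto
  obtain p where p: "bij_betw p T T'" using finite_same_card_bij[OF f(1,2)] assms(4) by auto
  have "card (U - T) = card (U - T')" using assms f by (simp add: card_Diff_subset)
  then obtain q where q: "bij_betw q (U - T) (U - T')" using finite_same_card_bij[OF f(3,4)] by auto
  have "bij_betw (\<lambda>x. if x \<in> T then p x else q x) (T \<union> (U - T)) (T' \<union> (U - T'))"
    by (rule bij_betw_disjoint_Un[OF p q]) auto
  moreover have "T \<union> (U - T) = U" "T' \<union> (U - T') = U" using assms by auto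
  moreover have "(\<lambda>x. if x \<in> T then p x else q x) ` T = T'" using p by (auto simp: bij_betw_def)
  ultimately show ?thesis by metis
qed

section \<open>Levels, degrees and transitivity in a graded digraph\<close>

locale graded_digraph = homog_digraph +
  fixes lev :: "'a \<Rightarrow> int"
  assumes lev: "(x, y) \<in> E \<Longrightarrow> lev y = lev x + 1"
    and level_finite: "finite {v \<in> V. lev v = k}"
    and arc_exists: "\<exists>x y. (x, y) \<in> E"
begin

lemma exout: assumes "v \<in> V" shows "\<exists>y. (v, y) \<in> E"
proof -
  obtain a b where ab: "(a, b) \<in> E" using arc_exists by blast
  obtain g where "aut g" "g a = v" using vertex_transitive arcV[OF ab] assms by blast
  then show ?thesis using aut_arc ab by blast
qed

lemma exin: assumes "v \<in> V" shows "\<exists>y. (y, v) \<in> E"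
proof -
  obtain a b where ab: "(a, b) \<in> E" using arc_exists by blast
  obtain g where "aut g" "g b = v" using vertex_transitive arcV[OF ab] assms by blast
  then show ?thesis using aut_arc ab by blast
qed

lemma aut_lev:
  assumes g: "aut g" "u \<in> V" "v \<in> V"
  shows "lev (g v) - lev v = lev (g u) - lev u"
proof (rule connected_invariant[where P = "\<lambda>v. lev (g v) - lev v = lev (g u) - lev u", OF conn g(2) refl _ g(3)])
  fix x y assume "(x, y) \<in> uadj V E" and e: "lev (g x) - lev x = lev (g u) - lev u"
  then consider "(x, y) \<in> E" | "(y, x) \<in> E" by (auto simp: uadj_def)
  then show "lev (g y) - lev y = lev (g u) - lev u"
  proof cases
    case 1 then show ?thesis using e lev[OF 1] lev[OF aut_arc[OF g(1) 1]] by simp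
  next
    case 2 then show ?thesis using e lev[OF 2] lev[OF aut_arc[OF g(1) 2]] by simp
  qed
qed

lemma level_card: assumes "u \<in> V" "v \<in> V" shows "card {x \<in> V. lev x = lev u} = card {x \<in> V. lev x = lev v}"
proof -
  have "card {x \<in> V. lev x = lev u} \<le> card {x \<in> V. lev x = lev v}" if uv: "u \<in> V" "v \<in> V" for u v
  proof -
    obtain g where g: "aut g" "g u = v" using vertex_transitive[OF uv] by blast
    have "g ` {x \<in> V. lev x = lev u} \<subseteq> {x \<in> V. lev x = lev v}"
    proof (rule image_subsetI)
      fix x assume "x \<in> {x \<in> V. lev x = lev u}"
      then show "g x \<in> {x \<in> V. lev x = lev v}" using aut_lev[OF g(1) uv(1), of x] aut_in[OF g(1)] g(2) by auto
    qed
    moreover have "inj_on g {x \<in> V. lev x = lev u}" using aut_inj[OF g(1)] by (rule inj_on_subset) auto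
    ultimately show ?thesis by (intro card_inj_on_le[OF _ _ level_finite])
  qed
  then show ?thesis using assms by (meson le_antisym)
qed

definition deg :: nat where "deg = card (out (SOME v. v \<in> V))"

lemma card_out: assumes "v \<in> V" shows "card (out v) = deg"
proof -
  let ?u = "SOME v. v \<in> V"
  have u: "?u \<in> V" using assms by (rule someI)
  obtain g where g: "aut g" "g ?u = v" using vertex_transitive[OF u assms] by blast
  have "inj_on g (out ?u)" by (rule inj_on_subset[OF aut_inj[OF g(1)]]) (use arcV in auto)
  then show ?thesis using aut_out[OF g(1) u] g(2) by (metis card_image deg_def)
qed

text \<open>The arcs between two consecutive levels are counted from both sides; the levels have
  equal positive size, so in-degree and out-degree agree.\<close>

lemma card_inn: assumes v: "v \<in> V" shows "card (inn v) = deg"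
proof -
  have c: "card (inn u) = card (inn v)" if u: "u \<in> V" for u
  proof -
    obtain g where g: "aut g" "g v = u" using vertex_transitive[OF v u] by blast
    have "inj_on g (inn v)" by (rule inj_on_subset[OF aut_inj[OF g(1)]]) (use arcV in auto)
    then show ?thesis using aut_inn[OF g(1) v] g(2) by (metis card_image)
  qed
  obtain w where w: "(v, w) \<in> E" using exout[OF v] by blast
  let ?L = "{x \<in> V. lev x = lev v}" and ?M = "{x \<in> V. lev x = lev w}"
  have "card (Sigma ?L out) = card ?L * deg" using card_out level_finite by (subst card_SigmaI) auto
  moreover have "card (Sigma ?M inn) = card ?M * card (inn v)"
    using c level_finite by (subst card_SigmaI) auto
  moreover have "bij_betw prod.swap (Sigma ?L out) (Sigma ?M inn)"
  proof (rule bij_betw_byWitness[where f' = prod.swap])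
    have l: "x \<in> V \<and> y \<in> V \<and> (lev x = lev v \<longleftrightarrow> lev y = lev w)" if "(x, y) \<in> E" for x y
      using lev[OF w] lev[OF that] arcV[OF that] by auto
    show "prod.swap ` Sigma ?L out \<subseteq> Sigma ?M inn" using l by auto
    show "prod.swap ` Sigma ?M inn \<subseteq> Sigma ?L out" using l by auto
  qed auto
  then have "card (Sigma ?L out) = card (Sigma ?M inn)" by (rule bij_betw_same_card)
  moreover have "card ?L = card ?M" using level_card v w arcV by blast
  moreover have "card ?L > 0" using v level_finite by (auto simp: card_gt_0_iff)
  ultimately show ?thesis by simp
qed

lemma lev_relpow: "(x, y) \<in> E ^^ n \<Longrightarrow> lev y = lev x + int n"
  by (induction n arbitrary: y) (auto dest: lev)

lemma lev_rtrancl: "(x, y) \<in> E\<^sup>* \<Longrightarrow> lev x \<le> lev y"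
  by (induction rule: rtrancl_induct) (auto dest: lev)

lemma relpow_V: "(x, y) \<in> E ^^ n \<Longrightarrow> x \<in> V \<Longrightarrow> y \<in> V"
  by (cases n) (auto dest: arcV)

lemma rtrancl_V: "(x, y) \<in> E\<^sup>* \<Longrightarrow> x \<in> V \<Longrightarrow> y \<in> V"
  by (induction rule: rtrancl_induct) (auto dest: arcV)

text \<open>Both \<open>p\<close> and \<open>q\<close> are attached to \<open>S\<close> only by
  their arc to \<open>x\<close>, so exchanging one for the other is an isomorphism of induced
  subdigraphs.\<close>

lemma move_leaf:
  assumes S: "S \<subseteq> V" "finite S" "connected_on S E" "x \<in> S"
    and p: "(p, x) \<in> E" "p \<notin> S" "\<And>s. s \<in> S - {x} \<Longrightarrow> (p, s) \<notin> E \<and> (s, p) \<notin> E"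
    and q: "(q, x) \<in> E" "q \<notin> S" "\<And>s. s \<in> S - {x} \<Longrightarrow> (q, s) \<notin> E \<and> (s, q) \<notin> E"
  shows "\<exists>g. aut g \<and> (\<forall>s\<in>S. g s = s) \<and> g p = q"
proof -
  let ?f = "\<lambda>t. if t = p then q else t"
  have "connected_on (insert p S) E"
  proof (rule connected_onI[of x])
    fix t assume t: "t \<in> insert p S"
    show "(t, x) \<in> (uadj (insert p S) E)\<^sup>*"
    proof (cases "t = p")
      case True
      have "(p, x) \<in> uadj (insert p S) E" using p(1) S(4) by (auto simp: uadj_def)
      then show ?thesis using True by auto
    next
      case False
      then have "(t, x) \<in> (uadj S E)\<^sup>*" using t S by (auto simp: connected_on_def)
      then show ?thesis by (rule uadj_rtrancl_mono[rotated]) auto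
    qed
  qed (use S in simp)
  moreover have px: "(x, p) \<notin> E" "(x, q) \<notin> E" using p q antisym by blast+
  have "(s, t) \<in> E \<longleftrightarrow> (?f s, ?f t) \<in> E" if "s \<in> insert p S" "t \<in> insert p S" for s t
    using that p q px irrefl by (cases "s = x"; cases "t = x"; auto)
  ultimately have "\<exists>g. aut g \<and> (\<forall>t\<in>insert p S. g t = ?f t)"
    using S p(2) q(2) arcV[OF p(1)] arcV[OF q(1)] by (intro extend) (auto simp: inj_on_def)
  then show ?thesis using p(2) by (metis insertCI)
qed

text \<open>Levels exclude an arc between \<open>p\<close> and \<open>q\<close>, so all such triples
  induce isomorphic subdigraphs. This transfers any configuration from one pair to every
  other.\<close>

lemma siblings_transitive:
  assumes "p \<noteq> q" "(p, r) \<in> E" "(q, r) \<in> E" "p' \<noteq> q'" "(p', r') \<in> E" "(q', r') \<in> E"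
  shows "\<exists>g. aut g \<and> g p = p' \<and> g q = q'"
proof -
  let ?f = "\<lambda>t. if t = p then p' else if t = q then q' else r'"
  have l: "lev p = lev q" "lev r = lev p + 1" "lev p' = lev q'" "lev r' = lev p' + 1"
    using lev[OF assms(2)] lev[OF assms(3)] lev[OF assms(5)] lev[OF assms(6)] by auto
  have n: "r \<noteq> p" "r \<noteq> q" "r' \<noteq> p'" "r' \<noteq> q'" using l by auto
  have na: "(p, q) \<notin> E" "(q, p) \<notin> E" "(p', q') \<notin> E" "(q', p') \<notin> E"
    using l lev[of p q] lev[of q p] lev[of p' q'] lev[of q' p'] by auto
  have nb: "(r, p) \<notin> E" "(r, q) \<notin> E" "(r', p') \<notin> E" "(r', q') \<notin> E" using assms antisym by blast+
  have "\<exists>g. aut g \<and> (\<forall>t\<in>{p,q,r}. g t = ?f t)"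
  proof (rule extend)
    show "connected_on {p,q,r} E" by (rule star_connected[of r]) (use assms in auto)
    fix x y assume "x \<in> {p,q,r}" "y \<in> {p,q,r}"
    then show "(x, y) \<in> E \<longleftrightarrow> (?f x, ?f y) \<in> E" using n na nb assms irrefl by auto
  qed (use assms n arcV in \<open>auto simp: inj_on_def\<close>)
  then show ?thesis using n assms(1) by auto
qed

lemma cosiblings_transitive:
  assumes "p \<noteq> q" "(r, p) \<in> E" "(r, q) \<in> E" "p' \<noteq> q'" "(r', p') \<in> E" "(r', q') \<in> E"
  shows "\<exists>g. aut g \<and> g p = p' \<and> g q = q'"
proof -
  let ?f = "\<lambda>t. if t = p then p' else if t = q then q' else r'"
  have l: "lev p = lev q" "lev p = lev r + 1" "lev p' = lev q'" "lev p' = lev r' + 1"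
    using lev[OF assms(2)] lev[OF assms(3)] lev[OF assms(5)] lev[OF assms(6)] by auto
  have n: "r \<noteq> p" "r \<noteq> q" "r' \<noteq> p'" "r' \<noteq> q'" using l by auto
  have na: "(p, q) \<notin> E" "(q, p) \<notin> E" "(p', q') \<notin> E" "(q', p') \<notin> E"
    using l lev[of p q] lev[of q p] lev[of p' q'] lev[of q' p'] by auto
  have nb: "(p, r) \<notin> E" "(q, r) \<notin> E" "(p', r') \<notin> E" "(q', r') \<notin> E" using assms antisym by blast+
  have "\<exists>g. aut g \<and> (\<forall>t\<in>{p,q,r}. g t = ?f t)"
  proof (rule extend)
    show "connected_on {p,q,r} E" by (rule star_connected[of r]) (use assms in auto)
    fix x y assume "x \<in> {p,q,r}" "y \<in> {p,q,r}"
    then show "(x, y) \<in> E \<longleftrightarrow> (?f x, ?f y) \<in> E" using n na nb assms irrefl by auto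
  qed (use assms n arcV in \<open>auto simp: inj_on_def\<close>)
  then show ?thesis using n assms(1) by auto
qed

text \<open>If two siblings share \<open>k\<close> of their \<open>d\<close> out-neighbours with \<open>0 < k < d\<close>, then all \<open>k\<close>-subsets of \<open>out x\<close>
  occur as such intersections for siblings of \<open>x\<close> in \<open>out z - {x}\<close>, but there are only \<open>d - 1\<close> of these.\<close>

lemma siblings_same_out:
  assumes twin: "\<And>x y. x \<noteq> y \<Longrightarrow> (\<exists>w. (x, w) \<in> E \<and> (y, w) \<in> E) \<longleftrightarrow> (\<exists>z. (z, x) \<in> E \<and> (z, y) \<in> E)"
    and w: "(x, w) \<in> E" "(y, w) \<in> E"
  shows "out x = out y"
proof (rule ccontr)
  assume ne: "out x \<noteq> out y"
  then have xy: "x \<noteq> y" by auto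
  then obtain z where z: "(z, x) \<in> E" "(z, y) \<in> E" using twin w by blast
  have V: "x \<in> V" "y \<in> V" "z \<in> V" using w z arcV by blast+
  define T where "T = out x \<inter> out y"
  have Tpos: "card T > 0" using w V by (auto simp: T_def card_gt_0_iff)
  have Tlt: "card T < deg"
  proof -
    have "T \<noteq> out x"
    proof
      assume "T = out x"
      then have "out x \<subseteq> out y" by (auto simp: T_def)
      then show False using ne card_subset_eq[of "out y" "out x"] card_out V by simp
    qed
    then have "T \<subset> out x" by (auto simp: T_def)
    then show ?thesis using psubset_card_mono[of "out x" T] V card_out by simp
  qed
  have lv: "lev x = lev z + 1" "\<And>t. (x, t) \<in> E \<Longrightarrow> lev t = lev z + 2"
    using lev[OF z(1)] lev[of x] by auto
  have "{T'. T' \<subseteq> out x \<and> card T' = card T} \<subseteq> (\<lambda>y. out x \<inter> out y) ` (out z - {x})"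
  proof
    fix T' assume "T' \<in> {T'. T' \<subseteq> out x \<and> card T' = card T}"
    then obtain p where p: "bij_betw p (out x) (out x)" "p ` T = T'"
      using ex_permutation_onto[of "out x" T T'] V by (auto simp: T_def)
    \<comment> \<open>Keeping \<open>z\<close> and \<open>x\<close> fixed makes the image of
      \<open>y\<close> another out-neighbour of \<open>z\<close> different from \<open>x\<close>,
      while the permutation of \<open>out x\<close> moves \<open>T\<close> to
      \<open>T'\<close>.\<close>
    let ?S = "insert z (insert x (out x))"
    define f where "f t = (if (x, t) \<in> E then p t else t)" for t
    have f1: "f t = p t" if "(x, t) \<in> E" for t using that by (simp add: f_def)
    have f2: "f t = t" if "(x, t) \<notin> E" for t using that by (simp add: f_def)
    have pE: "(x, p t) \<in> E" if "(x, t) \<in> E" for t using p(1) that by (auto dest: bij_betwE)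
    have fE: "(x, f t) \<in> E \<longleftrightarrow> (x, t) \<in> E" for t using f1 f2 pE by (cases "(x, t) \<in> E") auto
    have nx: "(x, x) \<notin> E" "(x, z) \<notin> E" using irrefl antisym z by blast+
    have "\<exists>g. aut g \<and> (\<forall>t\<in>?S. g t = f t)"
    proof (rule extend)
      show "?S \<subseteq> V" using V arcV by auto
      show "finite ?S" using V by simp
      show "connected_on ?S E" by (rule star_connected[of x]) (use z in auto)
      show "f ` ?S \<subseteq> V"
      proof (rule image_subsetI)
        fix t assume "t \<in> ?S"
        then show "f t \<in> V" using fE[of t] f2[of t] arcV V by (cases "(x, t) \<in> E") auto
      qed
      show "inj_on f ?S"
      proof (rule inj_onI)
        fix s t assume e: "f s = f t"
        have pi: "p s = p t \<Longrightarrow> (x, s) \<in> E \<Longrightarrow> (x, t) \<in> E \<Longrightarrow> s = t"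
          using p(1) by (meson bij_betw_def in_out inj_onD)
        show "s = t" using e pi fE[of s] fE[of t] f1[of s] f1[of t] f2[of s] f2[of t] by metis
      qed
      fix s t assume st: "s \<in> ?S" "t \<in> ?S"
      have iff: "(s, t) \<in> E \<longleftrightarrow> (s = z \<and> t = x) \<or> (s = x \<and> (x, t) \<in> E)" if m: "s \<in> ?S" "t \<in> ?S" for s t
      proof
        assume "(s, t) \<in> E"
        then have l: "lev t = lev s + 1" by (rule lev)
        consider "s = z" | "s = x" | "(x, s) \<in> E" using m by auto
        then show "(s = z \<and> t = x) \<or> (s = x \<and> (x, t) \<in> E)"
        proof cases
          case 1
          then have "lev t = lev z + 1" using l by simp
          then have "t \<noteq> z" "(x, t) \<notin> E" using lv(2)[of t] by auto
          then show ?thesis using 1 m by auto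
        next
          case 2 then show ?thesis using \<open>(s, t) \<in> E\<close> by simp
        next
          case 3
          then have "lev t = lev z + 3" using l lv(2)[of s] by simp
          then have "t \<noteq> z" "t \<noteq> x" "(x, t) \<notin> E" using lv(1) lv(2)[of t] by auto
          then show ?thesis using m by auto
        qed
      qed (use z in auto)
      have fS: "f t \<in> ?S" if "t \<in> ?S" for t using that fE f2 by (cases "(x, t) \<in> E") auto
      have fz: "f t = z \<longleftrightarrow> t = z" "f t = x \<longleftrightarrow> t = x" for t
        using fE[of t] f2[of t] nx by (cases "(x, t) \<in> E"; auto)+
      show "(s, t) \<in> E \<longleftrightarrow> (f s, f t) \<in> E"
        unfolding iff[OF st] iff[OF fS[OF st(1)] fS[OF st(2)]] fz fE ..
    qed
    then obtain g where g: "aut g" "\<forall>t\<in>?S. g t = f t" by blast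
    have gz: "g z = z" "g x = x" using g(2) nx f2 by auto
    have gi: "inj_on g V" by (rule aut_inj[OF g(1)])
    have "g ` T = T'" using g(2) f1 unfolding p(2)[symmetric] by (intro image_cong) (auto simp: T_def)
    moreover have "g ` T = out x \<inter> out (g y)"
    proof -
      have "g ` T = g ` out x \<inter> g ` out y" unfolding T_def
        by (rule inj_on_image_Int[OF gi]) (use arcV in auto)
      then show ?thesis using aut_out[OF g(1) V(1)] aut_out[OF g(1) V(2)] gz by simp
    qed
    moreover have "(z, g y) \<in> E" using aut_arc[OF g(1) z(2)] gz by simp
    moreover have "g y \<noteq> x" using gi gz(2) xy V by (metis inj_onD)
    ultimately show "T' \<in> (\<lambda>y. out x \<inter> out y) ` (out z - {x})" by auto
  qed
  then have "card {T'. T' \<subseteq> out x \<and> card T' = card T} \<le> card (out z - {x})"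
    using V by (meson card_image_le card_mono finite_Diff finite_imageI finite_out le_trans)
  also have "\<dots> = deg - 1" using V z card_out by (simp add: card_Diff_singleton)
  finally have "deg choose card T \<le> deg - 1" using n_subsets[of "out x" "card T"] V card_out by simp
  then show False using le_choose[OF Tpos Tlt] Tlt by linarith
qed

text \<open>Walks from \<open>u\<close> are straightened: the twin rules remove each change of
  direction, so every vertex is a strict descendant of \<open>u\<close> or a strict ancestor of an
  out-neighbour of \<open>u\<close>. One level above \<open>u\<close>, only an arc remains
  possible.\<close>

lemma twins_complete:
  assumes twin: "\<And>x y. x \<noteq> y \<Longrightarrow> (\<exists>w. (x, w) \<in> E \<and> (y, w) \<in> E) \<longleftrightarrow> (\<exists>z. (z, x) \<in> E \<and> (z, y) \<in> E)"
    and uv: "u \<in> V" "v \<in> V" "lev v = lev u + 1"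
  shows "(u, v) \<in> E"
proof -
  have so: "(x, t) \<in> E" if "(x, w) \<in> E" "(y, w) \<in> E" "(y, t) \<in> E" for x y w t
    using siblings_same_out[OF twin that(1,2)] that(3) by (metis in_out)
  have co: "(x, t) \<in> E" if h: "(z, x) \<in> E" "(z, y) \<in> E" "(y, t) \<in> E" for x y z t
  proof (cases "x = y")
    case False
    then obtain w where "(x, w) \<in> E" "(y, w) \<in> E" using twin h by blast
    then show ?thesis using so h by blast
  qed (use h in simp)
  \<comment> \<open>For distinct \<open>x\<close> and \<open>y\<close>, the common in-neighbour
    \<open>z\<close> and the vertex \<open>t\<close> both point to \<open>y\<close>, so they have
    the same out-neighbours, among them \<open>x\<close>.\<close>
  have si: "(t, x) \<in> E" if h: "(x, w) \<in> E" "(y, w) \<in> E" "(t, y) \<in> E" for x y w t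
  proof (cases "x = y")
    case False
    then obtain z where "(z, x) \<in> E" "(z, y) \<in> E" using twin h by blast
    then show ?thesis using so h by blast
  qed (use h in simp)
  have "(u, v) \<in> E\<^sup>+ \<or> (\<exists>y. (u, y) \<in> E \<and> (v, y) \<in> E\<^sup>+)"
  proof (rule connected_invariant[where P = "\<lambda>v. (u, v) \<in> E\<^sup>+ \<or> (\<exists>y. (u, y) \<in> E \<and> (v, y) \<in> E\<^sup>+)", OF conn uv(1) _ _ uv(2)])
    show "(u, u) \<in> E\<^sup>+ \<or> (\<exists>y. (u, y) \<in> E \<and> (u, y) \<in> E\<^sup>+)" using exout[OF uv(1)] by auto
    fix v v' assume "(v, v') \<in> uadj V E" and P: "(u, v) \<in> E\<^sup>+ \<or> (\<exists>y. (u, y) \<in> E \<and> (v, y) \<in> E\<^sup>+)"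
    then consider (a) "(u, v) \<in> E\<^sup>+" "(v, v') \<in> E" | (b) "(u, v) \<in> E\<^sup>+" "(v', v) \<in> E"
      | (c) y where "(u, y) \<in> E" "(v, y) \<in> E\<^sup>+" "(v', v) \<in> E"
      | (d) y where "(u, y) \<in> E" "(v, y) \<in> E\<^sup>+" "(v, v') \<in> E"
      by (auto simp: uadj_def)
    then show "(u, v') \<in> E\<^sup>+ \<or> (\<exists>y. (u, y) \<in> E \<and> (v', y) \<in> E\<^sup>+)"
    proof cases
      case a then show ?thesis by (meson trancl.trancl_into_trancl)
    next
      case b
      from b(1) obtain p where p: "(u, p) \<in> E\<^sup>*" "(p, v) \<in> E" by (meson tranclD2)
      show ?thesis
      proof (cases "u = p")
        case True then show ?thesis using p b(2) by blast
      next
        case False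
        then obtain q where "(u, q) \<in> E\<^sup>*" "(q, p) \<in> E" using p(1) by (meson rtranclE)
        then have "(u, v') \<in> E\<^sup>+" using si[OF b(2) p(2)] by (meson rtrancl_into_trancl1)
        then show ?thesis by blast
      qed
    next
      case c then show ?thesis by (meson trancl_into_trancl2)
    next
      case d
      from d(2) obtain p where p: "(v, p) \<in> E" "(p, y) \<in> E\<^sup>*" by (meson tranclD)
      show ?thesis
      proof (cases "p = y")
        case True
        then have "(u, v') \<in> E" using so[of u y v v'] d p by blast
        then show ?thesis by blast
      next
        case False
        then obtain q where q: "(p, q) \<in> E" "(q, y) \<in> E\<^sup>*" using p(2) by (meson converse_rtranclE)
        then have "(v', q) \<in> E" using co[OF d(3) p(1)] by blast
        then have "(v', y) \<in> E\<^sup>+" using q(2) by (meson rtrancl_into_trancl2)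
        then show ?thesis using d(1) by blast
      qed
    qed
  qed
  then show ?thesis
  proof
    assume "(u, v) \<in> E\<^sup>+"
    then obtain p where p: "(u, p) \<in> E\<^sup>*" "(p, v) \<in> E" by (meson tranclD2)
    show ?thesis
    proof (cases "u = p")
      case False
      then obtain q where "(u, q) \<in> E\<^sup>*" "(q, p) \<in> E" using p(1) by (meson rtranclE)
      then have "lev p \<ge> lev u + 1" using lev_rtrancl[of u q] lev[of q p] by simp
      then show ?thesis using lev[OF p(2)] uv(3) by simp
    qed (use p in simp)
  next
    assume "\<exists>y. (u, y) \<in> E \<and> (v, y) \<in> E\<^sup>+"
    then obtain y p where p: "(u, y) \<in> E" "(v, p) \<in> E" "(p, y) \<in> E\<^sup>*" by (meson tranclD)
    then have "lev y = lev u + 1" "lev p = lev v + 1" "lev p \<le> lev y"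
      using lev[OF p(1)] lev[OF p(2)] lev_rtrancl[OF p(3)] by auto
    then show ?thesis using uv(3) by simp
  qed
qed

end

section \<open>Confluence\<close>

context graded_digraph
begin

text \<open>\<open>confluent 0\<close> is impossible, and \<open>confluent 1\<close> says that a
  diamond exists.\<close>

definition confluent :: "nat \<Rightarrow> bool" where
  "confluent n \<longleftrightarrow> (\<exists>u x y w. x \<noteq> y \<and> (u, x) \<in> E \<and> (u, y) \<in> E \<and> (x, w) \<in> E ^^ n \<and> (y, w) \<in> E ^^ n)"

lemma not_confluentD:
  "\<not> confluent n \<Longrightarrow> (u, x) \<in> E \<Longrightarrow> (u, y) \<in> E \<Longrightarrow> (x, w) \<in> E ^^ n \<Longrightarrow> (y, w) \<in> E ^^ n \<Longrightarrow> x = y"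
  unfolding confluent_def by blast

text \<open>Absence of short confluences is stable under reversing arcs: the second vertices of both
  paths from \<open>u\<close> reach \<open>w\<close> equally fast, so they coincide, and the paths
  can be shortened.\<close>

lemma not_confluent_dual:
  assumes "\<And>n. n < j \<Longrightarrow> \<not> confluent n"
  shows "n < j \<Longrightarrow> (x, w) \<in> E \<Longrightarrow> (y, w) \<in> E \<Longrightarrow> (u, x) \<in> E ^^ n \<Longrightarrow> (u, y) \<in> E ^^ n \<Longrightarrow> x = y"
proof (induction n arbitrary: u)
  case (Suc n)
  obtain s where s: "(u, s) \<in> E" "(s, x) \<in> E ^^ n" using relpow_Suc_D2[OF Suc.prems(4)] by blast
  obtain t where t: "(u, t) \<in> E" "(t, y) \<in> E ^^ n" using relpow_Suc_D2[OF Suc.prems(5)] by blast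
  have "(s, w) \<in> E ^^ Suc n" "(t, w) \<in> E ^^ Suc n" using s t Suc.prems by auto
  then have "s = t" using not_confluentD[OF assms[OF Suc.prems(1)]] s t by blast
  then show ?case using Suc.IH Suc.prems s t by auto
qed simp

text \<open>Distinct out-neighbours of \<open>u\<close> have disjoint sets of \<open>n\<close>-step
  descendants, so the count at least doubles with each step.\<close>

lemma not_confluent_growth:
  assumes "deg \<ge> 2" "\<And>n. \<not> confluent n"
  shows "u \<in> V \<Longrightarrow> 2 ^ n \<le> card {w. (u, w) \<in> E ^^ n}"
proof (induction n arbitrary: u)
  case (Suc n)
  have fin: "finite {w. (x, w) \<in> E ^^ n}" if "x \<in> V" for x n
  proof (rule finite_subset[OF _ level_finite])
    show "{w. (x, w) \<in> E ^^ n} \<subseteq> {v \<in> V. lev v = lev x + int n}" using lev_relpow relpow_V that by blast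
  qed
  have "card (out u) \<ge> 2" using card_out Suc.prems assms by simp
  then obtain x y where xy: "x \<in> out u" "y \<in> out u" "x \<noteq> y"
    by (metis Suc.prems card_le_Suc0_iff_eq finite_out not_less_eq_eq numeral_2_eq_2)
  have V: "x \<in> V" "y \<in> V" using xy arcV by auto
  let ?X = "{w. (x, w) \<in> E ^^ n}" and ?Y = "{w. (y, w) \<in> E ^^ n}"
  have "?X \<inter> ?Y = {}" using not_confluentD[OF assms(2)[of n], of u x y] xy by auto
  then have "card (?X \<union> ?Y) = card ?X + card ?Y" using fin V by (intro card_Un_disjoint) auto
  moreover have "?X \<union> ?Y \<subseteq> {w. (u, w) \<in> E ^^ Suc n}" using xy relpow_Suc_I2[of u _ E _ n] by auto
  then have "card (?X \<union> ?Y) \<le> card {w. (u, w) \<in> E ^^ Suc n}" using fin[OF Suc.prems] by (rule card_mono[rotated])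
  ultimately show ?case using Suc.IH[OF V(1)] Suc.IH[OF V(2)] by simp
qed (simp add: card_eq_0_iff Suc_le_eq)

lemma confluent_exists:
  assumes "deg \<ge> 2"
  shows "\<exists>n. confluent n"
proof (rule ccontr)
  assume "\<not> ?thesis"
  then have nc: "\<And>n. \<not> confluent n" by blast
  obtain u where u: "u \<in> V" using conn by (auto simp: connected_on_def)
  define m where "m = card {x \<in> V. lev x = lev u}"
  have g: "2 ^ m \<le> card {w. (u, w) \<in> E ^^ m}" using not_confluent_growth[OF assms nc u] .
  have "(2::nat) ^ m > 0" by simp
  then have "{w. (u, w) \<in> E ^^ m} \<noteq> {}" using g by (metis card.empty not_less)
  then obtain w where w: "(u, w) \<in> E ^^ m" by blast
  have "{w. (u, w) \<in> E ^^ m} \<subseteq> {x \<in> V. lev x = lev w}"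
    using lev_relpow[OF w] lev_relpow relpow_V u by auto
  then have "card {w. (u, w) \<in> E ^^ m} \<le> card {x \<in> V. lev x = lev w}" using level_finite by (rule card_mono[rotated])
  also have "\<dots> = m" unfolding m_def using level_card relpow_V[OF w u] u by blast
  finally show False using g less_exp[of m] by linarith
qed

text \<open>Homogeneity carries the two middle vertices of one diamond to any pair with a common
  neighbour on either side, and the rest of the diamond comes along.\<close>

lemma confluent_1_twins:
  assumes "confluent 1" "p \<noteq> q"
  shows "(\<exists>w. (p, w) \<in> E \<and> (q, w) \<in> E) \<longleftrightarrow> (\<exists>z. (z, p) \<in> E \<and> (z, q) \<in> E)"
proof -
  obtain u x y w where c: "x \<noteq> y" "(u, x) \<in> E" "(u, y) \<in> E" "(x, w) \<in> E" "(y, w) \<in> E"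
    using assms(1) by (auto simp: confluent_def)
  show ?thesis
  proof
    assume "\<exists>r. (p, r) \<in> E \<and> (q, r) \<in> E"
    then obtain r where "(p, r) \<in> E" "(q, r) \<in> E" by blast
    then obtain g where g: "aut g" "g x = p" "g y = q" using siblings_transitive[of x y w p q r] c assms by blast
    then show "\<exists>z. (z, p) \<in> E \<and> (z, q) \<in> E" using aut_arc[OF g(1) c(2)] aut_arc[OF g(1) c(3)] by auto
  next
    assume "\<exists>r. (r, p) \<in> E \<and> (r, q) \<in> E"
    then obtain r where "(r, p) \<in> E" "(r, q) \<in> E" by blast
    then obtain g where g: "aut g" "g x = p" "g y = q" using cosiblings_transitive[of x y u p q r] c assms by blast
    then show "\<exists>z. (p, z) \<in> E \<and> (q, z) \<in> E" using aut_arc[OF g(1) c(4)] aut_arc[OF g(1) c(5)] by auto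
  qed
qed

text \<open>With legs of length \<open>j \<ge> 3\<close>, all \<open>d\<^sup>2\<close> two-step ancestors of \<open>b3\<close> share an in-neighbour with \<open>a\<close>,
  while each of the \<open>d\<close> in-neighbours of \<open>a\<close> points to at most one of them.\<close>

lemma no_late_confluence:
  assumes nc: "\<And>n. n < j \<Longrightarrow> \<not> confluent n" and cj: "confluent j" and j3: "j \<ge> 3" and d2: "deg \<ge> 2"
  shows False
proof -
  define i where "i = j - 3"
  have i: "j = Suc (Suc (Suc i))" using j3 by (simp add: i_def)
  obtain z a b w where zab: "a \<noteq> b" "(z, a) \<in> E" "(z, b) \<in> E" "(a, w) \<in> E ^^ j" "(b, w) \<in> E ^^ j"
    using cj by (auto simp: confluent_def)
  obtain aj where aj: "(a, aj) \<in> E ^^ Suc (Suc i)" "(aj, w) \<in> E" using zab(4) unfolding i by (meson relpow_Suc_E)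
  obtain bj where bj: "(b, bj) \<in> E ^^ Suc (Suc i)" "(bj, w) \<in> E" using zab(5) unfolding i by (meson relpow_Suc_E)
  obtain b2 where b2: "(b, b2) \<in> E" "(b2, bj) \<in> E ^^ Suc i" using relpow_Suc_D2[OF bj(1)] by blast
  obtain b3 where b3: "(b2, b3) \<in> E" "(b3, bj) \<in> E ^^ i" using relpow_Suc_D2[OF b2(2)] by blast
  have V: "a \<in> V" "b \<in> V" "w \<in> V" "b3 \<in> V" "aj \<in> V" "bj \<in> V" "z \<in> V" using zab aj bj b3 arcV by blast+
  have l: "lev b = lev a" "lev b2 = lev a + 1" "lev b3 = lev a + 2" "lev aj = lev a + 2 + int i"
    "lev bj = lev a + 2 + int i" "lev w = lev a + 3 + int i"
    using lev[OF zab(2)] lev[OF zab(3)] lev[OF b2(1)] lev[OF b3(1)] lev_relpow[OF b3(2)]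
      lev_relpow[OF aj(1)] lev[OF bj(2)] by auto
  have abj: "aj \<noteq> bj"
    using not_confluentD[OF nc[of "Suc (Suc i)"] zab(2,3) aj(1)] bj(1) zab(1) i by auto
  \<comment> \<open>The paths to \<open>aj\<close> and \<open>bj\<close> have the same length, below
    \<open>j\<close>, so the dual form of non-confluence at \<open>w\<close> would give
    \<open>aj = bj\<close>.\<close>
  have nocommon: False if h: "(p, aj) \<in> E\<^sup>*" "(p, bj) \<in> E\<^sup>*" "lev p \<ge> lev a" for p
  proof -
    obtain m n where mn: "(p, aj) \<in> E ^^ m" "(p, bj) \<in> E ^^ n" using h rtrancl_imp_relpow by metis
    then have "n = m" "m < j" using lev_relpow[OF mn(1)] lev_relpow[OF mn(2)] l h(3) i by auto
    then show False using not_confluent_dual[OF nc _ aj(2) bj(2) mn(1)] mn(2) abj by blast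
  qed
  \<comment> \<open>Intervals of the reachability order replace chosen paths: membership is
    reachability, so missing arcs follow from \<open>nocommon\<close> and levels. The second
    interval starts only at \<open>b3\<close>, leaving \<open>b2\<close> and \<open>b\<close> free
    to be moved.\<close>
  define IA where "IA = {v. (a, v) \<in> E\<^sup>* \<and> (v, aj) \<in> E\<^sup>*}"
  define IB where "IB = {v. (b3, v) \<in> E\<^sup>* \<and> (v, bj) \<in> E\<^sup>*}"
  define S where "S = IA \<union> IB \<union> {w}"
  have aIA: "a \<in> IA" "aj \<in> IA" using relpow_imp_rtrancl[OF aj(1)] by (auto simp: IA_def)
  have bIB: "b3 \<in> IB" "bj \<in> IB" using relpow_imp_rtrancl[OF b3(2)] by (auto simp: IB_def)
  have levA: "lev a \<le> lev v" "lev v \<le> lev aj" if "v \<in> IA" for v using that lev_rtrancl by (auto simp: IA_def)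
  have levB: "lev b3 \<le> lev v" "lev v \<le> lev bj" if "v \<in> IB" for v using that lev_rtrancl by (auto simp: IB_def)
  have SV: "S \<subseteq> V" using V rtrancl_V by (auto simp: S_def IA_def IB_def)
  have Sfin: "finite S"
  proof -
    have "S \<subseteq> (\<Union>k\<in>{lev a..lev w}. {v \<in> V. lev v = k})"
    proof
      fix v assume v: "v \<in> S"
      then have "lev a \<le> lev v \<and> lev v \<le> lev w" using levA levB l by (fastforce simp: S_def)
      then show "v \<in> (\<Union>k\<in>{lev a..lev w}. {v \<in> V. lev v = k})" using v SV by auto
    qed
    moreover have "finite (\<Union>k\<in>{lev a..lev w}. {v \<in> V. lev v = k})" using level_finite by blast
    ultimately show ?thesis by (rule finite_subset)
  qed
  have stepS: "(x, w) \<in> (uadj S E)\<^sup>*" if "(x, y) \<in> E" "x \<in> S" "y \<in> S" "(y, w) \<in> (uadj S E)\<^sup>*" for x y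
    using that by (auto simp: uadj_def intro: converse_rtrancl_into_rtrancl)
  have connA: "(v, w) \<in> (uadj S E)\<^sup>*" if v: "v \<in> IA" for v
  proof -
    have "(v, aj) \<in> E\<^sup>*" using v by (simp add: IA_def)
    then have "(a, v) \<in> E\<^sup>* \<longrightarrow> (v, w) \<in> (uadj S E)\<^sup>*"
    proof (induction rule: converse_rtrancl_induct)
      case base show ?case using stepS[OF aj(2)] aIA by (auto simp: S_def)
    next
      case (step x y)
      show ?case
      proof
        assume ax: "(a, x) \<in> E\<^sup>*"
        then have ay: "(a, y) \<in> E\<^sup>*" using step.hyps(1) by auto
        moreover have "(x, aj) \<in> E\<^sup>*" using step.hyps by (meson converse_rtrancl_into_rtrancl)
        ultimately have "x \<in> S" "y \<in> S" using ax step.hyps by (auto simp: S_def IA_def)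
        then show "(x, w) \<in> (uadj S E)\<^sup>*" using stepS[OF step.hyps(1)] step.IH ay by blast
      qed
    qed
    then show ?thesis using v by (simp add: IA_def)
  qed
  have connB: "(v, w) \<in> (uadj S E)\<^sup>*" if v: "v \<in> IB" for v
  proof -
    have "(v, bj) \<in> E\<^sup>*" using v by (simp add: IB_def)
    then have "(b3, v) \<in> E\<^sup>* \<longrightarrow> (v, w) \<in> (uadj S E)\<^sup>*"
    proof (induction rule: converse_rtrancl_induct)
      case base show ?case using stepS[OF bj(2)] bIB by (auto simp: S_def)
    next
      case (step x y)
      show ?case
      proof
        assume ax: "(b3, x) \<in> E\<^sup>*"
        then have ay: "(b3, y) \<in> E\<^sup>*" using step.hyps(1) by auto
        moreover have "(x, bj) \<in> E\<^sup>*" using step.hyps by (meson converse_rtrancl_into_rtrancl)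
        ultimately have "x \<in> S" "y \<in> S" using ax step.hyps by (auto simp: S_def IB_def)
        then show "(x, w) \<in> (uadj S E)\<^sup>*" using stepS[OF step.hyps(1)] step.IH ay by blast
      qed
    qed
    then show ?thesis using v by (simp add: IB_def)
  qed
  have Sconn: "connected_on S E" by (rule connected_onI[of w]) (use connA connB in \<open>auto simp: S_def\<close>)
  have b3up: "(q, bj) \<in> E\<^sup>*" if "(q, b3) \<in> E\<^sup>*" for q using that bIB by (auto simp: IB_def)
  have cond1: "q \<notin> S \<and> (\<forall>s\<in>S - {b3}. (q, s) \<notin> E \<and> (s, q) \<notin> E)" if q: "(q, b3) \<in> E" for q
  proof -
    have lq: "lev q = lev a + 1" using lev[OF q] l by simp
    have qb: "(q, bj) \<in> E\<^sup>*" using q b3up by auto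
    have nqa: "(q, aj) \<notin> E\<^sup>*" using nocommon[of q] qb lq by auto
    have "q \<notin> S" using nqa levB[of q] lq l by (auto simp: S_def IA_def)
    moreover have "(q, s) \<notin> E" if s: "s \<in> S" "s \<noteq> b3" for s
    proof
      assume qs: "(q, s) \<in> E"
      have ls: "lev s = lev b3" using lev[OF qs] lq l by simp
      consider "s \<in> IA" | "s \<in> IB" | "s = w" using s(1) by (auto simp: S_def)
      then show False
      proof cases
        case 1 then have "(q, aj) \<in> E\<^sup>*" using qs by (auto simp: IA_def)
        then show False using nqa by simp
      next
        case 2
        then have "(b3, s) \<in> E\<^sup>*" by (simp add: IB_def)
        then obtain t where "(b3, t) \<in> E\<^sup>*" "(t, s) \<in> E" using s(2) by (metis rtranclE)
        then have "lev b3 + 1 \<le> lev s" using lev_rtrancl[of b3 t] lev[of t s] by simp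
        then show False using ls by simp
      next
        case 3 then show False using ls l by simp
      qed
    qed
    moreover have "(s, q) \<notin> E" if s: "s \<in> S" for s
    proof
      assume sq: "(s, q) \<in> E"
      have ls: "lev s = lev a" using lev[OF sq] lq by simp
      consider "s \<in> IA" | "s \<in> IB" | "s = w" using s(1) by (auto simp: S_def)
      then show False
      proof cases
        case 1 then have "(s, aj) \<in> E\<^sup>*" by (simp add: IA_def)
        moreover have "(s, bj) \<in> E\<^sup>*" using sq qb by (meson converse_rtrancl_into_rtrancl)
        ultimately show False using nocommon[of s] ls by simp
      next
        case 2 then show False using levB[of s] ls l by simp
      next
        case 3 then show False using ls l by simp
      qed
    qed
    ultimately show ?thesis by blast
  qed
  have cond2: "q \<notin> insert c S \<and> (\<forall>s\<in>insert c S - {c}. (q, s) \<notin> E \<and> (s, q) \<notin> E)"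
    if c: "(c, b3) \<in> E" and q: "(q, c) \<in> E" for c q
  proof -
    have lq: "lev q = lev a" using lev[OF c] lev[OF q] l by simp
    have "(q, b3) \<in> E\<^sup>*" using c q by auto
    then have nqa: "(q, aj) \<notin> E\<^sup>*" using nocommon[of q] b3up lq by auto
    have "q \<notin> insert c S" using nqa levB[of q] lq l lev[OF q] by (auto simp: S_def IA_def)
    moreover have "(q, s) \<notin> E" if s: "s \<in> S" for s
    proof
      assume qs: "(q, s) \<in> E"
      have ls: "lev s = lev a + 1" using lev[OF qs] lq by simp
      consider "s \<in> IA" | "s \<in> IB" | "s = w" using s(1) by (auto simp: S_def)
      then show False
      proof cases
        case 1 then have "(q, aj) \<in> E\<^sup>*" using qs by (auto simp: IA_def)
        then show False using nqa by simp
      next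
        case 2 then show False using levB[of s] ls l by simp
      next
        case 3 then show False using ls l by simp
      qed
    qed
    moreover have "(s, q) \<notin> E" if s: "s \<in> S" for s
    proof
      assume sq: "(s, q) \<in> E"
      have ls: "lev s = lev a - 1" using lev[OF sq] lq by simp
      then show False using s levA[of s] levB[of s] l by (auto simp: S_def)
    qed
    ultimately show ?thesis by blast
  qed
  \<comment> \<open>First \<open>b2\<close> is moved to \<open>c\<close> with \<open>S\<close>
    fixed, then the image of \<open>b\<close> is moved to \<open>b'\<close> with \<open>c\<close>
    fixed as well. The common in-neighbour \<open>z\<close> travels along while \<open>a\<close>
    stays in place.\<close>
  have cosib: "\<exists>y. (y, a) \<in> E \<and> (y, b') \<in> E" if c: "(c, b3) \<in> E" and b': "(b', c) \<in> E" for c b'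
  proof -
    have b3S: "b3 \<in> S" using bIB by (simp add: S_def)
    have "\<exists>g. aut g \<and> (\<forall>s\<in>S. g s = s) \<and> g b2 = c"
      by (rule move_leaf[OF SV Sfin Sconn b3S b3(1) _ _ c]) (use cond1[OF b3(1)] cond1[OF c] in blast)+
    then obtain g1 where g1: "aut g1" "\<forall>s\<in>S. g1 s = s" "g1 b2 = c" by blast
    have p: "(g1 b, c) \<in> E" using aut_arc[OF g1(1) b2(1)] g1(3) by simp
    have c1: "connected_on (insert c S) E"
    proof (rule connected_onI[of w])
      have "(v, w) \<in> (uadj (insert c S) E)\<^sup>*" if "v \<in> S" for v
        by (rule uadj_rtrancl_mono[of S]) (use that Sconn in \<open>auto simp: connected_on_def S_def\<close>)
      moreover have "(c, b3) \<in> uadj (insert c S) E" using c b3S by (auto simp: uadj_def)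
      ultimately show "(x, w) \<in> (uadj (insert c S) E)\<^sup>*" if "x \<in> insert c S" for x
        using that b3S by (metis converse_rtrancl_into_rtrancl insertE)
    qed (simp add: S_def)
    have "\<exists>g. aut g \<and> (\<forall>s\<in>insert c S. g s = s) \<and> g (g1 b) = b'"
    proof (rule move_leaf[OF _ _ c1, of c])
      show "insert c S \<subseteq> V" using SV arcV[OF c] by blast
      show "finite (insert c S)" using Sfin by simp
    qed (use p b' cond2[OF c p] cond2[OF c b'] in blast)+
    then obtain g2 where g2: "aut g2" "\<forall>s\<in>insert c S. g2 s = s" "g2 (g1 b) = b'" by blast
    have "a \<in> S" using aIA by (simp add: S_def)
    then have "(g2 (g1 z), a) \<in> E" "(g2 (g1 z), b') \<in> E"
      using aut_arc[OF g2(1) aut_arc[OF g1(1) zab(2)]] aut_arc[OF g2(1) aut_arc[OF g1(1) zab(3)]] g1 g2 by auto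
    then show ?thesis by blast
  qed
  let ?Y = "\<Union>c\<in>inn b3. inn c"
  have "card ?Y = (\<Sum>c\<in>inn b3. card (inn c))"
  proof (rule card_UN_disjoint)
    show "finite (inn b3)" using V by simp
    show "\<forall>c\<in>inn b3. finite (inn c)" using arcV by auto
    show "\<forall>c\<in>inn b3. \<forall>c'\<in>inn b3. c \<noteq> c' \<longrightarrow> inn c \<inter> inn c' = {}"
    proof (intro ballI impI, rule ccontr)
      fix c c' assume h: "c \<in> inn b3" "c' \<in> inn b3" "c \<noteq> c'" "inn c \<inter> inn c' \<noteq> {}"
      then obtain q where "(q, c) \<in> E" "(q, c') \<in> E" by auto
      then show False using not_confluentD[OF nc[of 1], of q c c' b3] h i by simp
    qed
  qed
  also have "\<dots> = (\<Sum>c\<in>inn b3. deg)" by (rule sum.cong) (use card_inn arcV in auto)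
  also have "\<dots> = deg * deg" using card_inn V by simp
  finally have cY: "card ?Y = deg * deg" .
  have "\<forall>b'\<in>?Y. \<exists>y. (y, a) \<in> E \<and> (y, b') \<in> E" using cosib by auto
  then obtain f where f: "\<And>b'. b' \<in> ?Y \<Longrightarrow> (f b', a) \<in> E \<and> (f b', b') \<in> E" by metis
  have "inj_on f ?Y"
  proof (rule inj_onI)
    fix p q assume pq: "p \<in> ?Y" "q \<in> ?Y" "f p = f q"
    then have "(p, b3) \<in> E ^^ 2" "(q, b3) \<in> E ^^ 2" by (auto simp: numeral_2_eq_2)
    then show "p = q" using not_confluentD[OF nc[of 2], of "f p" p q b3] f[OF pq(1)] f[OF pq(2)] pq(3) i by simp
  qed
  moreover have "f ` ?Y \<subseteq> inn a" by (rule image_subsetI) (use f in simp)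
  ultimately have "card ?Y \<le> card (inn a)" using V by (intro card_inj_on_le[of f]) auto
  then show False using cY card_inn V d2 by simp
qed

text \<open>All arcs into \<open>Q\<close> start in \<open>P\<close>, and every vertex receives and
  emits the same number \<open>deg\<close> of arcs.\<close>

lemma card_le_of_inn_subset:
  assumes "finite P" "P \<subseteq> V" "Q \<subseteq> V" "finite Q" "deg > 0" "\<And>w. w \<in> Q \<Longrightarrow> inn w \<subseteq> P"
  shows "card Q \<le> card P"
proof -
  have Q: "card (Sigma Q inn) = card Q * deg" using assms(3,4) card_inn by (subst card_SigmaI) (auto simp: subset_iff)
  have P: "card (Sigma P out) = card P * deg" using assms(1,2) card_out by (subst card_SigmaI) (auto simp: subset_iff)
  have "card (Sigma Q inn) \<le> card (Sigma P out)"
  proof (rule card_inj_on_le[of prod.swap])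
    show "prod.swap ` Sigma Q inn \<subseteq> Sigma P out"
    proof (rule image_subsetI)
      fix e assume "e \<in> Sigma Q inn"
      then obtain w x where "e = (w, x)" "w \<in> Q" "x \<in> inn w" by blast
      then show "prod.swap e \<in> Sigma P out" using assms(6)[of w] by auto
    qed
    show "finite (Sigma P out)" using assms(1,2) by (intro finite_SigmaI) auto
  qed simp
  then show ?thesis using P Q assms(5) by simp
qed

text \<open>Here \<open>u\<close> has \<open>d(d - 1)\<close> vertices sharing an in-neighbour with it and as many others sharing an
  out-neighbour, and all of them lie among at most \<open>d\<^sup>2\<close> three-step descendants of one vertex.\<close>

lemma no_second_confluence:
  assumes nc: "\<not> confluent 1" and c2: "confluent 2" and d2: "deg \<ge> 2"
  shows False
proof -
  have df: "x = x'" if "(u, x) \<in> E" "(u, x') \<in> E" "(x, w) \<in> E" "(x', w) \<in> E" for u x x' w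
    using not_confluentD[OF nc] that by auto
  obtain z0 a1 b1 w0 where ab: "a1 \<noteq> b1" "(z0, a1) \<in> E" "(z0, b1) \<in> E" "(a1, w0) \<in> E ^^ 2" "(b1, w0) \<in> E ^^ 2"
    using c2 by (auto simp: confluent_def)
  obtain a2 b2 where ab2: "(a1, a2) \<in> E" "(a2, w0) \<in> E" "(b1, b2) \<in> E" "(b2, w0) \<in> E"
    using ab(4,5) by (auto simp: numeral_2_eq_2)
  have ab2n: "a2 \<noteq> b2" using df ab ab2 by blast
  have V5: "a1 \<in> V" "a2 \<in> V" "w0 \<in> V" "b1 \<in> V" "b2 \<in> V" using ab2 arcV by blast+
  \<comment> \<open>Without diamonds the ends \<open>p\<close> and \<open>q\<close> differ and no
    arc runs crosswise; levels exclude all other arcs. So the five vertices induce a path.\<close>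
  have fork: "distinct [p,x,w,y,q]"
     "\<forall>s\<in>{p,x,w,y,q}. \<forall>t\<in>{p,x,w,y,q}. (s, t) \<in> E \<longleftrightarrow> (s = p \<and> t = x) \<or> (s = q \<and> t = y) \<or> (s = x \<and> t = w) \<or> (s = y \<and> t = w)"
    if k: "(p, x) \<in> E" "(x, w) \<in> E" "(y, w) \<in> E" "(q, y) \<in> E" "x \<noteq> y" for p x w y q
  proof -
    have l: "lev x = lev p + 1" "lev w = lev p + 2" "lev y = lev p + 1" "lev q = lev p"
      using lev[OF k(1)] lev[OF k(2)] lev[OF k(3)] lev[OF k(4)] by auto
    have n: "p \<noteq> q" using df k by blast
    have n2: "(p, y) \<notin> E" "(q, x) \<notin> E" using df k by blast+
    have n3: "p \<noteq> x" "p \<noteq> y" "p \<noteq> w" "q \<noteq> x" "q \<noteq> y" "q \<noteq> w" "x \<noteq> w" "y \<noteq> w" using l by auto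
    have "(s, t) \<in> E \<longleftrightarrow> (s = p \<and> t = x) \<or> (s = q \<and> t = y) \<or> (s = x \<and> t = w) \<or> (s = y \<and> t = w)"
      if st: "s \<in> {p,x,w,y,q}" "t \<in> {p,x,w,y,q}" for s t
    proof
      assume e: "(s, t) \<in> E"
      then have "lev t = lev s + 1" by (rule lev)
      then show "(s = p \<and> t = x) \<or> (s = q \<and> t = y) \<or> (s = x \<and> t = w) \<or> (s = y \<and> t = w)"
        using st l e n2 by auto
    qed (use k in auto)
    then show "\<forall>s\<in>{p,x,w,y,q}. \<forall>t\<in>{p,x,w,y,q}. (s, t) \<in> E \<longleftrightarrow> (s = p \<and> t = x) \<or> (s = q \<and> t = y) \<or> (s = x \<and> t = w) \<or> (s = y \<and> t = w)"
      by blast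
    show "distinct [p,x,w,y,q]" using n n3 k(5) by auto
  qed
  \<comment> \<open>Every fork is isomorphic to the one in the given confluence, whose ends have the
    common in-neighbour \<open>z0\<close>.\<close>
  have Q: "\<exists>z. (z, u) \<in> E \<and> (z, u') \<in> E"
    if k: "(u, x) \<in> E" "(x, w) \<in> E" "(x', w) \<in> E" "(u', x') \<in> E" "x \<noteq> x'" for u x w x' u'
  proof -
    note F1 = fork[OF ab2(1,2,4,3) ab2n] and F2 = fork[OF k]
    define f where "f t = (if t = a1 then u else if t = a2 then x else if t = w0 then w else if t = b2 then x' else u')" for t
    have fv: "f a1 = u" "f a2 = x" "f w0 = w" "f b2 = x'" "f b1 = u'" using F1(1) by (auto simp: f_def)
    let ?S = "{a1,a2,w0,b2,b1}"
    have "\<exists>g. aut g \<and> (\<forall>t\<in>?S. g t = f t)"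
    proof (rule extend)
      show "?S \<subseteq> V" using V5 by blast
      show "finite ?S" by simp
      have e: "(a1, a2) \<in> uadj ?S E" "(a2, w0) \<in> uadj ?S E" "(b1, b2) \<in> uadj ?S E" "(b2, w0) \<in> uadj ?S E"
        using ab2 by (auto simp: uadj_def)
      show "connected_on ?S E"
      proof (rule connected_onI[of w0])
        fix t assume "t \<in> ?S"
        moreover have "(a1, w0) \<in> (uadj ?S E)\<^sup>*" by (rule converse_rtrancl_into_rtrancl[OF e(1) r_into_rtrancl[OF e(2)]])
        moreover have "(b1, w0) \<in> (uadj ?S E)\<^sup>*" by (rule converse_rtrancl_into_rtrancl[OF e(3) r_into_rtrancl[OF e(4)]])
        moreover note r_into_rtrancl[OF e(2)] r_into_rtrancl[OF e(4)]
        ultimately show "(t, w0) \<in> (uadj ?S E)\<^sup>*" by blast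
      qed simp
      have fi: "(f s = u \<longleftrightarrow> s = a1) \<and> (f s = x \<longleftrightarrow> s = a2) \<and> (f s = w \<longleftrightarrow> s = w0) \<and> (f s = x' \<longleftrightarrow> s = b2) \<and> (f s = u' \<longleftrightarrow> s = b1)"
        if m: "s \<in> ?S" for s
      proof -
        have d: "distinct [u,x,w,x',u']" "distinct [a1,a2,w0,b2,b1]" by (rule F2(1), rule F1(1))
        consider "s = a1" | "s = a2" | "s = w0" | "s = b2" | "s = b1" using m by blast
        then show ?thesis by cases (use d fv in auto)
      qed
      show "inj_on f ?S"
      proof (rule inj_onI)
        fix s t assume m: "s \<in> ?S" "t \<in> ?S" "f s = f t"
        consider "s = a1" | "s = a2" | "s = w0" | "s = b2" | "s = b1" using m(1) by blast
        then show "s = t" using fi[OF m(2)] m(3) fv by metis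
      qed
      show "f ` ?S \<subseteq> V" using arcV[OF k(1)] arcV[OF k(2)] arcV[OF k(3)] arcV[OF k(4)] by (simp add: fv)
      fix s t assume st: "s \<in> ?S" "t \<in> ?S"
      have "f ` ?S \<subseteq> {u,x,w,x',u'}" by (simp add: fv)
      then have fS: "f s \<in> {u,x,w,x',u'}" "f t \<in> {u,x,w,x',u'}" using st by blast+
      have E1: "(s, t) \<in> E \<longleftrightarrow> (s = a1 \<and> t = a2) \<or> (s = b1 \<and> t = b2) \<or> (s = a2 \<and> t = w0) \<or> (s = b2 \<and> t = w0)"
        using F1(2)[rule_format, OF st] .
      have E2: "(f s, f t) \<in> E \<longleftrightarrow> (f s = u \<and> f t = x) \<or> (f s = u' \<and> f t = x') \<or> (f s = x \<and> f t = w) \<or> (f s = x' \<and> f t = w)"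
        using F2(2)[rule_format, OF fS] .
      show "(s, t) \<in> E \<longleftrightarrow> (f s, f t) \<in> E" unfolding E1 E2 using fi[OF st(1)] fi[OF st(2)] by blast
    qed
    then obtain g where g: "aut g" "\<forall>t\<in>?S. g t = f t" by blast
    then have "(g z0, u) \<in> E" "(g z0, u') \<in> E"
      using aut_arc[OF g(1) ab(2)] aut_arc[OF g(1) ab(3)] fv by auto
    then show ?thesis by blast
  qed
  define cosib where "cosib u = (\<Union>y\<in>inn u. out y) - {u}" for u
  define leaves where "leaves x w = (\<Union>x'\<in>inn w - {x}. inn x')" for x w
  \<comment> \<open>Without diamonds the sets \<open>inn x'\<close> are disjoint and give d(d-1)
    leaves, while the pairs of an in-neighbour of \<open>u\<close> and another of its out-neighbours
    bound \<open>cosib u\<close> by the same number. Equality identifies the two sets and makes the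
    common in-neighbour unique.\<close>
  have cL: "leaves x w = cosib u \<and> card (cosib u) = deg * (deg - 1) \<and> inj_on snd (Sigma (inn u) (\<lambda>y. out y - {u}))"
    if k: "(u, x) \<in> E" "(x, w) \<in> E" for u x w
  proof -
    have V: "u \<in> V" "x \<in> V" "w \<in> V" using k arcV by blast+
    have sub: "leaves x w \<subseteq> cosib u"
    proof
      fix u' assume "u' \<in> leaves x w"
      then have "\<exists>x'. (x', w) \<in> E \<and> x' \<noteq> x \<and> (u', x') \<in> E" by (auto simp: leaves_def)
      then obtain x' where x': "(x', w) \<in> E" "x' \<noteq> x" "(u', x') \<in> E" by blast
      then obtain z where "(z, u) \<in> E" "(z, u') \<in> E" using Q[of u x w x' u'] k by blast
      moreover have "u' \<noteq> u" using df k x' by blast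
      ultimately show "u' \<in> cosib u" by (auto simp: cosib_def)
    qed
    have "card (leaves x w) = (\<Sum>x'\<in>inn w - {x}. card (inn x'))" unfolding leaves_def
    proof (rule card_UN_disjoint)
      show "finite (inn w - {x})" using V by simp
      show "\<forall>i\<in>inn w - {x}. finite (inn i)" using arcV by auto
      show "\<forall>i\<in>inn w - {x}. \<forall>j\<in>inn w - {x}. i \<noteq> j \<longrightarrow> inn i \<inter> inn j = {}" using df by fastforce
    qed
    also have "\<dots> = (\<Sum>x'\<in>inn w - {x}. deg)" by (rule sum.cong) (use card_inn arcV in auto)
    also have "\<dots> = deg * (deg - 1)" using card_inn[OF V(3)] k V by (simp add: card_Diff_singleton)
    finally have c1: "card (leaves x w) = deg * (deg - 1)" .
    let ?P = "Sigma (inn u) (\<lambda>y. out y - {u})"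
    have Pf: "finite ?P" using V arcV by (intro finite_SigmaI) auto
    have "card ?P = (\<Sum>y\<in>inn u. card (out y - {u}))" using V arcV by (intro card_SigmaI) auto
    also have "\<dots> = (\<Sum>y\<in>inn u. deg - 1)" by (rule sum.cong) (use card_out arcV in \<open>auto simp: card_Diff_singleton\<close>)
    also have "\<dots> = deg * (deg - 1)" using card_inn[OF V(1)] by simp
    finally have c2: "card ?P = deg * (deg - 1)" .
    have im: "snd ` ?P = cosib u" by (force simp: cosib_def)
    have "finite (cosib u)" using Pf im by (metis finite_imageI)
    moreover have "card (cosib u) \<le> deg * (deg - 1)" using card_image_le[OF Pf, of snd] im c2 by simp
    ultimately have e: "leaves x w = cosib u" using sub c1 by (metis card_mono card_subset_eq le_antisym)
    then have "card (snd ` ?P) = card ?P" using im c1 c2 by simp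
    then have "inj_on snd ?P" using Pf by (rule eq_card_imp_inj_on[rotated])
    then show ?thesis using e c1 by simp
  qed
  \<comment> \<open>Each of the d-1 other out-neighbours of \<open>y\<close> is a leaf, so it points
    to one of the d-1 other in-neighbours of \<open>w\<close>. Without diamonds this choice is
    injective, hence onto.\<close>
  have full: "inn w \<subseteq> {x'. (y, x') \<in> E ^^ 2}" if k: "(y, u) \<in> E" "(u, x) \<in> E" "(x, w) \<in> E" for y u x w
  proof
    fix x' assume x': "x' \<in> inn w"
    have V: "y \<in> V" "w \<in> V" using k arcV by blast+
    show "x' \<in> {x'. (y, x') \<in> E ^^ 2}"
    proof (cases "x' = x")
      case True then show ?thesis using k by (auto simp: numeral_2_eq_2)
    next
      case False
      have "\<forall>s\<in>out y - {u}. \<exists>t. t \<in> inn w - {x} \<and> (s, t) \<in> E"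
      proof
        fix s assume "s \<in> out y - {u}"
        then have "s \<in> cosib u" using k by (auto simp: cosib_def)
        then have "s \<in> leaves x w" using cL[OF k(2,3)] by simp
        then show "\<exists>t. t \<in> inn w - {x} \<and> (s, t) \<in> E" by (auto simp: leaves_def)
      qed
      then obtain f where f: "\<And>s. s \<in> out y - {u} \<Longrightarrow> f s \<in> inn w - {x} \<and> (s, f s) \<in> E" by metis
      have "inj_on f (out y - {u})"
      proof (rule inj_onI)
        fix s t assume h: "s \<in> out y - {u}" "t \<in> out y - {u}" "f s = f t"
        then show "s = t" using df[of y s t "f s"] f[OF h(1)] f[OF h(2)] by auto
      qed
      then have "card (f ` (out y - {u})) = card (out y - {u})" by (rule card_image)
      also have "\<dots> = card (inn w - {x})" using card_out card_inn V k by (simp add: card_Diff_singleton)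
      finally have ce: "card (f ` (out y - {u})) = card (inn w - {x})" .
      have "f ` (out y - {u}) \<subseteq> inn w - {x}" by (rule image_subsetI) (use f in blast)
      then have "f ` (out y - {u}) = inn w - {x}" using ce V by (intro card_subset_eq) auto
      then obtain s where "s \<in> out y - {u}" "f s = x'" using x' False by (metis DiffI imageE singletonD)
      then show ?thesis using f[of s] by (auto simp: numeral_2_eq_2)
    qed
  qed
  obtain u where u: "u \<in> V" using conn by (auto simp: connected_on_def)
  obtain y2 where y2: "(y2, u) \<in> E" using exin[OF u] by blast
  obtain y1 where y1: "(y1, y2) \<in> E" using exin arcV[OF y2] by blast
  obtain y0 where y0: "(y0, y1) \<in> E" using exin arcV[OF y1] by blast
  have y0V: "y0 \<in> V" using arcV y0 by blast
  let ?X2 = "\<Union>s\<in>out y0. out s" and ?X3 = "\<Union>s\<in>out y0. \<Union>x\<in>out s. out x"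
  have X2: "{x'. (y, x') \<in> E ^^ 2} = (\<Union>s\<in>out y. out s)" for y by (auto simp: numeral_2_eq_2)
  have fX2: "finite ?X2" "?X2 \<subseteq> V" and fX3: "finite ?X3" "?X3 \<subseteq> V" using y0V arcV by auto
  have "card ?X2 \<le> (\<Sum>s\<in>out y0. card (out s))" using y0V by (intro card_UN_le) simp
  also have "\<dots> = (\<Sum>s\<in>out y0. deg)" by (rule sum.cong) (use card_out arcV in auto)
  finally have cX2: "card ?X2 \<le> deg * deg" using card_out[OF y0V] by simp
  \<comment> \<open>By \<open>full\<close>, all in-neighbours of a three-step descendant of
    \<open>y0\<close> are two-step descendants, so the arcs can be counted from both sides.\<close>
  have "card ?X3 \<le> card ?X2"
  proof (rule card_le_of_inn_subset[OF fX2 fX3(2,1)])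
    fix w assume "w \<in> ?X3"
    then obtain s x where "(y0, s) \<in> E" "(s, x) \<in> E" "(x, w) \<in> E" by auto
    then show "inn w \<subseteq> ?X2" using full[of y0 s x w] X2 by simp
  qed (use d2 in simp)
  then have cX3: "card ?X3 \<le> deg * deg" using cX2 by simp
  define sib where "sib = (\<Union>v\<in>out u. inn v) - {u}"
  have X3I: "r \<in> ?X3" if "(y0, s) \<in> E" "(s, t) \<in> E" "(t, r) \<in> E" for s t r
    using that by (intro UN_I[of s] UN_I[of t]) simp_all
  have uX: "u \<in> ?X3" by (rule X3I[OF y0 y1 y2])
  have "cosib u \<subseteq> ?X3"
  proof
    fix s assume "s \<in> cosib u"
    then obtain y where y: "(y, u) \<in> E" "(y, s) \<in> E" by (auto simp: cosib_def)
    then have "(y0, y) \<in> E ^^ 2" using full[OF y0 y1 y2] by auto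
    then obtain t where "(y0, t) \<in> E" "(t, y) \<in> E" by (auto simp: numeral_2_eq_2)
    then show "s \<in> ?X3" using X3I y(2) by blast
  qed
  moreover have "sib \<subseteq> ?X3"
  proof
    fix s assume "s \<in> sib"
    then obtain v where v: "(u, v) \<in> E" "(s, v) \<in> E" by (auto simp: sib_def)
    then have "(y1, s) \<in> E ^^ 2" using full[OF y1 y2 v(1)] by auto
    then obtain t where "(y1, t) \<in> E" "(t, s) \<in> E" by (auto simp: numeral_2_eq_2)
    then show "s \<in> ?X3" using X3I[OF y0] by blast
  qed
  ultimately have sub: "insert u (cosib u \<union> sib) \<subseteq> ?X3" using uX by blast
  obtain x w where xw: "(u, x) \<in> E" "(x, w) \<in> E" using exout u arcV by meson
  have cc: "card (cosib u) = deg * (deg - 1)" using cL[OF xw] by blast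
  let ?P = "Sigma (out u) (\<lambda>v. inn v - {u})"
  \<comment> \<open>If \<open>s\<close> shared both \<open>v\<close> and \<open>v'\<close> with
    \<open>u\<close>, then \<open>v\<close> and \<open>v'\<close> would have the two common
    in-neighbours \<open>u\<close> and \<open>s\<close>, against the uniqueness in \<open>cL\<close>
    at \<open>v\<close>.\<close>
  have "inj_on snd ?P"
  proof (rule inj_onI)
    fix p q assume pq: "p \<in> ?P" "q \<in> ?P" "snd p = snd q"
    obtain v v' s where e: "p = (v, s)" "q = (v', s)" using pq(3) by (metis prod.collapse)
    have h: "(u, v) \<in> E" "(u, v') \<in> E" "(s, v) \<in> E" "(s, v') \<in> E" "s \<noteq> u" using pq e by auto
    show "p = q"
    proof (rule ccontr)
      assume "p \<noteq> q"
      then have vv: "v \<noteq> v'" using e by simp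
      obtain x w where "(v, x) \<in> E" "(x, w) \<in> E" using exout arcV h(1) by meson
      then have I: "inj_on snd (Sigma (inn v) (\<lambda>y. out y - {v}))" using cL by blast
      have m: "(u, v') \<in> Sigma (inn v) (\<lambda>y. out y - {v})" "(s, v') \<in> Sigma (inn v) (\<lambda>y. out y - {v})"
        using h vv by auto
      have "(u, v') = (s, v')" by (rule inj_onD[OF I _ m]) simp
      then show False using h by simp
    qed
  qed
  then have "card (snd ` ?P) = card ?P" by (rule card_image)
  moreover have "snd ` ?P = sib" by (force simp: sib_def)
  moreover have "card ?P = deg * (deg - 1)"
  proof -
    have "card ?P = (\<Sum>v\<in>out u. card (inn v - {u}))" using u arcV by (intro card_SigmaI) auto
    also have "\<dots> = (\<Sum>v\<in>out u. deg - 1)" by (rule sum.cong) (use card_inn arcV in \<open>auto simp: card_Diff_singleton\<close>)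
    finally show ?thesis using card_out[OF u] by simp
  qed
  ultimately have cs: "card sib = deg * (deg - 1)" by simp
  have disj: "cosib u \<inter> sib = {}"
  proof (rule ccontr)
    assume "cosib u \<inter> sib \<noteq> {}"
    then obtain s y v where "(y, u) \<in> E" "(y, s) \<in> E" "(u, v) \<in> E" "(s, v) \<in> E" "s \<noteq> u" by (auto simp: cosib_def sib_def)
    then show False using df by blast
  qed
  have "finite (insert u (cosib u \<union> sib))" by (rule finite_subset[OF sub fX3(1)])
  then have fin: "finite (cosib u)" "finite sib" by simp_all
  have "u \<notin> cosib u \<union> sib" by (auto simp: cosib_def sib_def)
  then have "card (insert u (cosib u \<union> sib)) = 1 + 2 * (deg * (deg - 1))"
    using fin disj cc cs by (simp add: card_Un_disjoint)
  moreover have "card (insert u (cosib u \<union> sib)) \<le> card ?X3" using sub fX3(1) by (rule card_mono[rotated])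
  ultimately have le: "1 + 2 * (deg * (deg - 1)) \<le> deg * deg" using cX3 by simp
  \<comment> \<open>The left side exceeds the right by the square of \<open>deg - 1\<close>, which
    is positive here.\<close>
  obtain m where "deg = Suc (Suc m)" using d2 by (metis Suc_le_D numeral_2_eq_2 Suc_le_mono)
  then show False using le by simp
qed

lemma levels_complete:
  assumes "x \<in> V" "y \<in> V" "lev y = lev x + 1"
  shows "(x, y) \<in> E"
proof -
  have "out x \<noteq> {}" using exout[OF assms(1)] by auto
  then have "deg > 0" using card_out[OF assms(1)] finite_out[OF assms(1)] by (metis card_gt_0_iff)
  have "(\<exists>w. (p, w) \<in> E \<and> (q, w) \<in> E) \<longleftrightarrow> (\<exists>z. (z, p) \<in> E \<and> (z, q) \<in> E)" if "p \<noteq> q" for p q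
  proof (cases "deg \<ge> 2")
    case True
    define j where "j = (LEAST n. confluent n)"
    have j: "confluent j" unfolding j_def using confluent_exists[OF True] by (rule LeastI_ex)
    have nc: "\<not> confluent n" if "n < j" for n using that not_less_Least unfolding j_def by blast
    have "j \<noteq> 0"
    proof
      assume "j = 0" then show False using j by (auto simp: confluent_def)
    qed
    moreover have "\<not> j \<ge> 3" using no_late_confluence[OF nc j _ True] by blast
    moreover have "j \<noteq> 2" using no_second_confluence[OF nc _ True] j by auto
    ultimately have "j = 1" by linarith
    then show ?thesis using confluent_1_twins j that by blast
  next
    case False
    \<comment> \<open>With in-degree and out-degree 1, distinct vertices share no neighbour on the
      same side, so both sides of the equivalence are false.\<close>
    then have d: "deg = 1" using \<open>deg > 0\<close> by simp
    have "\<not> ((p, w) \<in> E \<and> (q, w) \<in> E)" for w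
    proof
      assume h: "(p, w) \<in> E \<and> (q, w) \<in> E"
      then have "card (inn w) = 1" using card_inn[of w] arcV[of p w] d by simp
      then obtain t where "inn w = {t}" by (auto simp: card_1_singleton_iff)
      then show False using h that by (metis in_inn singletonD)
    qed
    moreover have "\<not> ((w, p) \<in> E \<and> (w, q) \<in> E)" for w
    proof
      assume h: "(w, p) \<in> E \<and> (w, q) \<in> E"
      then have "card (out w) = 1" using card_out[of w] arcV[of w p] d by simp
      then obtain t where "out w = {t}" by (auto simp: card_1_singleton_iff)
      then show False using h that by (metis in_out singletonD)
    qed
    ultimately show ?thesis by blast
  qed
  then show ?thesis by (rule twins_complete[OF _ assms])
qed

end

section \<open>The digraphs J(r)\<close>

text \<open>\<open>J(r)\<close> without coordinates: levels may be arbitrary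
  \<open>r\<close>-element sets.\<close>

definition complete_levels :: "'a set \<Rightarrow> ('a \<times> 'a) set \<Rightarrow> ('a \<Rightarrow> int) \<Rightarrow> nat \<Rightarrow> bool" where
  "complete_levels V E lev r \<longleftrightarrow> E = {(x, y). x \<in> V \<and> y \<in> V \<and> lev y = lev x + 1} \<and>
     (\<forall>k. finite {v \<in> V. lev v = k} \<and> card {v \<in> V. lev v = k} = r)"

lemma isomorphic_J_imp_complete_levels:
  assumes "E \<subseteq> V \<times> V" "isomorphic V E (J_verts r) (J_arcs r)"
  shows "\<exists>lev. complete_levels V E lev r"
proof -
  obtain f where f: "bij_betw f V (J_verts r)" "\<And>x y. x \<in> V \<Longrightarrow> y \<in> V \<Longrightarrow> (x, y) \<in> E \<longleftrightarrow> (f x, f y) \<in> J_arcs r"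
    using assms(2) by (auto simp: isomorphic_def dg_iso_def)
  have fJ: "snd (f x) \<in> {1..r}" if "x \<in> V" for x using bij_betwE[OF f(1)] that by (force simp: J_verts_def)
  have "E = {(x, y). x \<in> V \<and> y \<in> V \<and> fst (f y) = fst (f x) + 1}"
  proof -
    have "(x, y) \<in> E \<longleftrightarrow> fst (f y) = fst (f x) + 1" if "x \<in> V" "y \<in> V" for x y
      using f(2)[OF that] fJ[OF that(1)] fJ[OF that(2)] by (auto simp: J_arcs_def split: prod.splits)
    then show ?thesis using assms(1) by auto
  qed
  moreover have "finite {v \<in> V. fst (f v) = k} \<and> card {v \<in> V. fst (f v) = k} = r" for k
  proof -
    have "f ` {v \<in> V. fst (f v) = k} = {k} \<times> {1..r}"
    proof (intro equalityI subsetI)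
      fix p assume "p \<in> f ` {v \<in> V. fst (f v) = k}"
      then show "p \<in> {k} \<times> {1..r}" using fJ by (auto simp: mem_Times_iff)
    next
      fix p assume p: "p \<in> {k} \<times> {1..r}"
      then have "p \<in> f ` V" using f(1) by (auto simp: bij_betw_def J_verts_def)
      then obtain x where "x \<in> V" "f x = p" by blast
      moreover have "fst p = k" using p by auto
      ultimately show "p \<in> f ` {v \<in> V. fst (f v) = k}" by blast
    qed
    moreover have i: "inj_on f {v \<in> V. fst (f v) = k}" using f(1) by (auto simp: bij_betw_def inj_on_def)
    ultimately have b: "bij_betw f {v \<in> V. fst (f v) = k} ({k} \<times> {1..r})" by (simp add: bij_betw_def)
    then have "finite {v \<in> V. fst (f v) = k}" by (simp add: bij_betw_finite)
    moreover have "card {v \<in> V. fst (f v) = k} = card ({k} \<times> {1..r})" by (rule bij_betw_same_card[OF b])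
    ultimately show ?thesis by simp
  qed
  ultimately show ?thesis unfolding complete_levels_def by (intro exI[of _ "\<lambda>v. fst (f v)"]) blast
qed

lemma complete_levels_imp_isomorphic_J:
  assumes "complete_levels V E lev r"
  shows "isomorphic V E (J_verts r) (J_arcs r)"
proof -
  have "\<exists>h. bij_betw h {v \<in> V. lev v = k} {1..r}" for k
    using assms unfolding complete_levels_def by (intro finite_same_card_bij) auto
  then obtain h where h: "\<And>k. bij_betw (h k) {v \<in> V. lev v = k} {1..r}" by metis
  define f where "f v = (lev v, h (lev v) v)" for v
  have hin: "h (lev v) v \<in> {1..r}" if "v \<in> V" for v using bij_betwE[OF h[of "lev v"]] that by blast
  have "inj_on f V"
  proof (rule inj_onI)
    fix x y assume xy: "x \<in> V" "y \<in> V" "f x = f y"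
    then have "inj_on (h (lev x)) {v \<in> V. lev v = lev x}" using h by (simp add: bij_betw_def)
    then show "x = y" using xy by (auto simp: f_def dest: inj_onD)
  qed
  moreover have "f ` V = J_verts r"
  proof (intro equalityI subsetI)
    fix p assume "p \<in> f ` V" then show "p \<in> J_verts r" using hin by (auto simp: f_def J_verts_def)
  next
    fix p assume "p \<in> J_verts r"
    then obtain k i where p: "p = (k, i)" "i \<in> {1..r}" by (auto simp: J_verts_def)
    then have "i \<in> h k ` {v \<in> V. lev v = k}" using h[of k] by (simp add: bij_betw_def)
    then show "p \<in> f ` V" using p by (auto simp: f_def)
  qed
  moreover have "(x, y) \<in> E \<longleftrightarrow> (f x, f y) \<in> J_arcs r" if "x \<in> V" "y \<in> V" for x y
    using assms that hin[OF that(1)] hin[OF that(2)] unfolding complete_levels_def f_def J_arcs_def by auto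
  ultimately show ?thesis unfolding isomorphic_def dg_iso_def bij_betw_def by blast
qed

text \<open>On a connected set an isomorphism shifts all levels by one constant \<open>d\<close>, so
  it uses equally many vertices of level \<open>k\<close> and of level \<open>k + d\<close>. The
  remainders are matched by arbitrary bijections, since any bijection shifting the levels by a
  constant preserves arcs.\<close>

lemma complete_levels_homogeneous:
  assumes c: "complete_levels V E lev r"
  shows "conn_homogeneous V E"
  unfolding conn_homogeneous_def
proof (intro allI impI, elim conjE)
  fix S T f
  assume S: "S \<subseteq> V" "finite S" "connected_on S (induced S E)" and T: "T \<subseteq> V" "finite T"
    and f: "dg_iso f S (induced S E) T (induced T E)"
  have E: "(x, y) \<in> E \<longleftrightarrow> lev y = lev x + 1" if "x \<in> V" "y \<in> V" for x y
    using c that by (auto simp: complete_levels_def)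
  have L: "finite {v \<in> V. lev v = k}" "card {v \<in> V. lev v = k} = r" for k
    using c by (auto simp: complete_levels_def)
  have fb: "bij_betw f S T" using f by (simp add: dg_iso_def)
  have fT: "f x \<in> T" if "x \<in> S" for x using fb that by (meson bij_betwE)
  have fE: "(x, y) \<in> E \<longleftrightarrow> (f x, f y) \<in> E" if "x \<in> S" "y \<in> S" for x y
    using f that fT by (auto simp: dg_iso_def induced_def)
  obtain a where a: "a \<in> S" using S(3) by (auto simp: connected_on_def)
  define d where "d = lev (f a) - lev a"
  have shift: "lev (f x) = lev x + d" if "x \<in> S" for x
  proof (rule connected_invariant[where P = "\<lambda>x. lev (f x) = lev x + d", OF S(3) a _ _ that])
    show "lev (f a) = lev a + d" by (simp add: d_def)
    fix x y assume "(x, y) \<in> uadj S (induced S E)" and e: "lev (f x) = lev x + d"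
    then have xy: "x \<in> S" "y \<in> S" and "(x, y) \<in> E \<or> (y, x) \<in> E" by (auto simp: uadj_def induced_def)
    then consider "lev y = lev x + 1" "lev (f y) = lev (f x) + 1" | "lev x = lev y + 1" "lev (f x) = lev (f y) + 1"
      using fE[OF xy] fE[OF xy(2,1)] E S(1) T(1) fT by (metis subsetD)
    then show "lev (f y) = lev y + d" using e by cases auto
  qed
  let ?A = "\<lambda>k. {v \<in> V. lev v = k} - S" and ?B = "\<lambda>k. {v \<in> V. lev v = k + d} - T"
  have "\<exists>h. bij_betw h (?A k) (?B k)" for k
  proof (rule finite_same_card_bij)
    show "finite (?A k)" "finite (?B k)" using L by auto
    let ?S = "{v \<in> V. lev v = k} \<inter> S" and ?T = "{v \<in> V. lev v = k + d} \<inter> T"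
    have "f ` ?S = ?T"
    proof (intro equalityI subsetI)
      fix y assume "y \<in> f ` ?S" then show "y \<in> ?T" using shift fT T(1) by auto
    next
      fix y assume y: "y \<in> ?T"
      then obtain x where x: "x \<in> S" "f x = y" using fb by (auto simp: bij_betw_def)
      then have "lev x = k" using shift[OF x(1)] y by simp
      then show "y \<in> f ` ?S" using x S(1) by blast
    qed
    moreover have "inj_on f ?S" using fb by (auto simp: bij_betw_def inj_on_def)
    ultimately have "card ?S = card ?T" by (metis card_image)
    then show "card (?A k) = card (?B k)" using L by (simp add: card_Diff_subset_Int)
  qed
  then obtain h where h: "\<And>k. bij_betw (h k) (?A k) (?B k)" by metis
  define g where "g v = (if v \<in> S then f v else h (lev v) v)" for v
  have gS: "g v = f v" if "v \<in> S" for v using that by (simp add: g_def)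
  have gN: "g v = h (lev v) v" "g v \<in> ?B (lev v)" if "v \<in> V" "v \<notin> S" for v
    using bij_betwE[OF h[of "lev v"]] that by (auto simp: g_def)
  have glev: "g v \<in> V \<and> lev (g v) = lev v + d" if "v \<in> V" for v
    using that gN[of v] gS[of v] shift[of v] fT[of v] T(1) by (cases "v \<in> S") auto
  have gT: "g v \<in> T \<longleftrightarrow> v \<in> S" if "v \<in> V" for v
    using that gN[of v] gS[of v] fT[of v] by (cases "v \<in> S") auto
  have "inj_on g V"
  proof (rule inj_onI)
    fix x y assume xy: "x \<in> V" "y \<in> V" "g x = g y"
    have l: "lev x = lev y" using glev[OF xy(1)] glev[OF xy(2)] xy(3) by simp
    have s: "x \<in> S \<longleftrightarrow> y \<in> S" using gT[OF xy(1)] gT[OF xy(2)] xy(3) by simp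
    show "x = y"
    proof (cases "x \<in> S")
      case True
      then have "f x = f y" using s xy(3) gS by simp
      then show ?thesis using True s fb by (meson bij_betw_def inj_onD)
    next
      case False
      then have "h (lev x) x = h (lev x) y" using s xy gN(1) l by simp
      moreover have "x \<in> ?A (lev x)" "y \<in> ?A (lev x)" using False s xy l by auto
      ultimately show ?thesis using h[of "lev x"] by (meson bij_betw_def inj_onD)
    qed
  qed
  moreover have "g ` V = V"
  proof (intro equalityI subsetI)
    fix y assume "y \<in> g ` V" then show "y \<in> V" using glev by blast
  next
    fix y assume y: "y \<in> V"
    show "y \<in> g ` V"
    proof (cases "y \<in> T")
      case True
      then obtain x where "x \<in> S" "f x = y" using fb by (auto simp: bij_betw_def)
      then show ?thesis using gS[of x] S(1) by (metis image_eqI subsetD)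
    next
      case False
      define k where "k = lev y - d"
      have "y \<in> ?B k" using False y by (simp add: k_def)
      then obtain x where x: "x \<in> ?A k" "h k x = y" using h[of k] by (metis (no_types, lifting) bij_betw_def imageE)
      then have "g x = y" using gN(1)[of x] by auto
      then show ?thesis using x by blast
    qed
  qed
  moreover have "(x, y) \<in> E \<longleftrightarrow> (g x, g y) \<in> E" if "x \<in> V" "y \<in> V" for x y
    using E that glev[OF that(1)] glev[OF that(2)] by auto
  ultimately have "dg_iso g V E V E" by (simp add: dg_iso_def bij_betw_def)
  then show "\<exists>g. dg_iso g V E V E \<and> (\<forall>x\<in>S. g x = f x)" using gS by blast
qed

text \<open>The out-neighbours of a vertex form the entire next level, which therefore has
  \<open>deg\<close> elements; following arcs up and down from one vertex shows that no level is
  empty.\<close>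

lemma (in graded_digraph) complete_levels_deg: "complete_levels V E lev deg"
proof -
  have all: "\<exists>v\<in>V. lev v = k" for k
  proof -
    obtain u where u: "u \<in> V" using conn by (auto simp: connected_on_def)
    have up: "\<exists>v\<in>V. lev v = lev u + int n" for n
    proof (induction n)
      case 0 show ?case using u by auto
    next
      case (Suc n)
      then obtain v where v: "v \<in> V" "lev v = lev u + int n" by blast
      obtain w where "(v, w) \<in> E" using exout v by blast
      then show ?case using lev[of v w] arcV v by (intro bexI[of _ w]) auto
    qed
    have down: "\<exists>v\<in>V. lev v = lev u - int n" for n
    proof (induction n)
      case 0 show ?case using u by auto
    next
      case (Suc n)
      then obtain v where v: "v \<in> V" "lev v = lev u - int n" by blast
      obtain w where "(w, v) \<in> E" using exin v by blast
      then show ?case using lev[of w v] arcV v by (intro bexI[of _ w]) auto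
    qed
    show ?thesis using up[of "nat (k - lev u)"] down[of "nat (lev u - k)"] by (cases "k \<ge> lev u") auto
  qed
  have "card {v \<in> V. lev v = k} = deg" for k
  proof -
    obtain u where u: "u \<in> V" "lev u = k - 1" using all by blast
    have "(u, v) \<in> E \<longleftrightarrow> v \<in> V \<and> lev v = k" for v
      using levels_complete[OF u(1), of v] u(2) lev[of u v] arcV[of u v] by auto
    then have "out u = {v \<in> V. lev v = k}" unfolding out_def by (intro Collect_cong)
    then show ?thesis using card_out[OF u(1)] by metis
  qed
  moreover have "(x, y) \<in> E \<longleftrightarrow> x \<in> V \<and> y \<in> V \<and> lev y = lev x + 1" for x y
    using levels_complete[of x y] lev[of x y] arcV[of x y] by blast
  then have "E = {(x, y). x \<in> V \<and> y \<in> V \<and> lev y = lev x + 1}" by auto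
  ultimately show ?thesis unfolding complete_levels_def using level_finite by blast
qed

theorem theorem6p2:
  fixes V :: "'a set" and E :: "('a \<times> 'a) set"
  assumes "digraph V E"
    and "connected_on V E"
    and "locally_finite V E"
    and "card (ends V E) = 2"
  shows "conn_homogeneous V E \<longleftrightarrow> (\<exists>r::nat. isomorphic V E (J_verts r) (J_arcs r))"
proof
  assume "conn_homogeneous V E"
  then interpret homog_digraph V E using assms by unfold_locales
  obtain lev :: "'a \<Rightarrow> int" where "\<And>x y. (x, y) \<in> E \<Longrightarrow> lev y = lev x + 1" "\<And>k. finite {v \<in> V. lev v = k}"
    "\<exists>x y. (x, y) \<in> E" using graded[OF assms(4)] by blast
  then interpret graded_digraph V E lev by unfold_locales
  show "\<exists>r. isomorphic V E (J_verts r) (J_arcs r)"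
    using complete_levels_imp_isomorphic_J[OF complete_levels_deg] by blast
next
  assume "\<exists>r. isomorphic V E (J_verts r) (J_arcs r)"
  then obtain r where "isomorphic V E (J_verts r) (J_arcs r)" by blast
  moreover have "E \<subseteq> V \<times> V" using assms(1) by (simp add: digraph_def)
  ultimately show "conn_homogeneous V E"
    using isomorphic_J_imp_complete_levels complete_levels_homogeneous by blast
qed

end
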